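(* The adjunction between $\mathrm{Alg}(\mathcal{E})$ and $\mathbf{EMod}^{\mathrm{op}}$ given by the functors $\mathrm{Alg}(\mathcal{E})(-,[0,1]):\mathrm{Alg}(\mathcal{E})\to\mathbf{EMod}^{\mathrm{op}}$ (left adjoint) and $\mathbf{EMod}(-,[0,1]):\mathbf{EMod}^{\mathrm{op}}\to\mathrm{Alg}(\mathcal{E})$ (right adjoint) restricts to an equivalence of categories $\mathrm{Alg}_{\mathrm{obs}}(\mathcal{E})\simeq\mathbf{BEMod}^{\mathrm{op}}$ between observable $\mathcal{E}$-algebras and the opposite of the category of Banach effect modules. Combined with the isomorphism between observable $\mathcal{E}$-algebras and observable convex compact Hausdorff spaces, one obtains $$\mathbf{CCH}_{\mathrm{obs}}\;\cong\;\mathrm{Alg}_{\mathrm{obs}}(\mathcal{E})\;\simeq\;\mathbf{BEMod}^{\mathrm{op}}.$$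
   Context: Effect algebra: a set $E$ with a partial commutative associative operation $\oplus$ with neutral element $0$ and a map $(-)^\perp$ such that, with $1:=0^\perp$, $x^\perp$ is the unique element with $x\oplus x^\perp=1$, and $x\oplus 1$ is defined only if $x=0$; it is ordered by $x\le y$ iff $x\oplus z=y$ for some $z$. Effect module: an effect algebra with scalar multiplication $[0,1]\times E\to E$ with $1x=x$, $(rs)x=r(sx)$, $(r+s)x=rx\oplus sx$ if $r+s\le1$, and $r(x\oplus y)=rx\oplus ry$ if $x\oplus y$ is defined. Category $\mathbf{EMod}$: maps preserve $1$, defined sums $\oplus$, and scalar multiplication. For a set $X$, $[0,1]^X$ is an effect module pointwise. An effect module is Archimedean if $x\le y$ whenever $\frac12x\le\frac12y\oplus\frac r2 1$ for all $r\in(0,1]$. An Archimedean effect module has the metric $d(x,y)=\max\big(\inf\{r\in(0,1]\mid\frac12x\le\frac12y\oplus\frac r21\},\inf\{r\in(0,1]\mid\frac12y\le\frac12x\oplus\frac r21\}\big)$. A Banach effect module is an Archimedean effect module that is complete in this metric; $\mathbf{BEMod}\hookrightarrow\mathbf{EMod}$ is the full subcategory of these. Expectation monad on $\mathbf{Sets}$: $\mathcal{E}(X)=\mathbf{EMod}([0,1]^X,[0,1])$, $\mathcal{E}(f)(h)(p)=h(p\circ f)$, unit $\eta(x)(p)=p(x)$, multiplication $\mu(h)(p)=h(\lambda k\in\mathcal{E}(X).\,k(p))$. $\mathrm{Alg}(\mathcal{E})$ is its category of Eilenberg-Moore algebras. $\mathcal{D}$ is the finitely supported discrete probability distribution monad;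 its algebras are convex sets, its algebra maps affine functions. $\mathcal{UF}$ is the ultrafilter monad; its algebras are compact Hausdorff spaces with continuous maps (for an algebra $a$, $U$ is closed iff $U\in\mathcal{F}\Rightarrow a(\mathcal{F})\in U$ for all ultrafilters $\mathcal{F}$). Maps of monads $\sigma:\mathcal{D}\Rightarrow\mathcal{E}$, $\sigma(\varphi)(p)=\sum_x\varphi(x)p(x)$, and $\tau:\mathcal{UF}\Rightarrow\mathcal{E}$, $\tau(\mathcal{F})(p)=\inf\{s\in[0,1]\mid\{x\mid p(x)\le s\}\in\mathcal{F}\}$, turn each $\mathcal{E}$-algebra $\alpha:\mathcal{E}(X)\to X$ into a convex set via $\alpha\circ\sigma$ and a compact Hausdorff space via $\alpha\circ\tau$. $\mathbf{CCH}$: sets with a convex structure and a compact Hausdorff topology, with affine continuous maps. $X\in\mathbf{CCH}$ is observable if the affine continuous maps $X\to[0,1]$ separate points; $\mathbf{CCH}_{\mathrm{obs}}$ is the full subcategory of these. An $\mathcal{E}$-algebra is observable if its underlying object of $\mathbf{CCH}$ is; $\mathrm{Alg}_{\mathrm{obs}}(\mathcal{E})\hookrightarrow\mathrm{Alg}(\mathcal{E})$ is the full subcategory of these. The functors: $[0,1]$ carries the $\mathcal{E}$-algebra $h\mapsto h(\mathrm{id})$; $\mathrm{Alg}(\mathcal{E})(X,[0,1])$ is the set of algebra maps $X\to[0,1]$, equivalently affine continuous maps, a sub-effect module of $[0,1]^X$. For an effect module $M$, $\mathbf{EMod}(M,[0,1])$ carries the $\mathcal{E}$-algebra $\alpha_M(h)(y)=h(\lambda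 k.\,k(y))$. Both functors act on maps by precomposition; unit and counit are point evaluations. *)

theory Defs
  imports "HOL-Probability.Probability"
begin

section \<open>Effect modules\<close>

text \<open>
  Structures have an explicit carrier inside a type. A partial sum is an option-valued operation,
  with None for undefined; nothing is said about the operations outside the carrier.
\<close>

record 'a effect_algebra =
  ecarrier :: "'a set"
  ezero :: 'a
  esum :: "'a \<Rightarrow> 'a \<Rightarrow> 'a option"
  ecompl :: "'a \<Rightarrow> 'a"

record 'a emod = "'a effect_algebra" +
  escale :: "real \<Rightarrow> 'a \<Rightarrow> 'a"

definition eone :: "('a, 'm) effect_algebra_scheme \<Rightarrow> 'a" where
  "eone M = ecompl M (ezero M)"

text \<open>
  In the first two laws below, equality of options also says that one side is defined
  if and only if the other is.
\<close>

locale effect_algebra =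
  fixes M :: "('a, 'm) effect_algebra_scheme"
  assumes zero_closed: "ezero M \<in> ecarrier M"
    and compl_closed: "x \<in> ecarrier M \<Longrightarrow> ecompl M x \<in> ecarrier M"
    and sum_closed: "\<lbrakk>x \<in> ecarrier M; y \<in> ecarrier M; esum M x y = Some z\<rbrakk> \<Longrightarrow> z \<in> ecarrier M"
    and sum_commute: "\<lbrakk>x \<in> ecarrier M; y \<in> ecarrier M\<rbrakk> \<Longrightarrow> esum M x y = esum M y x"
    and sum_assoc: "\<lbrakk>x \<in> ecarrier M; y \<in> ecarrier M; z \<in> ecarrier M\<rbrakk> \<Longrightarrow>
      Option.bind (esum M x y) (\<lambda>u. esum M u z) = Option.bind (esum M y z) (\<lambda>v. esum M x v)"
    and sum_zero: "x \<in> ecarrier M \<Longrightarrow> esum M x (ezero M) = Some x"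
    and sum_compl: "x \<in> ecarrier M \<Longrightarrow> esum M x (ecompl M x) = Some (eone M)"
    and compl_unique: "\<lbrakk>x \<in> ecarrier M; y \<in> ecarrier M; esum M x y = Some (eone M)\<rbrakk> \<Longrightarrow> y = ecompl M x"
    and sum_one: "\<lbrakk>x \<in> ecarrier M; esum M x (eone M) \<noteq> None\<rbrakk> \<Longrightarrow> x = ezero M"

definition ele :: "('a, 'm) effect_algebra_scheme \<Rightarrow> 'a \<Rightarrow> 'a \<Rightarrow> bool" where
  "ele M x y \<longleftrightarrow> (\<exists>z\<in>ecarrier M. esum M x z = Some y)"

locale effect_module = effect_algebra M for M :: "('a, 'm) emod_scheme" +
  assumes scale_closed: "\<lbrakk>r \<in> {0..1}; x \<in> ecarrier M\<rbrakk> \<Longrightarrow> escale M r x \<in> ecarrier M"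
    and scale_one: "x \<in> ecarrier M \<Longrightarrow> escale M 1 x = x"
    and scale_scale: "\<lbrakk>r \<in> {0..1}; s \<in> {0..1}; x \<in> ecarrier M\<rbrakk> \<Longrightarrow>
      escale M (r * s) x = escale M r (escale M s x)"
    and scale_add_left: "\<lbrakk>r \<in> {0..1}; s \<in> {0..1}; r + s \<le> 1; x \<in> ecarrier M\<rbrakk> \<Longrightarrow>
      esum M (escale M r x) (escale M s x) = Some (escale M (r + s) x)"
    and scale_add_right: "\<lbrakk>r \<in> {0..1}; x \<in> ecarrier M; y \<in> ecarrier M; esum M x y = Some z\<rbrakk> \<Longrightarrow>
      esum M (escale M r x) (escale M r y) = Some (escale M r z)"

definition EMod :: "'a emod set" where
  "EMod = {M. effect_module M}"

text \<open>Morphisms are extensional on the carrier, so that they form hom-sets of functions.\<close>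

definition EMod_hom :: "'a emod \<Rightarrow> 'b emod \<Rightarrow> ('a \<Rightarrow> 'b) set" where
  "EMod_hom M N = {f \<in> ecarrier M \<rightarrow>\<^sub>E ecarrier N.
     f (eone M) = eone N \<and>
     (\<forall>x\<in>ecarrier M. \<forall>y\<in>ecarrier M. \<forall>z. esum M x y = Some z \<longrightarrow> esum N (f x) (f y) = Some (f z)) \<and>
     (\<forall>r\<in>{0..1}. \<forall>x\<in>ecarrier M. f (escale M r x) = escale N r (f x))}"

definition EMod_iso :: "'a emod \<Rightarrow> 'b emod \<Rightarrow> ('a \<Rightarrow> 'b) \<Rightarrow> bool" where
  "EMod_iso M N f \<longleftrightarrow> f \<in> EMod_hom M N \<and>
     (\<exists>g\<in>EMod_hom N M. compose (ecarrier M) g f = (\<lambda>x\<in>ecarrier M. x) \<and>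
                        compose (ecarrier N) f g = (\<lambda>y\<in>ecarrier N. y))"

definition unit_emod :: "real emod" where
  "unit_emod = \<lparr>ecarrier = {0..1}, ezero = 0,
     esum = (\<lambda>r s. if r + s \<le> 1 then Some (r + s) else None),
     ecompl = (\<lambda>r. 1 - r), escale = (\<lambda>r s. r * s)\<rparr>"

definition pow_emod :: "'a set \<Rightarrow> ('a \<Rightarrow> real) emod" where
  "pow_emod X = \<lparr>ecarrier = X \<rightarrow>\<^sub>E {0..1}, ezero = (\<lambda>x\<in>X. 0),
     esum = (\<lambda>p q. if \<forall>x\<in>X. p x + q x \<le> 1 then Some (\<lambda>x\<in>X. p x + q x) else None),
     ecompl = (\<lambda>p. \<lambda>x\<in>X. 1 - p x), escale = (\<lambda>r p. \<lambda>x\<in>X. r * p x)\<rparr>"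


section \<open>Banach effect modules\<close>

text \<open>\<open>half_le M r x y\<close> is the relation \<open>x/2 \<le> y/2 \<oplus> (r/2) 1\<close>.\<close>

definition half_le :: "'a emod \<Rightarrow> real \<Rightarrow> 'a \<Rightarrow> 'a \<Rightarrow> bool" where
  "half_le M r x y \<longleftrightarrow>
     (\<exists>z. esum M (escale M (1/2) y) (escale M (r/2) (eone M)) = Some z \<and> ele M (escale M (1/2) x) z)"

definition archimedean :: "'a emod \<Rightarrow> bool" where
  "archimedean M \<longleftrightarrow>
     (\<forall>x\<in>ecarrier M. \<forall>y\<in>ecarrier M. (\<forall>r\<in>{0<..1}. half_le M r x y) \<longrightarrow> ele M x y)"

text \<open>The value 0 outside the carrier is needed because \<^locale>\<open>Metric_space\<close> asks for
  nonnegativity and symmetry on the whole type.\<close>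

definition edist :: "'a emod \<Rightarrow> 'a \<Rightarrow> 'a \<Rightarrow> real" where
  "edist M x y = (if x \<in> ecarrier M \<and> y \<in> ecarrier M
     then max (Inf {r \<in> {0<..1}. half_le M r x y}) (Inf {r \<in> {0<..1}. half_le M r y x})
     else 0)"

definition BEMod :: "'a emod set" where
  "BEMod = {M \<in> EMod. archimedean M \<and> Metric_space.mcomplete (ecarrier M) (edist M)}"


section \<open>The expectation monad and its algebras\<close>

definition Exp :: "'a set \<Rightarrow> (('a \<Rightarrow> real) \<Rightarrow> real) set" where
  "Exp X = EMod_hom (pow_emod X) unit_emod"

definition Exp_map :: "'a set \<Rightarrow> 'b set \<Rightarrow> ('a \<Rightarrow> 'b) \<Rightarrow> (('a \<Rightarrow> real) \<Rightarrow> real) \<Rightarrow> (('b \<Rightarrow> real) \<Rightarrow> real)" where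
  "Exp_map X Y f h = (\<lambda>p \<in> Y \<rightarrow>\<^sub>E {0..1}. h (compose X p f))"

definition Exp_unit :: "'a set \<Rightarrow> 'a \<Rightarrow> (('a \<Rightarrow> real) \<Rightarrow> real)" where
  "Exp_unit X x = (\<lambda>p \<in> X \<rightarrow>\<^sub>E {0..1}. p x)"

definition Exp_mult :: "'a set \<Rightarrow> ((((('a \<Rightarrow> real) \<Rightarrow> real) \<Rightarrow> real) \<Rightarrow> real)) \<Rightarrow> (('a \<Rightarrow> real) \<Rightarrow> real)" where
  "Exp_mult X h = (\<lambda>p \<in> X \<rightarrow>\<^sub>E {0..1}. h (\<lambda>k \<in> Exp X. k p))"

record 'a ealg =
  acarrier :: "'a set"
  astruct :: "(('a \<Rightarrow> real) \<Rightarrow> real) \<Rightarrow> 'a"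

definition Alg :: "'a ealg set" where
  "Alg = {A. astruct A \<in> Exp (acarrier A) \<rightarrow>\<^sub>E acarrier A \<and>
     (\<forall>x\<in>acarrier A. astruct A (Exp_unit (acarrier A) x) = x) \<and>
     (\<forall>h\<in>Exp (Exp (acarrier A)).
        astruct A (Exp_mult (acarrier A) h) =
        astruct A (Exp_map (Exp (acarrier A)) (acarrier A) (astruct A) h))}"

definition Alg_hom :: "'a ealg \<Rightarrow> 'b ealg \<Rightarrow> ('a \<Rightarrow> 'b) set" where
  "Alg_hom A B = {f \<in> acarrier A \<rightarrow>\<^sub>E acarrier B.
     \<forall>h\<in>Exp (acarrier A). f (astruct A h) = astruct B (Exp_map (acarrier A) (acarrier B) f h)}"

definition Alg_iso :: "'a ealg \<Rightarrow> 'b ealg \<Rightarrow> ('a \<Rightarrow> 'b) \<Rightarrow> bool" where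
  "Alg_iso A B f \<longleftrightarrow> f \<in> Alg_hom A B \<and>
     (\<exists>g\<in>Alg_hom B A. compose (acarrier A) g f = (\<lambda>x\<in>acarrier A. x) \<and>
                       compose (acarrier B) f g = (\<lambda>y\<in>acarrier B. y))"

definition unit_alg :: "real ealg" where
  "unit_alg = \<lparr>acarrier = {0..1}, astruct = (\<lambda>h \<in> Exp {0..1}. h (\<lambda>x\<in>{0..1}. x))\<rparr>"


section \<open>Convex compact Hausdorff spaces\<close>

text \<open>
  The distribution monad on \<open>X\<close>: finitely supported probability mass functions supported in \<open>X\<close>,
  with \<^const>\<open>return_pmf\<close>, \<^const>\<open>join_pmf\<close> and \<^const>\<open>map_pmf\<close> as unit, multiplication and
  functor action.
\<close>

definition Distr :: "'a set \<Rightarrow> 'a pmf set" where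
  "Distr X = {\<phi>. finite (set_pmf \<phi>) \<and> set_pmf \<phi> \<subseteq> X}"

definition convex_structure :: "'a set \<Rightarrow> ('a pmf \<Rightarrow> 'a) \<Rightarrow> bool" where
  "convex_structure X c \<longleftrightarrow> c \<in> Distr X \<rightarrow>\<^sub>E X \<and>
     (\<forall>x\<in>X. c (return_pmf x) = x) \<and>
     (\<forall>\<Phi>\<in>Distr (Distr X). c (join_pmf \<Phi>) = c (map_pmf c \<Phi>))"

text \<open>An ultrafilter on the subset \<open>X\<close> is an ultrafilter on the type that contains \<open>X\<close>.\<close>

definition ultrafilters :: "'a set \<Rightarrow> 'a filter set" where
  "ultrafilters X = {F. F \<noteq> bot \<and> eventually (\<lambda>x. x \<in> X) F \<and>
     (\<forall>P. eventually P F \<or> eventually (\<lambda>x. \<not> P x) F)}"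

text \<open>\<open>U\<close> is open iff its complement \<open>X - U\<close> is closed in the sense of ultrafilter algebras.\<close>

definition uf_topology :: "'a set \<Rightarrow> ('a filter \<Rightarrow> 'a) \<Rightarrow> 'a topology" where
  "uf_topology X a = topology (\<lambda>U. U \<subseteq> X \<and>
     (\<forall>F\<in>ultrafilters X. eventually (\<lambda>x. x \<in> X - U) F \<longrightarrow> a F \<in> X - U))"

record 'a cch =
  ccarrier :: "'a set"
  cconv :: "'a pmf \<Rightarrow> 'a"
  ctop :: "'a topology"

definition CCH :: "'a cch set" where
  "CCH = {X. convex_structure (ccarrier X) (cconv X) \<and>
     topspace (ctop X) = ccarrier X \<and> compact_space (ctop X) \<and> Hausdorff_space (ctop X)}"

definition CCH_hom :: "'a cch \<Rightarrow> 'b cch \<Rightarrow> ('a \<Rightarrow> 'b) set" where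
  "CCH_hom X Y = {f \<in> ccarrier X \<rightarrow>\<^sub>E ccarrier Y.
     (\<forall>\<phi>\<in>Distr (ccarrier X). f (cconv X \<phi>) = cconv Y (map_pmf f \<phi>)) \<and>
     continuous_map (ctop X) (ctop Y) f}"

definition unit_cch :: "real cch" where
  "unit_cch = \<lparr>ccarrier = {0..1},
     cconv = (\<lambda>\<phi> \<in> Distr {0..1}. \<Sum>x\<in>set_pmf \<phi>. pmf \<phi> x * x),
     ctop = top_of_set {0..1}\<rparr>"

definition observable :: "'a cch \<Rightarrow> bool" where
  "observable X \<longleftrightarrow> (\<forall>x\<in>ccarrier X. \<forall>y\<in>ccarrier X. x \<noteq> y \<longrightarrow> (\<exists>f\<in>CCH_hom X unit_cch. f x \<noteq> f y))"

definition CCH_obs :: "'a cch set" where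
  "CCH_obs = {X \<in> CCH. observable X}"


section \<open>From algebras of the expectation monad to convex compact Hausdorff spaces\<close>

definition distr_to_Exp :: "'a set \<Rightarrow> 'a pmf \<Rightarrow> (('a \<Rightarrow> real) \<Rightarrow> real)" where
  "distr_to_Exp X \<phi> = (\<lambda>p \<in> X \<rightarrow>\<^sub>E {0..1}. \<Sum>x\<in>set_pmf \<phi>. pmf \<phi> x * p x)"

definition uf_to_Exp :: "'a set \<Rightarrow> 'a filter \<Rightarrow> (('a \<Rightarrow> real) \<Rightarrow> real)" where
  "uf_to_Exp X F = (\<lambda>p \<in> X \<rightarrow>\<^sub>E {0..1}. Inf {s \<in> {0..1}. eventually (\<lambda>x. p x \<le> s) F})"

definition cch_of_alg :: "'a ealg \<Rightarrow> 'a cch" where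
  "cch_of_alg A = \<lparr>ccarrier = acarrier A,
     cconv = (\<lambda>\<phi> \<in> Distr (acarrier A). astruct A (distr_to_Exp (acarrier A) \<phi>)),
     ctop = uf_topology (acarrier A) (\<lambda>F. astruct A (uf_to_Exp (acarrier A) F))\<rparr>"

definition Alg_obs :: "'a ealg set" where
  "Alg_obs = {A \<in> Alg. observable (cch_of_alg A)}"


section \<open>The contravariant hom-functors into the unit interval\<close>

definition emod_of_alg :: "'a ealg \<Rightarrow> ('a \<Rightarrow> real) emod" where
  "emod_of_alg A = (pow_emod (acarrier A))\<lparr>ecarrier := Alg_hom A unit_alg\<rparr>"

definition emod_of_alg_map :: "'a ealg \<Rightarrow> 'b ealg \<Rightarrow> ('a \<Rightarrow> 'b) \<Rightarrow> (('b \<Rightarrow> real) \<Rightarrow> ('a \<Rightarrow> real))" where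
  "emod_of_alg_map A B f = (\<lambda>g \<in> Alg_hom B unit_alg. compose (acarrier A) g f)"

definition alg_of_emod :: "'a emod \<Rightarrow> ('a \<Rightarrow> real) ealg" where
  "alg_of_emod M = \<lparr>acarrier = EMod_hom M unit_emod,
     astruct = (\<lambda>h \<in> Exp (EMod_hom M unit_emod).
       \<lambda>y \<in> ecarrier M. h (\<lambda>k \<in> EMod_hom M unit_emod. k y))\<rparr>"

definition alg_of_emod_map :: "'a emod \<Rightarrow> 'b emod \<Rightarrow> ('a \<Rightarrow> 'b) \<Rightarrow> (('b \<Rightarrow> real) \<Rightarrow> ('a \<Rightarrow> real))" where
  "alg_of_emod_map M N f = (\<lambda>k \<in> EMod_hom N unit_emod. compose (ecarrier M) k f)"

text \<open>The counit is a morphism into \<open>M\<close> of the opposite category of effect modules,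
  hence a map of effect modules out of \<open>M\<close>.\<close>

definition adj_unit :: "'a ealg \<Rightarrow> 'a \<Rightarrow> (('a \<Rightarrow> real) \<Rightarrow> real)" where
  "adj_unit A = (\<lambda>x \<in> acarrier A. \<lambda>g \<in> Alg_hom A unit_alg. g x)"

definition adj_counit :: "'a emod \<Rightarrow> 'a \<Rightarrow> (('a \<Rightarrow> real) \<Rightarrow> real)" where
  "adj_counit M = (\<lambda>y \<in> ecarrier M. \<lambda>k \<in> EMod_hom M unit_emod. k y)"

end

theory Submission
  imports Defs
begin

text \<open>
  The main tool is a Hahn-Banach theorem for effect modules. A minimal sublinear functional
  with values in the unit interval is additive, hence a state, so by Zorn's lemma there is a state
  below any sublinear functional \<open>q\<close>, and it can be made to agree with \<open>q\<close> at one given point. Two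
  consequences are that states on a submodule extend, and that in an Archimedean effect module the
  states determine the order.

  An algebra map \<open>f\<close> into the interval is a function with \<open>f(\<alpha>(h)) = h(f)\<close> for all \<open>h\<close>, and every such
  \<open>h\<close> is a limit of finite distributions along an ultrafilter, so these are the affine continuous
  functions. A state on the module of algebra maps extends to a state \<open>h\<close> on all functions and is
  therefore evaluation at \<open>\<alpha>(h)\<close>: the unit is surjective, and observability makes it injective. If \<open>f\<close> is
  an algebra map on the states of \<open>M\<close>, then \<open>h(f)\<close> depends only on the restriction of \<open>h\<close> to \<open>M\<close>; by
  Hahn-Banach this forces \<open>f\<close> to be a uniform limit of elements of \<open>M\<close>, and completeness puts it
  in \<open>M\<close>. Conversely, the structure map of a convex compact Hausdorff space sends \<open>h\<close> to its
  barycenter, obtained as an ultrafilter limit of convex combinations.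
\<close>

section \<open>Effect algebras\<close>

text \<open>So sublinear functionals live on the module itself, infima range over pairs of weights
  with sum at most 1, a difference \<open>x - y\<close> is replaced by a combination of
  \<open>x/2\<close> with half the complement of \<open>y\<close>, and scalar factors are cancelled
  by repeated doubling.

  Minimality gives additivity for the following reason. The infimum of
  \<open>q(x + t w) - t q(w)\<close> over \<open>t \<ge> 0\<close> is again sublinear in
  \<open>x\<close> and lies below \<open>q\<close>. A minimal \<open>q\<close> equals it, and then
  \<open>t = 1\<close> says that \<open>q\<close> is superadditive. One such lowering before
  minimising also pins the value at a prescribed point.

  Equations between points of observable objects are checked after maps into the interval, where
  convex combinations become expectations and ultrafilter limits become limits of real functions.
  The laws of algebras and of convex structures are obtained in this way.\<close>

context effect_algebra
begin

text \<open>Addition made total on \<^typ>\<open>'a option\<close>, so that it is associative and commutative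
  without side conditions.\<close>

definition padd :: "'a option \<Rightarrow> 'a option \<Rightarrow> 'a option" where
  "padd a b = (case a of None \<Rightarrow> None | Some x \<Rightarrow> (case b of None \<Rightarrow> None | Some y \<Rightarrow>
     if x \<in> ecarrier M \<and> y \<in> ecarrier M then esum M x y else None))"

lemma padd_Some: "\<lbrakk>x \<in> ecarrier M; y \<in> ecarrier M\<rbrakk> \<Longrightarrow> padd (Some x) (Some y) = esum M x y"
  by (simp add: padd_def)

lemma padd_None [simp]: "padd None b = None" "padd a None = None"
  by (auto simp: padd_def split: option.splits)

lemma padd_commute: "padd a b = padd b a"
  by (auto simp: padd_def sum_commute split: option.splits)

lemma padd_assoc: "padd (padd a b) c = padd a (padd b c)"
proof (cases "\<exists>x y z. a = Some x \<and> b = Some y \<and> c = Some z \<and>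
    x \<in> ecarrier M \<and> y \<in> ecarrier M \<and> z \<in> ecarrier M")
  case True
  then obtain x y z where *: "a = Some x" "b = Some y" "c = Some z"
    and c: "x \<in> ecarrier M" "y \<in> ecarrier M" "z \<in> ecarrier M" by blast
  have "padd (padd a b) c = Option.bind (esum M x y) (\<lambda>u. esum M u z)"
    using c sum_closed[OF c(1,2)] by (cases "esum M x y") (auto simp: * padd_def)
  moreover have "padd a (padd b c) = Option.bind (esum M y z) (\<lambda>v. esum M x v)"
    using c sum_closed[OF c(2,3)] by (cases "esum M y z") (auto simp: * padd_def)
  ultimately show ?thesis using sum_assoc[OF c] by simp
next
  case False
  then show ?thesis
    by (auto simp: padd_def split: option.splits if_splits)
qed

lemma padd_left_commute: "padd b (padd a c) = padd a (padd b c)"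
  unfolding padd_assoc[symmetric] by (subst padd_commute[of b a]) (rule refl)

lemmas padd_ac = padd_assoc padd_commute padd_left_commute

lemma padd_SomeD: "padd (Some x) (Some y) = Some z \<Longrightarrow>
    x \<in> ecarrier M \<and> y \<in> ecarrier M \<and> esum M x y = Some z \<and> z \<in> ecarrier M"
  by (cases "x \<in> ecarrier M \<and> y \<in> ecarrier M") (auto simp: padd_def intro: sum_closed)

lemma padd_eq_SomeD: "padd a b = Some z \<Longrightarrow> \<exists>x y. a = Some x \<and> b = Some y"
  by (auto simp: padd_def split: option.splits)

lemma one_closed: "eone M \<in> ecarrier M"
  by (simp add: eone_def zero_closed compl_closed)

lemma compl_compl: "x \<in> ecarrier M \<Longrightarrow> ecompl M (ecompl M x) = x"
  using compl_unique[of "ecompl M x" x] sum_compl[of x] sum_commute[of x "ecompl M x"] compl_closed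
  by simp

lemma compl_one: "ecompl M (eone M) = ezero M"
  by (simp add: eone_def compl_compl zero_closed)

text \<open>Adding the complement of \<open>u\<close> to \<open>v \<oplus> z = u\<close> gives 1, so
  uniqueness of complements expresses \<open>v\<close> through \<open>z\<close> and \<open>u\<close>
  alone.\<close>

lemma sum_cancel:
  assumes c: "x \<in> ecarrier M" "y \<in> ecarrier M" "z \<in> ecarrier M"
    and e: "esum M x z = Some u" "esum M y z = Some u"
  shows "x = y"
proof -
  have u: "u \<in> ecarrier M" using sum_closed c e by blast
  have *: "v = ecompl M (the (padd (Some z) (Some (ecompl M u))))"
    if v: "v \<in> ecarrier M" "esum M v z = Some u" for v
  proof -
    have eq: "padd (Some v) (padd (Some z) (Some (ecompl M u))) = Some (eone M)"
      unfolding padd_assoc[symmetric] using v c u by (simp add: padd_Some compl_closed sum_compl)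
    obtain w where w: "padd (Some z) (Some (ecompl M u)) = Some w"
      using eq padd_eq_SomeD by blast
    have wc: "w \<in> ecarrier M" using padd_SomeD w by blast
    have "esum M w v = Some (eone M)"
      using eq wc v by (simp add: w padd_Some sum_commute)
    then show ?thesis using compl_unique[OF wc v(1)] w by simp
  qed
  show ?thesis using *[of x] *[of y] c e by simp
qed

text \<open>\<open>(x \<oplus> y) \<oplus> 1 = 0 \<oplus> 1\<close> is defined, hence so is its part
  \<open>x \<oplus> 1\<close>, which forces \<open>x = 0\<close>.\<close>

lemma sum_eq_zero:
  assumes c: "x \<in> ecarrier M" "y \<in> ecarrier M" and e: "esum M x y = Some (ezero M)"
  shows "x = ezero M"
proof -
  have "padd (padd (Some x) (Some y)) (Some (eone M)) \<noteq> None"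
    using c e sum_zero[OF one_closed] by (simp add: padd_Some zero_closed one_closed sum_commute)
  then have "padd (Some y) (padd (Some x) (Some (eone M))) \<noteq> None"
    by (simp add: padd_ac)
  then have "padd (Some x) (Some (eone M)) \<noteq> None"
    by (metis padd_None(2))
  then show ?thesis using sum_one c by (simp add: padd_Some one_closed)
qed

lemma ele_refl: "x \<in> ecarrier M \<Longrightarrow> ele M x x"
  unfolding ele_def using sum_zero zero_closed by blast

lemma ele_antisym:
  assumes c: "x \<in> ecarrier M" "y \<in> ecarrier M" and e: "ele M x y" "ele M y x"
  shows "x = y"
proof -
  obtain a b where ab: "a \<in> ecarrier M" "b \<in> ecarrier M" "esum M x a = Some y" "esum M y b = Some x"
    using e unfolding ele_def by blast
  have "padd (Some x) (padd (Some a) (Some b)) = Some x"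
    unfolding padd_assoc[symmetric] using ab c by (simp add: padd_Some)
  then obtain d where d: "padd (Some a) (Some b) = Some d" "padd (Some x) (Some d) = Some x"
    using padd_eq_SomeD by metis
  have dc: "d \<in> ecarrier M" using d padd_SomeD by blast
  have "d = ezero M"
    using sum_cancel[OF dc zero_closed c(1), of x] d dc c sum_zero
    by (simp add: padd_Some sum_commute zero_closed)
  then have "a = ezero M" using sum_eq_zero[OF ab(1,2)] d ab by (simp add: padd_Some)
  then show ?thesis using ab sum_zero c by simp
qed

lemma ele_trans:
  assumes "x \<in> ecarrier M" "y \<in> ecarrier M" "z \<in> ecarrier M" and e: "ele M x y" "ele M y z"
  shows "ele M x z"
proof -
  obtain a b where ab: "a \<in> ecarrier M" "b \<in> ecarrier M" "esum M x a = Some y" "esum M y b = Some z"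
    using e unfolding ele_def by blast
  have "padd (Some x) (padd (Some a) (Some b)) = Some z"
    unfolding padd_assoc[symmetric] using ab assms by (simp add: padd_Some)
  then obtain d where "padd (Some a) (Some b) = Some d" "padd (Some x) (Some d) = Some z"
    using padd_eq_SomeD by metis
  then show ?thesis unfolding ele_def using padd_SomeD by metis
qed

lemma ele_add:
  assumes c: "x \<in> ecarrier M" "x' \<in> ecarrier M" "y \<in> ecarrier M" "y' \<in> ecarrier M"
    and le: "ele M x x'" "ele M y y'" and e: "esum M x' y' = Some z'"
  shows "\<exists>z\<in>ecarrier M. esum M x y = Some z \<and> ele M z z'"
proof -
  obtain a b where ab: "a \<in> ecarrier M" "b \<in> ecarrier M" "esum M x a = Some x'" "esum M y b = Some y'"
    using le unfolding ele_def by blast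
  have "padd (padd (Some x) (Some a)) (padd (Some y) (Some b)) = Some z'"
    using ab c e by (simp add: padd_Some)
  then have "padd (padd (Some x) (Some y)) (padd (Some a) (Some b)) = Some z'"
    by (simp add: padd_ac)
  then obtain z d where z: "padd (Some x) (Some y) = Some z" "padd (Some a) (Some b) = Some d"
    "padd (Some z) (Some d) = Some z'"
    using padd_eq_SomeD by metis
  then show ?thesis unfolding ele_def using padd_SomeD by metis
qed

text \<open>If \<open>x \<oplus> y = z\<close>, then \<open>x\<close> plus the complement of
  \<open>z\<close> completes \<open>y\<close> to 1, so it is the complement of \<open>y\<close>. The
  equivalence turns definedness into an order statement, which states can decide.\<close>

lemma sum_defined_iff:
  assumes c: "x \<in> ecarrier M" "y \<in> ecarrier M"
  shows "esum M x y \<noteq> None \<longleftrightarrow> ele M x (ecompl M y)"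
proof
  assume "ele M x (ecompl M y)"
  then show "esum M x y \<noteq> None"
    using ele_add[of x "ecompl M y" y y "eone M"] c sum_compl[of y] ele_refl[of y]
    by (auto simp: compl_closed sum_commute)
next
  assume "esum M x y \<noteq> None"
  then obtain z where z: "esum M x y = Some z" by blast
  then have zc: "z \<in> ecarrier M" using sum_closed c by blast
  have "padd (Some y) (padd (Some x) (Some (ecompl M z))) = padd (padd (Some x) (Some y)) (Some (ecompl M z))"
    by (simp add: padd_ac)
  also have "\<dots> = Some (eone M)"
    using z zc c sum_compl by (simp add: padd_Some compl_closed)
  finally obtain d where d: "padd (Some x) (Some (ecompl M z)) = Some d"
    "padd (Some y) (Some d) = Some (eone M)"
    using padd_eq_SomeD by metis
  then have "d = ecompl M y" using compl_unique padd_SomeD by blast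
  then show "ele M x (ecompl M y)" unfolding ele_def using d padd_SomeD by blast
qed

lemma ele_add_cancel:
  assumes c: "x \<in> ecarrier M" "y \<in> ecarrier M" "z \<in> ecarrier M"
    and e: "esum M x z = Some u" "esum M y z = Some v" and le: "ele M u v"
  shows "ele M x y"
proof -
  obtain d where d: "d \<in> ecarrier M" "esum M u d = Some v"
    using le unfolding ele_def by blast
  have uc: "u \<in> ecarrier M" using sum_closed c e by blast
  have "padd (padd (Some x) (Some d)) (Some z) = padd (padd (Some x) (Some z)) (Some d)"
    by (simp add: padd_ac)
  also have "\<dots> = Some v" using c d e uc by (simp add: padd_Some)
  finally obtain b where b: "padd (Some x) (Some d) = Some b" "padd (Some b) (Some z) = Some v"
    using padd_eq_SomeD by metis
  then have "b = y" using sum_cancel[of b y z v] padd_SomeD c e by blast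
  then show ?thesis unfolding ele_def using b padd_SomeD by blast
qed

lemma sum_le_left: "\<lbrakk>x \<in> ecarrier M; y \<in> ecarrier M; esum M x y = Some z\<rbrakk> \<Longrightarrow> ele M x z"
  unfolding ele_def by blast

end

section \<open>Effect modules\<close>

text \<open>Fixes the unextended record type, on which \<open>EMod\<close>, \<open>EMod_hom\<close>
  and \<open>half_le\<close> are defined.\<close>

locale emodule = effect_module M for M :: "'a emod"

lemma emodule_iff: "emodule M \<longleftrightarrow> M \<in> EMod"
  by (simp add: emodule_def EMod_def)

text \<open>Sums are inherited together with their definedness. The notion is applied to the
  multiples of 1, to the algebra maps into the interval, to \<open>antidiag\<close>, and to a whole
  cube.\<close>

definition subeffect :: "'a emod \<Rightarrow> 'a set \<Rightarrow> bool" where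
  "subeffect M C \<longleftrightarrow> C \<subseteq> ecarrier M \<and> ezero M \<in> C \<and> (\<forall>x\<in>C. ecompl M x \<in> C) \<and>
     (\<forall>x\<in>C. \<forall>y\<in>C. \<forall>z. esum M x y = Some z \<longrightarrow> z \<in> C) \<and>
     (\<forall>r\<in>{0..1}. \<forall>x\<in>C. escale M r x \<in> C)"

context emodule
begin

lemma subeffect_EMod:
  assumes "subeffect M C"
  shows "M\<lparr>ecarrier := C\<rparr> \<in> EMod"
proof -
  have C: "\<And>x. x \<in> C \<Longrightarrow> x \<in> ecarrier M" "ezero M \<in> C" "\<And>x. x \<in> C \<Longrightarrow> ecompl M x \<in> C"
    "\<And>x y z. \<lbrakk>x \<in> C; y \<in> C; esum M x y = Some z\<rbrakk> \<Longrightarrow> z \<in> C"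
    "\<And>r x. \<lbrakk>r \<in> {0..1}; x \<in> C\<rbrakk> \<Longrightarrow> escale M r x \<in> C"
    using assms unfolding subeffect_def by blast+
  define N where "N = M\<lparr>ecarrier := C\<rparr>"
  have N: "ecarrier N = C" "ezero N = ezero M" "esum N = esum M" "ecompl N = ecompl M"
    "escale N = escale M" "eone N = eone M"
    by (simp_all add: N_def eone_def)
  have "effect_module N"
  proof (unfold_locales, unfold N)
    fix x y z r s
    show "ezero M \<in> C" by (fact C)
    show "x \<in> C \<Longrightarrow> ecompl M x \<in> C" by (rule C)
    show "\<lbrakk>x \<in> C; y \<in> C; esum M x y = Some z\<rbrakk> \<Longrightarrow> z \<in> C" by (rule C)
    show "\<lbrakk>x \<in> C; y \<in> C\<rbrakk> \<Longrightarrow> esum M x y = esum M y x" using C(1) sum_commute by blast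
    show "\<lbrakk>x \<in> C; y \<in> C; z \<in> C\<rbrakk> \<Longrightarrow>
      Option.bind (esum M x y) (\<lambda>u. esum M u z) = Option.bind (esum M y z) (\<lambda>v. esum M x v)"
      by (intro sum_assoc C(1))
    show "x \<in> C \<Longrightarrow> esum M x (ezero M) = Some x" by (intro sum_zero C(1))
    show "x \<in> C \<Longrightarrow> esum M x (ecompl M x) = Some (eone M)" by (intro sum_compl C(1))
    show "\<lbrakk>x \<in> C; y \<in> C; esum M x y = Some (eone M)\<rbrakk> \<Longrightarrow> y = ecompl M x"
      by (intro compl_unique C(1))
    show "\<lbrakk>x \<in> C; esum M x (eone M) \<noteq> None\<rbrakk> \<Longrightarrow> x = ezero M" by (intro sum_one C(1))
    show "\<lbrakk>r \<in> {0..1}; x \<in> C\<rbrakk> \<Longrightarrow> escale M r x \<in> C" by (rule C)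
    show "x \<in> C \<Longrightarrow> escale M 1 x = x" by (intro scale_one C(1))
    show "\<lbrakk>r \<in> {0..1}; s \<in> {0..1}; x \<in> C\<rbrakk> \<Longrightarrow> escale M (r * s) x = escale M r (escale M s x)"
      by (intro scale_scale C(1))
    show "\<lbrakk>r \<in> {0..1}; s \<in> {0..1}; r + s \<le> 1; x \<in> C\<rbrakk> \<Longrightarrow>
      esum M (escale M r x) (escale M s x) = Some (escale M (r + s) x)"
      by (intro scale_add_left C(1))
    show "\<lbrakk>r \<in> {0..1}; x \<in> C; y \<in> C; esum M x y = Some z\<rbrakk> \<Longrightarrow>
      esum M (escale M r x) (escale M r y) = Some (escale M r z)"
      by (intro scale_add_right C(1))
  qed
  then show ?thesis by (simp add: EMod_def N_def)
qed

section \<open>Scalar multiples and combinations with total weight at most 1\<close>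

lemma scale_zero_left: "x \<in> ecarrier M \<Longrightarrow> escale M 0 x = ezero M"
  using sum_cancel[of "escale M 0 x" "ezero M" "escale M 0 x" "escale M 0 x"]
    scale_add_left[of 0 0 x] scale_closed[of 0 x] sum_zero[of "escale M 0 x"]
    sum_commute[of "escale M 0 x" "ezero M"] zero_closed by simp

lemma scale_zero_right: "r \<in> {0..1} \<Longrightarrow> escale M r (ezero M) = ezero M"
  using scale_scale[of r 0 "eone M"] one_closed scale_zero_left[OF one_closed] by simp

definition lc :: "real \<Rightarrow> 'a \<Rightarrow> real \<Rightarrow> 'a \<Rightarrow> 'a" where
  "lc a x b y = the (esum M (escale M a x) (escale M b y))"

lemma scale_compl:
  assumes "r \<in> {0..1}" "x \<in> ecarrier M"
  shows "esum M (escale M r x) (escale M r (ecompl M x)) = Some (escale M r (eone M))"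
  using scale_add_right[OF assms compl_closed[OF assms(2)] sum_compl[OF assms(2)]] .

lemma scale_le_one:
  assumes "r \<in> {0..1}" "x \<in> ecarrier M"
  shows "ele M (escale M r x) (escale M r (eone M))"
  using scale_compl[OF assms] scale_closed compl_closed assms unfolding ele_def by blast

text \<open>\<open>a x\<close> and \<open>b y\<close> lie below \<open>a 1\<close> and
  \<open>b 1\<close>, whose sum is \<open>(a + b) 1\<close>. So combinations of total weight at most
  1 exist without further conditions on \<open>x\<close> and \<open>y\<close>.\<close>

lemma lc_sum:
  assumes "0 \<le> a" "0 \<le> b" "a + b \<le> 1" "x \<in> ecarrier M" "y \<in> ecarrier M"
  shows "esum M (escale M a x) (escale M b y) = Some (lc a x b y)" and "lc a x b y \<in> ecarrier M"
proof -
  have ab: "a \<in> {0..1}" "b \<in> {0..1}" using assms by auto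
  have "\<exists>z\<in>ecarrier M. esum M (escale M a x) (escale M b y) = Some z \<and> ele M z (escale M (a + b) (eone M))"
    using scale_add_left[OF ab assms(3) one_closed]
    by (intro ele_add[OF _ _ _ _ scale_le_one[OF ab(1) assms(4)] scale_le_one[OF ab(2) assms(5)]])
       (auto intro: scale_closed ab assms one_closed simp del: atLeastAtMost_iff)
  then show "esum M (escale M a x) (escale M b y) = Some (lc a x b y)" "lc a x b y \<in> ecarrier M"
    by (auto simp: lc_def)
qed

lemma scale_lc:
  assumes "r \<in> {0..1}" "0 \<le> a" "0 \<le> b" "a + b \<le> 1" "x \<in> ecarrier M" "y \<in> ecarrier M"
  shows "escale M r (lc a x b y) = lc (r * a) x (r * b) y"
proof -
  have ab: "a \<in> {0..1}" "b \<in> {0..1}" using assms by auto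
  have "esum M (escale M r (escale M a x)) (escale M r (escale M b y)) = Some (escale M r (lc a x b y))"
    using lc_sum[OF assms(2-)] scale_closed ab assms by (intro scale_add_right) auto
  then show ?thesis
    using scale_scale[OF assms(1) ab(1) assms(5)] scale_scale[OF assms(1) ab(2) assms(6)]
    by (simp add: lc_def)
qed

lemma lc_scale_left:
  assumes "r \<in> {0..1}" "0 \<le> a" "a \<le> 1" "x \<in> ecarrier M"
  shows "lc a (escale M r x) b y = lc (a * r) x b y"
  using assms scale_scale[of a r x] by (simp add: lc_def)

lemma lc_add:
  assumes c: "x \<in> ecarrier M" "y \<in> ecarrier M" "w \<in> ecarrier M" and z: "esum M x y = Some z"
    and ab: "0 \<le> a" "0 \<le> b" "0 \<le> b'" "a + b + b' \<le> 1"
  shows "esum M (lc a x b w) (lc a y b' w) = Some (lc a z (b + b') w)"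
proof -
  have zc: "z \<in> ecarrier M" using sum_closed c z by blast
  have cl: "escale M a x \<in> ecarrier M" "escale M a y \<in> ecarrier M" "escale M a z \<in> ecarrier M"
    "escale M b w \<in> ecarrier M" "escale M b' w \<in> ecarrier M" "escale M (b + b') w \<in> ecarrier M"
    "lc a x b w \<in> ecarrier M" "lc a y b' w \<in> ecarrier M"
    using ab c zc by (auto intro!: scale_closed lc_sum)
  have "esum M (lc a x b w) (lc a y b' w)
      = padd (padd (Some (escale M a x)) (Some (escale M b w))) (padd (Some (escale M a y)) (Some (escale M b' w)))"
    using ab c cl lc_sum(1)[of a b x w] lc_sum(1)[of a b' y w] by (simp add: padd_Some)
  also have "\<dots> = padd (padd (Some (escale M a x)) (Some (escale M a y))) (padd (Some (escale M b w)) (Some (escale M b' w)))"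
    by (simp add: padd_ac)
  also have "\<dots> = padd (Some (escale M a z)) (Some (escale M (b + b') w))"
    using cl scale_add_right[of a x y z] scale_add_left[of b b' w] ab c z by (simp add: padd_Some)
  also have "\<dots> = Some (lc a z (b + b') w)"
    using cl lc_sum(1)[of a "b + b'" z w] ab c zc by (simp add: padd_Some)
  finally show ?thesis .
qed

lemma lc_zero_right:
  assumes "0 \<le> a" "a \<le> 1" "x \<in> ecarrier M" "y \<in> ecarrier M"
  shows "lc a x 0 y = escale M a x"
  using assms sum_zero[of "escale M a x"] by (simp add: lc_def scale_zero_left scale_closed)

lemma scale_mono:
  assumes "r \<in> {0..1}" "x \<in> ecarrier M" "y \<in> ecarrier M" "ele M x y"
  shows "ele M (escale M r x) (escale M r y)"
proof -
  obtain u where "u \<in> ecarrier M" "esum M x u = Some y" using assms unfolding ele_def by blast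
  then show ?thesis using scale_add_right[OF assms(1,2), of u y] scale_closed assms
    unfolding ele_def by blast
qed

lemma half_le_cancel:
  assumes "x \<in> ecarrier M" "y \<in> ecarrier M" "ele M (escale M (1/2) x) (escale M (1/2) y)"
  shows "ele M x y"
proof -
  have d: "esum M (escale M (1/2) u) (escale M (1/2) u) = Some u" if "u \<in> ecarrier M" for u
    using scale_add_left[of "1/2" "1/2" u] that by (simp add: scale_one)
  have "\<exists>z\<in>ecarrier M. esum M (escale M (1/2) x) (escale M (1/2) x) = Some z \<and> ele M z y"
    using assms d by (intro ele_add[of _ "escale M (1/2) y" _ "escale M (1/2) y"]) (auto intro: scale_closed)
  then show ?thesis using d[OF assms(1)] by simp
qed

text \<open>There is no scalar \<open>1/r\<close> to multiply by. The factor is first shrunk to a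
  power of 1/2, and each 1/2 is then removed by adding an inequality to itself
  (\<open>half_le_cancel\<close>).\<close>

lemma scale_le_cancel:
  assumes r: "0 < r" "r \<le> 1" and c: "x \<in> ecarrier M" "y \<in> ecarrier M"
    and le: "ele M (escale M r x) (escale M r y)"
  shows "ele M x y"
proof -
  obtain n where n: "(1/2) ^ n < r" using real_arch_pow_inv[OF r(1), of "1/2"] by auto
  have "ele M (escale M ((1/2)^n) x) (escale M ((1/2)^n) y)"
  proof -
    have s: "(1/2)^n / r \<in> {0..1}" using n r by auto
    have "ele M (escale M ((1/2)^n / r) (escale M r x)) (escale M ((1/2)^n / r) (escale M r y))"
      using le scale_mono[OF s] scale_closed r c by auto
    then show ?thesis using scale_scale[OF s, of r x] scale_scale[OF s, of r y] r c by auto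
  qed
  then show ?thesis
  proof (induction n)
    case 0
    then show ?case using c by (simp add: scale_one)
  next
    case (Suc n)
    have p: "(1/2)^n \<in> {0..1::real}" by (auto intro: power_le_one)
    have "ele M (escale M (1/2) (escale M ((1/2)^n) x)) (escale M (1/2) (escale M ((1/2)^n) y))"
      using Suc(2) scale_scale[of "1/2" "(1/2)^n" x] scale_scale[of "1/2" "(1/2)^n" y] c p by simp
    then show ?case using half_le_cancel scale_closed p c Suc(1) by blast
  qed
qed

end

section \<open>Sublinear functionals and extension of states\<close>

abbreviation states :: "'a emod \<Rightarrow> ('a \<Rightarrow> real) set" where
  "states M \<equiv> EMod_hom M unit_emod"

lemma unit_emod_simps: "ecarrier unit_emod = {0..1}" "eone unit_emod = 1"
    "escale unit_emod r s = r * s"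
  by (simp_all add: unit_emod_def eone_def)

context emodule
begin

text \<open>Exact additivity against multiples of 1 encodes normalisation
  (\<open>sub_states_one\<close>) and is also the source of monotonicity
  (\<open>sub_states_mono\<close>).\<close>

definition sub_states :: "('a \<Rightarrow> real) set" where
  "sub_states = {q \<in> ecarrier M \<rightarrow>\<^sub>E {0..1}.
     (\<forall>r\<in>{0..1}. \<forall>x\<in>ecarrier M. q (escale M r x) = r * q x) \<and>
     (\<forall>x\<in>ecarrier M. \<forall>y\<in>ecarrier M. \<forall>z. esum M x y = Some z \<longrightarrow> q z \<le> q x + q y) \<and>
     (\<forall>x\<in>ecarrier M. \<forall>r\<in>{0..1}. \<forall>z. esum M x (escale M r (eone M)) = Some z \<longrightarrow> q z = q x + r)}"

lemma sub_statesD: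
  assumes "q \<in> sub_states"
  shows "x \<in> ecarrier M \<Longrightarrow> 0 \<le> q x" "x \<in> ecarrier M \<Longrightarrow> q x \<le> 1"
    "q \<in> extensional (ecarrier M)"
    "\<lbrakk>0 \<le> r; r \<le> 1; x \<in> ecarrier M\<rbrakk> \<Longrightarrow> q (escale M r x) = r * q x"
    "\<lbrakk>x \<in> ecarrier M; y \<in> ecarrier M; esum M x y = Some z\<rbrakk> \<Longrightarrow> q z \<le> q x + q y"
    "\<lbrakk>x \<in> ecarrier M; 0 \<le> r; r \<le> 1; esum M x (escale M r (eone M)) = Some z\<rbrakk> \<Longrightarrow> q z = q x + r"
  using assms unfolding sub_states_def by (auto simp: PiE_iff)

lemma sub_states_one:
  assumes "q \<in> sub_states"
  shows "q (eone M) = 1"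
proof -
  have "q (ezero M) = 0"
    using sub_statesD(4)[OF assms, of 0 "eone M"] one_closed scale_zero_left by simp
  moreover have "esum M (ezero M) (escale M 1 (eone M)) = Some (eone M)"
    using sum_zero[OF one_closed] sum_commute[OF zero_closed one_closed] scale_one[OF one_closed]
    by simp
  ultimately show ?thesis using sub_statesD(6)[OF assms, of "ezero M" 1] zero_closed by simp
qed

text \<open>Let \<open>x \<oplus> u = y\<close> and let \<open>u'\<close> be the complement of
  \<open>u\<close>. Then \<open>x/2 \<oplus> 1/2 = y/2 \<oplus> u'/2\<close>, where the halves make
  both sums exist. Additivity against 1 on the left, and subadditivity with
  \<open>q u' \<le> 1\<close> on the right, give the claim.\<close>

lemma sub_states_mono:
  assumes q: "q \<in> sub_states" and c: "x \<in> ecarrier M" "y \<in> ecarrier M" and le: "ele M x y"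
  shows "q x \<le> q y"
proof -
  obtain u where u: "u \<in> ecarrier M" "esum M x u = Some y" using le unfolding ele_def by blast
  let ?h = "\<lambda>v. escale M (1/2) v"
  have cl: "?h x \<in> ecarrier M" "?h y \<in> ecarrier M" "?h u \<in> ecarrier M"
    "?h (ecompl M u) \<in> ecarrier M" "?h (eone M) \<in> ecarrier M"
    using c u by (auto intro!: scale_closed compl_closed one_closed)
  have "padd (Some (?h x)) (Some (?h (eone M)))
      = padd (Some (?h x)) (padd (Some (?h u)) (Some (?h (ecompl M u))))"
    using cl scale_compl[of "1/2" u] u by (simp add: padd_Some)
  also have "\<dots> = padd (Some (?h y)) (Some (?h (ecompl M u)))"
    unfolding padd_assoc[symmetric] using cl scale_add_right[of "1/2" x u y] u c
    by (simp add: padd_Some)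
  finally have eq: "esum M (?h x) (?h (eone M)) = esum M (?h y) (?h (ecompl M u))"
    using cl by (simp add: padd_Some)
  obtain t where t: "esum M (?h y) (?h (ecompl M u)) = Some t"
    using lc_sum(1)[of "1/2" "1/2" y "ecompl M u"] c u compl_closed by auto
  have "q (?h x) + 1/2 \<le> q (?h y) + q (?h (ecompl M u))"
    using sub_statesD(6)[OF q cl(1), of "1/2" t] sub_statesD(5)[OF q cl(2,4) t] eq t by simp
  moreover have "q (ecompl M u) \<le> 1" using sub_statesD(2)[OF q] compl_closed u by blast
  ultimately show ?thesis
    using c u compl_closed by (simp add: sub_statesD(4)[OF q])
qed

section \<open>Lowering a sublinear functional in one direction\<close>

definition step_set :: "('a \<Rightarrow> real) \<Rightarrow> 'a \<Rightarrow> 'a \<Rightarrow> real set" where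
  "step_set q w x = {(q (lc a x b w) - b * q w) / a | a b. 0 < a \<and> 0 \<le> b \<and> a + b \<le> 1}"

text \<open>The value at \<open>x\<close> is the infimum of \<open>q(x + tw) - t q(w)\<close> over \<open>t \<ge> 0\<close>, where
  \<open>t = b/a\<close>.\<close>

definition step :: "('a \<Rightarrow> real) \<Rightarrow> 'a \<Rightarrow> 'a \<Rightarrow> real" where
  "step q w = (\<lambda>x\<in>ecarrier M. Inf (step_set q w x))"

context
  fixes q w
  assumes q: "q \<in> sub_states" and w: "w \<in> ecarrier M"
begin

lemma step_set_nonneg:
  assumes "v \<in> step_set q w x" "x \<in> ecarrier M"
  shows "0 \<le> v"
proof -
  obtain a b where v: "v = (q (lc a x b w) - b * q w) / a" and ab: "0 < a" "0 \<le> b" "a + b \<le> 1"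
    using assms unfolding step_set_def by blast
  have "ele M (escale M b w) (lc a x b w)"
    using lc_sum(1)[of a b x w] ab assms w sum_commute scale_closed[of a x] scale_closed[of b w]
    unfolding ele_def by auto
  then have "q (escale M b w) \<le> q (lc a x b w)"
    using ab assms w by (intro sub_states_mono[OF q]) (auto intro!: scale_closed lc_sum)
  then show ?thesis using v ab w by (simp add: sub_statesD(4)[OF q])
qed

lemma step_le:
  assumes "x \<in> ecarrier M" "0 < a" "0 \<le> b" "a + b \<le> 1"
  shows "step q w x \<le> (q (lc a x b w) - b * q w) / a"
proof -
  have "bdd_below (step_set q w x)"
    using step_set_nonneg assms by (intro bdd_belowI[of _ 0]) blast
  then show ?thesis using assms unfolding step_def
    by (auto simp: step_set_def intro!: cInf_lower)
qed

lemma step_ge: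
  assumes "x \<in> ecarrier M"
    and "\<And>a b. \<lbrakk>0 < a; 0 \<le> b; a + b \<le> 1\<rbrakk> \<Longrightarrow> v \<le> (q (lc a x b w) - b * q w) / a"
  shows "v \<le> step q w x"
proof -
  have "(q (lc 1 x 0 w) - 0 * q w) / 1 \<in> step_set q w x"
    unfolding step_set_def by (intro CollectI exI[of _ 1] exI[of _ 0]) auto
  then have "step_set q w x \<noteq> {}" by blast
  then show ?thesis using assms unfolding step_def
    by (auto simp: step_set_def intro!: cInf_greatest)
qed

lemma step_le_self:
  assumes "x \<in> ecarrier M"
  shows "step q w x \<le> q x"
  using step_le[of x 1 0] assms w lc_zero_right[of 1 x w] by (simp add: scale_one)

lemma step_nonneg:
  assumes "x \<in> ecarrier M"
  shows "0 \<le> step q w x"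
  using step_ge[OF assms] step_set_nonneg assms unfolding step_set_def by blast

text \<open>A state below \<open>step q w\<close> has value at most \<open>1 - q w\<close> at the
  complement of \<open>w\<close>, hence at least \<open>q w\<close> at \<open>w\<close>. The bound
  comes from the weights 1/2 and 1/2, for which the combination is half of 1.\<close>

lemma step_compl: "step q w (ecompl M w) \<le> 1 - q w"
proof -
  have "lc (1/2) (ecompl M w) (1/2) w = escale M (1/2) (eone M)"
    using scale_compl[of "1/2" w] w sum_commute[of "escale M (1/2) w" "escale M (1/2) (ecompl M w)"]
    by (simp add: lc_def scale_closed compl_closed)
  then have "q (lc (1/2) (ecompl M w) (1/2) w) = 1/2"
    using one_closed by (simp add: sub_statesD(4)[OF q] sub_states_one[OF q])
  then show ?thesis using step_le[of "ecompl M w" "1/2" "1/2"] w compl_closed by simp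
qed

lemma step_scale:
  assumes r: "0 \<le> r" "r \<le> 1" and x: "x \<in> ecarrier M"
  shows "step q w (escale M r x) = r * step q w x"
proof (rule antisym)
  have rx: "escale M r x \<in> ecarrier M" using r x by (intro scale_closed) auto
  show "step q w (escale M r x) \<le> r * step q w x"
  proof (cases "r = 0")
    case True
    then show ?thesis
      using step_le_self[OF rx] sub_statesD(4)[OF q r x] by simp
  next
    case False
    with r have r0: "0 < r" by simp
    have "step q w (escale M r x) / r \<le> step q w x"
    proof (rule step_ge[OF x])
      fix a b :: real assume ab: "0 < a" "0 \<le> b" "a + b \<le> 1"
      \<comment> \<open>The pair \<open>(a, b)\<close> for \<open>x\<close> corresponds to
        \<open>(a, r b)\<close> for \<open>r x\<close>: the whole combination is multiplied by
        \<open>r\<close>. In the converse direction \<open>(a, b)\<close> for \<open>r x\<close>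
        corresponds to \<open>(a r, b)\<close> for \<open>x\<close>.\<close>
      have rb: "r * b \<le> b" using mult_right_mono[OF r(2) ab(2)] by simp
      have "lc a (escale M r x) (r * b) w = escale M r (lc a x b w)"
        using scale_lc[of r a b x w] lc_scale_left[of r a x] r ab x w by (simp add: mult.commute)
      then have "q (lc a (escale M r x) (r * b) w) = r * q (lc a x b w)"
        using r ab x w by (simp add: sub_statesD(4)[OF q] lc_sum)
      then have "step q w (escale M r x) \<le> (r * q (lc a x b w) - (r * b) * q w) / a"
        using step_le[OF rx, of a "r * b"] r ab rb by simp
      also have "\<dots> = r * ((q (lc a x b w) - b * q w) / a)" by (simp add: field_simps)
      finally show "step q w (escale M r x) / r \<le> (q (lc a x b w) - b * q w) / a"
        using r0 by (simp add: divide_le_eq mult.commute)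
    qed
    then show ?thesis using r0 by (simp add: divide_le_eq mult.commute)
  qed
  show "r * step q w x \<le> step q w (escale M r x)"
  proof (cases "r = 0")
    case True
    then show ?thesis using step_nonneg[OF rx] by simp
  next
    case False
    with r have r0: "0 < r" by simp
    show ?thesis
    proof (rule step_ge[OF rx])
      fix a b :: real assume ab: "0 < a" "0 \<le> b" "a + b \<le> 1"
      have ar: "a * r \<le> a" using r ab mult_left_mono[of r 1 a] by simp
      have "step q w x \<le> (q (lc (a * r) x b w) - b * q w) / (a * r)"
        using step_le[OF x, of "a * r" b] r0 ab ar by simp
      then have "r * step q w x \<le> r * ((q (lc (a * r) x b w) - b * q w) / (a * r))"
        using r0 by (intro mult_left_mono) auto
      also have "\<dots> = (q (lc a (escale M r x) b w) - b * q w) / a"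
        using r0 ab lc_scale_left[of r a x b w] r x by simp
      finally show "r * step q w x \<le> (q (lc a (escale M r x) b w) - b * q w) / a" .
    qed
  qed
qed

lemma step_subadd:
  assumes c: "x \<in> ecarrier M" "y \<in> ecarrier M" and z: "esum M x y = Some z"
  shows "step q w z \<le> step q w x + step q w y"
proof -
  have zc: "z \<in> ecarrier M" using sum_closed c z by blast
  have *: "step q w z \<le> (q (lc a x b w) - b * q w) / a + (q (lc a' y b' w) - b' * q w) / a'"
    if ab: "0 < a" "0 \<le> b" "a + b \<le> 1" "0 < a'" "0 \<le> b'" "a' + b' \<le> 1" for a b a' b'
  proof -
    \<comment> \<open>Convex weights that equalise the coefficients of \<open>x\<close> and
      \<open>y\<close>: \<open>c1 a = c2 a'\<close> is the common coefficient \<open>d\<close>, so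
      that \<open>x\<close> and \<open>y\<close> can be merged into \<open>d z\<close>.\<close>
    define c1 c2 where "c1 = a' / (a + a')" and "c2 = a / (a + a')"
    have "a + a' \<noteq> 0" using ab by simp
    then have c12: "0 < c1" "c1 \<le> 1" "0 < c2" "c2 \<le> 1" "c1 + c2 = 1" "c1 * a = c2 * a'"
      using ab by (auto simp: c1_def c2_def field_simps add_divide_distrib[symmetric])
    define d where "d = c1 * a"
    have d: "0 < d" "d = c2 * a'" using c12 ab by (auto simp: d_def)
    have "c1 * (a + b) \<le> c1" "c2 * (a' + b') \<le> c2" using c12 ab by simp_all
    moreover have "d + c1 * b + c2 * b' \<le> c1 * (a + b) + c2 * (a' + b')"
      using d c12 ab by (simp add: d_def algebra_simps)
    ultimately have sm: "d + c1 * b + c2 * b' \<le> 1" using c12 by linarith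
    have nn: "0 \<le> c1 * b" "0 \<le> c2 * b'" using c12 ab by simp_all
    have e: "esum M (lc d x (c1 * b) w) (lc d y (c2 * b') w) = Some (lc d z (c1 * b + c2 * b') w)"
      using lc_add[OF c w z, of d "c1 * b" "c2 * b'"] d nn sm by simp
    have "q (lc d z (c1 * b + c2 * b') w) \<le> q (lc d x (c1 * b) w) + q (lc d y (c2 * b') w)"
      using e d nn sm c w by (intro sub_statesD(5)[OF q _ _ e]) (auto intro!: lc_sum)
    also have "lc d x (c1 * b) w = escale M c1 (lc a x b w)"
      using scale_lc[of c1 a b x w] c12 ab c w by (simp add: d_def)
    also have "lc d y (c2 * b') w = escale M c2 (lc a' y b' w)"
      using scale_lc[of c2 a' b' y w] c12 ab c w by (simp add: d_def)
    finally have le: "q (lc d z (c1 * b + c2 * b') w) \<le> c1 * q (lc a x b w) + c2 * q (lc a' y b' w)"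
      using c12 ab c w by (simp add: sub_statesD(4)[OF q] lc_sum)
    have "step q w z \<le> (q (lc d z (c1 * b + c2 * b') w) - (c1 * b + c2 * b') * q w) / d"
      using d nn sm by (intro step_le[OF zc]) auto
    also have "\<dots> \<le> (c1 * q (lc a x b w) + c2 * q (lc a' y b' w) - (c1 * b + c2 * b') * q w) / d"
      using le d by (simp add: divide_right_mono)
    also have "\<dots> = c1 * (q (lc a x b w) - b * q w) / d + c2 * (q (lc a' y b' w) - b' * q w) / d"
      by (simp add: field_simps add_divide_distrib[symmetric])
    also have "c1 * (q (lc a x b w) - b * q w) / d = (q (lc a x b w) - b * q w) / a"
      using c12(1) by (simp add: d_def)
    also have "c2 * (q (lc a' y b' w) - b' * q w) / d = (q (lc a' y b' w) - b' * q w) / a'"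
      using c12(3) by (simp add: d(2))
    finally show ?thesis .
  qed
  have "step q w z - step q w y \<le> step q w x"
  proof (rule step_ge[OF c(1)])
    fix a b :: real assume ab: "0 < a" "0 \<le> b" "a + b \<le> 1"
    have "step q w z - (q (lc a x b w) - b * q w) / a \<le> step q w y"
      by (rule step_ge[OF c(2)]) (use *[OF ab] in \<open>simp add: algebra_simps\<close>)
    then show "step q w z - step q w y \<le> (q (lc a x b w) - b * q w) / a" by linarith
  qed
  then show ?thesis by linarith
qed

text \<open>Subadditivity gives one inequality. For the other, \<open>lc a z b w\<close> is
  \<open>lc a x b w\<close> plus \<open>a r\<close> times 1, and \<open>q\<close> itself splits off
  \<open>a r\<close> exactly.\<close>

lemma step_add_one:
  assumes x: "x \<in> ecarrier M" and r: "0 \<le> r" "r \<le> 1"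
    and z: "esum M x (escale M r (eone M)) = Some z"
  shows "step q w z = step q w x + r"
proof (rule antisym)
  let ?r = "escale M r (eone M)"
  have rc: "?r \<in> ecarrier M" using r one_closed by (intro scale_closed) auto
  have zc: "z \<in> ecarrier M" using sum_closed x rc z by blast
  have "step q w ?r \<le> r"
    using step_le_self[OF rc] sub_statesD(4)[OF q r one_closed] sub_states_one[OF q] by simp
  then show "step q w z \<le> step q w x + r"
    using step_subadd[OF x rc z] by linarith
  show "step q w x + r \<le> step q w z"
  proof (rule step_ge[OF zc])
    fix a b :: real assume ab: "0 < a" "0 \<le> b" "a + b \<le> 1"
    have ar: "a * r \<le> a" "0 \<le> a * r" using r ab mult_left_mono[of r 1 a] by simp_all
    have "esum M (lc a x b w) (lc a ?r 0 w) = Some (lc a z b w)"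
      using lc_add[OF x rc w z, of a b 0] ab by simp
    also have "lc a ?r 0 w = escale M (a * r) (eone M)"
      using lc_zero_right[of a ?r w] rc w ab r one_closed scale_scale[of a r "eone M"] by simp
    finally have "q (lc a z b w) = q (lc a x b w) + a * r"
      using sub_statesD(6)[OF q, of "lc a x b w" "a * r"] ab ar x w by (auto simp: lc_sum)
    then have "(q (lc a z b w) - b * q w) / a = (q (lc a x b w) - b * q w) / a + r"
      using ab by (simp add: field_simps)
    then show "step q w x + r \<le> (q (lc a z b w) - b * q w) / a"
      using step_le[OF x ab] by simp
  qed
qed

lemma step_sub_states: "step q w \<in> sub_states"
  unfolding sub_states_def
  using step_nonneg step_le_self sub_statesD(2)[OF q] step_scale step_subadd step_add_one
  by (auto simp: PiE_iff intro: order_trans) (auto simp: step_def)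

end

section \<open>Minimal sublinear functionals and states\<close>

text \<open>Homogeneity and additivity against 1 pass to pointwise infima directly. Subadditivity
  needs the chain: if \<open>q\<close> is chosen for one summand and \<open>q'\<close> for the
  other, the smaller of them serves for both.\<close>

lemma sub_states_Inf:
  assumes C: "C \<subseteq> sub_states" "C \<noteq> {}"
    and ch: "\<And>q q'. \<lbrakk>q \<in> C; q' \<in> C\<rbrakk> \<Longrightarrow>
      (\<forall>x\<in>ecarrier M. q x \<le> q' x) \<or> (\<forall>x\<in>ecarrier M. q' x \<le> q x)"
  shows "(\<lambda>x\<in>ecarrier M. INF q\<in>C. q x) \<in> sub_states"
proof -
  define u where "u = (\<lambda>x\<in>ecarrier M. INF q\<in>C. q x)"
  have bdd: "bdd_below ((\<lambda>q. q x) ` C)" if "x \<in> ecarrier M" for x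
    using C that sub_statesD(1) by (intro bdd_belowI[of _ 0]) auto
  have le: "u x \<le> q x" if "x \<in> ecarrier M" "q \<in> C" for x q
    using that cINF_lower[OF bdd] by (simp add: u_def)
  have ge: "v \<le> u x" if "x \<in> ecarrier M" "\<And>q. q \<in> C \<Longrightarrow> v \<le> q x" for x v
    using that C(2) by (simp add: cINF_greatest u_def)
  obtain q0 where q0: "q0 \<in> C" using C by blast
  have D: "q \<in> sub_states" if "q \<in> C" for q using C that by blast
  have nn: "0 \<le> u x" if "x \<in> ecarrier M" for x
    using that D sub_statesD(1) by (intro ge) blast+
  show ?thesis
    unfolding u_def[symmetric] sub_states_def
  proof (intro CollectI conjI ballI allI impI PiE_I)
    fix x assume x: "x \<in> ecarrier M"
    show "u x \<in> {0..1}"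
      using nn[OF x] le[OF x q0] sub_statesD(2)[OF D[OF q0] x] by auto
  next
    fix x assume "x \<notin> ecarrier M"
    then show "u x = undefined" by (simp add: u_def)
  next
    fix r x assume r: "r \<in> {0..1::real}" and x: "x \<in> ecarrier M"
    have rx: "escale M r x \<in> ecarrier M" using r x by (rule scale_closed)
    have h: "q (escale M r x) = r * q x" if "q \<in> C" for q
      using sub_statesD(4)[OF D[OF that]] r x by auto
    show "u (escale M r x) = r * u x"
    proof (rule antisym)
      show "r * u x \<le> u (escale M r x)"
      proof (rule ge[OF rx])
        fix q assume "q \<in> C"
        then show "r * u x \<le> q (escale M r x)"
          using mult_left_mono[OF le[OF x], of q r] r h[of q] by simp
      qed
      show "u (escale M r x) \<le> r * u x"
      proof (cases "r = 0")
        case True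
        then show ?thesis using le[OF rx q0] h[OF q0] by simp
      next
        case False
        then have r0: "r > 0" using r by simp
        have "u (escale M r x) / r \<le> u x"
        proof (rule ge[OF x])
          fix q assume "q \<in> C"
          then show "u (escale M r x) / r \<le> q x"
            using le[OF rx, of q] h[of q] r0 by (simp add: divide_le_eq mult.commute)
        qed
        then show ?thesis using r0 by (simp add: divide_le_eq mult.commute)
      qed
    qed
  next
    fix x y z assume x: "x \<in> ecarrier M" and y: "y \<in> ecarrier M" and z: "esum M x y = Some z"
    have zc: "z \<in> ecarrier M" using sum_closed x y z by blast
    have *: "u z \<le> q x + q' y" if "q \<in> C" "q' \<in> C" for q q'
    proof -
      have "\<exists>p\<in>C. p x \<le> q x \<and> p y \<le> q' y"
        using ch[OF that] that x y by blast
      then obtain p where p: "p \<in> C" "p x \<le> q x" "p y \<le> q' y" by blast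
      then show ?thesis
        using le[OF zc p(1)] sub_statesD(5)[OF D[OF p(1)] x y z] by linarith
    qed
    have "u z - u y \<le> u x"
    proof (rule ge[OF x])
      fix q assume q: "q \<in> C"
      have "u z - q x \<le> u y"
      proof (rule ge[OF y])
        fix q' assume "q' \<in> C"
        then show "u z - q x \<le> q' y" using *[OF q] by force
      qed
      then show "u z - u y \<le> q x" by linarith
    qed
    then show "u z \<le> u x + u y" by linarith
  next
    fix x r z assume x: "x \<in> ecarrier M" and r: "r \<in> {0..1::real}"
      and z: "esum M x (escale M r (eone M)) = Some z"
    have zc: "z \<in> ecarrier M" using sum_closed[OF x _ z] scale_closed[OF r one_closed] by blast
    have h: "q z = q x + r" if "q \<in> C" for q
      using sub_statesD(6)[OF D[OF that] x _ _ z] r by auto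
    have "u z - r \<le> u x" using le[OF zc] h by (intro ge[OF x]) force
    moreover have "u x + r \<le> u z" using le[OF x] h by (intro ge[OF zc]) force
    ultimately show "u z = u x + r" by linarith
  qed
qed

lemma minimal_sub_state:
  assumes q0: "q0 \<in> sub_states"
  obtains L where "L \<in> sub_states" "\<And>x. x \<in> ecarrier M \<Longrightarrow> L x \<le> q0 x"
    "\<And>q. \<lbrakk>q \<in> sub_states; \<And>x. x \<in> ecarrier M \<Longrightarrow> q x \<le> L x\<rbrakk> \<Longrightarrow> q = L"
proof -
  define A where "A = {q \<in> sub_states. \<forall>x\<in>ecarrier M. q x \<le> q0 x}"
  \<comment> \<open>Zorn's lemma is applied to the reversed pointwise order, so that its maximal
    element is a minimal functional.\<close>
  define P where "P = (\<lambda>q q'. \<forall>x\<in>ecarrier M. q' x \<le> (q x :: real))"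
  have "\<exists>m\<in>A. \<forall>a\<in>A. P m a \<longrightarrow> a = m"
  proof (rule predicate_Zorn)
    show "partial_order_on A (relation_of P A)"
    proof (rule partial_order_on_relation_ofI)
      fix a b assume "a \<in> A" "b \<in> A" "P a b" "P b a"
      then show "a = b"
        unfolding A_def P_def using sub_statesD(3)
        by (intro extensionalityI[of a "ecarrier M" b]) (auto intro: antisym)
    qed (auto simp: P_def intro: order_trans)
  next
    fix C assume C: "C \<in> Chains (relation_of P A)"
    have CA: "C \<subseteq> A" using C unfolding Chains_def relation_of_def by blast
    show "\<exists>u\<in>A. \<forall>a\<in>C. P a u"
    proof (cases "C = {}")
      case True
      then show ?thesis using q0 by (auto simp: A_def)
    next
      case False
      define u where "u = (\<lambda>x\<in>ecarrier M. INF q\<in>C. q x)"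
      have us: "u \<in> sub_states"
        unfolding u_def
      proof (rule sub_states_Inf)
        show "C \<subseteq> sub_states" using CA by (auto simp: A_def)
        fix q q' assume "q \<in> C" "q' \<in> C"
        then have "(q, q') \<in> relation_of P A \<or> (q', q) \<in> relation_of P A"
          using C unfolding Chains_def by blast
        then show "(\<forall>x\<in>ecarrier M. q x \<le> q' x) \<or> (\<forall>x\<in>ecarrier M. q' x \<le> q x)"
          unfolding relation_of_def P_def by blast
      qed (fact False)
      have le: "u x \<le> q x" if "x \<in> ecarrier M" "q \<in> C" for x q
      proof -
        have "bdd_below ((\<lambda>q. q x) ` C)"
          using CA that sub_statesD(1) by (intro bdd_belowI[of _ 0]) (auto simp: A_def)
        then show ?thesis using that cINF_lower by (simp add: u_def)
      qed
      obtain p where p: "p \<in> C" using False by blast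
      have "p x \<le> q0 x" if "x \<in> ecarrier M" for x
        using p CA that by (auto simp: A_def)
      then have "u \<in> A"
        using us le[OF _ p] unfolding A_def by (blast intro: order_trans)
      moreover have "\<forall>a\<in>C. P a u" using le by (auto simp: P_def)
      ultimately show ?thesis by blast
    qed
  qed
  then obtain m where m: "m \<in> A" "\<And>a. \<lbrakk>a \<in> A; P m a\<rbrakk> \<Longrightarrow> a = m" by blast
  show ?thesis
  proof (rule that[of m])
    fix q assume "q \<in> sub_states" "\<And>x. x \<in> ecarrier M \<Longrightarrow> q x \<le> m x"
    moreover have "m x \<le> q0 x" if "x \<in> ecarrier M" for x
      using m(1) that by (simp add: A_def)
    ultimately show "q = m" using m(2)[of q] unfolding A_def P_def by (blast intro: order_trans)
  qed (use m(1) in \<open>simp_all add: A_def\<close>)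
qed

text \<open>Definedness of \<open>k x + k y\<close> in the interval comes for free: the sum equals
  \<open>k z\<close>, which is at most 1.\<close>

lemma state_iff: "k \<in> states M \<longleftrightarrow> k \<in> ecarrier M \<rightarrow>\<^sub>E {0..1} \<and> k (eone M) = 1 \<and>
   (\<forall>x\<in>ecarrier M. \<forall>y\<in>ecarrier M. \<forall>z. esum M x y = Some z \<longrightarrow> k z = k x + k y) \<and>
   (\<forall>r\<in>{0..1}. \<forall>x\<in>ecarrier M. k (escale M r x) = r * k x)"
proof -
  have "(esum unit_emod (k x) (k y) = Some (k z)) \<longleftrightarrow> k z = k x + k y"
    if "k \<in> ecarrier M \<rightarrow>\<^sub>E {0..1}" "x \<in> ecarrier M" "y \<in> ecarrier M" "esum M x y = Some z" for x y z
  proof -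
    have "k z \<le> 1" using sum_closed[OF that(2-)] that(1) by (auto simp: PiE_iff)
    then show ?thesis by (auto simp: unit_emod_def)
  qed
  then have "(\<forall>x\<in>ecarrier M. \<forall>y\<in>ecarrier M. \<forall>z. esum M x y = Some z \<longrightarrow>
      esum unit_emod (k x) (k y) = Some (k z)) \<longleftrightarrow>
    (\<forall>x\<in>ecarrier M. \<forall>y\<in>ecarrier M. \<forall>z. esum M x y = Some z \<longrightarrow> k z = k x + k y)"
    if "k \<in> ecarrier M \<rightarrow>\<^sub>E {0..1}"
    using that by blast
  then show ?thesis
    unfolding EMod_hom_def unit_emod_simps mem_Collect_eq by blast
qed

lemma minimal_sub_state_is_state:
  assumes L: "L \<in> sub_states"
    and min: "\<And>q. \<lbrakk>q \<in> sub_states; \<And>x. x \<in> ecarrier M \<Longrightarrow> q x \<le> L x\<rbrakk> \<Longrightarrow> q = L"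
  shows "L \<in> states M"
proof -
  have add: "L z = L x + L y"
    if x: "x \<in> ecarrier M" and y: "y \<in> ecarrier M" and z: "esum M x y = Some z" for x y z
  proof (rule antisym)
    show "L z \<le> L x + L y" using sub_statesD(5)[OF L x y z] .
    have zc: "z \<in> ecarrier M" using sum_closed x y z by blast
    \<comment> \<open>By minimality the lowering has no effect. Its defining inequality at the
      weights 1/2 and 1/2 then reads \<open>L x \<le> 2 L(z/2) - L y\<close>, which is
      superadditivity.\<close>
    have "step L y = L" using step_sub_states[OF L y] step_le_self[OF L y] by (intro min)
    then have "L x \<le> (L (lc (1/2) x (1/2) y) - 1/2 * L y) / (1/2)"
      using step_le[OF L y x, of "1/2" "1/2"] by simp
    also have "lc (1/2) x (1/2) y = escale M (1/2) z"
      using scale_add_right[of "1/2" x y z] x y z by (simp add: lc_def)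
    finally show "L x + L y \<le> L z" using zc by (simp add: sub_statesD(4)[OF L])
  qed
  show ?thesis
    unfolding state_iff
    using add sub_states_one[OF L] L by (auto simp: sub_states_def)
qed

text \<open>Minimising below \<open>step q w\<close> instead of \<open>q\<close> is what produces
  \<open>L w = q w\<close>, through the bound at the complement of \<open>w\<close>.\<close>

theorem state_below_sub_state:
  assumes q: "q \<in> sub_states" and w: "w \<in> ecarrier M"
  obtains L where "L \<in> states M" "\<And>x. x \<in> ecarrier M \<Longrightarrow> L x \<le> q x" "L w = q w"
proof -
  obtain L where L: "L \<in> sub_states" "\<And>x. x \<in> ecarrier M \<Longrightarrow> L x \<le> step q w x"
    "\<And>p. \<lbrakk>p \<in> sub_states; \<And>x. x \<in> ecarrier M \<Longrightarrow> p x \<le> L x\<rbrakk> \<Longrightarrow> p = L"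
    using minimal_sub_state[OF step_sub_states[OF q w]] by metis
  have st: "L \<in> states M" by (rule minimal_sub_state_is_state[OF L(1,3)])
  have le: "L x \<le> q x" if "x \<in> ecarrier M" for x
    using L(2)[OF that] step_le_self[OF q w that] by linarith
  have "L w + L (ecompl M w) = 1"
    using st w compl_closed[OF w] sum_compl[OF w] unfolding state_iff by metis
  moreover have "L (ecompl M w) \<le> 1 - q w"
    using L(2)[of "ecompl M w"] step_compl[OF q w] compl_closed[OF w] by linarith
  ultimately have "L w = q w" using le[OF w] by linarith
  then show ?thesis using that st le by blast
qed

section \<open>Elementary properties of states\<close>

lemma ele_one: "x \<in> ecarrier M \<Longrightarrow> ele M x (eone M)"
  using sum_compl compl_closed unfolding ele_def by blast

lemma zero_ele: "x \<in> ecarrier M \<Longrightarrow> ele M (ezero M) x"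
  using sum_zero sum_commute[OF zero_closed] unfolding ele_def by fastforce

lemma stateD:
  assumes "k \<in> states M"
  shows "x \<in> ecarrier M \<Longrightarrow> 0 \<le> k x" "x \<in> ecarrier M \<Longrightarrow> k x \<le> 1" "k (eone M) = 1"
    "k \<in> extensional (ecarrier M)"
    "\<lbrakk>x \<in> ecarrier M; y \<in> ecarrier M; esum M x y = Some z\<rbrakk> \<Longrightarrow> k z = k x + k y"
    "\<lbrakk>0 \<le> r; r \<le> 1; x \<in> ecarrier M\<rbrakk> \<Longrightarrow> k (escale M r x) = r * k x"
  using assms unfolding state_iff by (auto simp: PiE_iff)

lemma state_compl: "\<lbrakk>k \<in> states M; x \<in> ecarrier M\<rbrakk> \<Longrightarrow> k (ecompl M x) = 1 - k x"
  using stateD(5)[of k x "ecompl M x"] sum_compl[of x] compl_closed[of x] stateD(3)[of k] by force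

lemma state_zero: "k \<in> states M \<Longrightarrow> k (ezero M) = 0"
  using state_compl[of k "eone M"] stateD(3)[of k] one_closed by (simp add: compl_one)

lemma state_mono:
  "\<lbrakk>k \<in> states M; x \<in> ecarrier M; y \<in> ecarrier M; ele M x y\<rbrakk> \<Longrightarrow> k x \<le> k y"
  unfolding ele_def using stateD(5)[of k x] stateD(1)[of k] by force

lemma state_lc:
  assumes "k \<in> states M" "0 \<le> a" "0 \<le> b" "a + b \<le> 1" "x \<in> ecarrier M" "y \<in> ecarrier M"
  shows "k (lc a x b y) = a * k x + b * k y"
proof -
  have "k (lc a x b y) = k (escale M a x) + k (escale M b y)"
    using assms lc_sum(1)[OF assms(2-)] by (intro stateD(5)[OF assms(1)]) (auto intro!: scale_closed)
  then show ?thesis using assms stateD(6)[OF assms(1)] by simp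
qed

lemma state_half_le:
  assumes k: "k \<in> states M" and c: "x \<in> ecarrier M" "y \<in> ecarrier M"
    and r: "r \<in> {0..1}" and h: "half_le M r x y"
  shows "k x \<le> k y + r"
proof -
  obtain z where z: "esum M (escale M (1/2) y) (escale M (r/2) (eone M)) = Some z"
    "ele M (escale M (1/2) x) z"
    using h unfolding half_le_def by blast
  have z': "z = lc (1/2) y (r/2) (eone M)" using z by (simp add: lc_def)
  have "k (escale M (1/2) x) \<le> k z"
    using r c one_closed z by (intro state_mono[OF k]) (auto simp: z' intro!: scale_closed lc_sum)
  then show ?thesis
    using r c one_closed by (simp add: z' state_lc[OF k] stateD[OF k])
qed

text \<open>The difference is expressible by the operations of \<open>C\<close>: it is the
  complement of \<open>d\<close> plus the complement of \<open>c\<close>.\<close>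

lemma subeffect_diff:
  assumes C: "subeffect M C" and c: "c \<in> C" "d \<in> C" and u: "u \<in> ecarrier M" "esum M d u = Some c"
  shows "u \<in> C"
proof -
  have cl: "c \<in> ecarrier M" "d \<in> ecarrier M" "ecompl M c \<in> C" "ecompl M c \<in> ecarrier M"
    using C c compl_closed unfolding subeffect_def by blast+
  have "padd (Some u) (padd (Some d) (Some (ecompl M c))) = padd (padd (Some d) (Some u)) (Some (ecompl M c))"
    by (simp add: padd_ac)
  also have "\<dots> = Some (eone M)" using u cl sum_compl by (simp add: padd_Some)
  finally obtain v where v: "padd (Some d) (Some (ecompl M c)) = Some v" "padd (Some u) (Some v) = Some (eone M)"
    using padd_eq_SomeD by metis
  have vc: "v \<in> ecarrier M" "esum M d (ecompl M c) = Some v" "esum M v u = Some (eone M)"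
    using v padd_SomeD padd_commute by metis+
  then have "v \<in> C" using C c cl unfolding subeffect_def by blast
  moreover have "u = ecompl M v" using compl_unique vc u by blast
  ultimately show ?thesis using C unfolding subeffect_def by blast
qed

section \<open>Extension of a state from a submodule\<close>

context
  fixes C k
  assumes C: "subeffect M C" and k: "k \<in> states (M\<lparr>ecarrier := C\<rparr>)"
begin

lemma subD:
  shows "c \<in> C \<Longrightarrow> c \<in> ecarrier M" "ezero M \<in> C" "eone M \<in> C" "c \<in> C \<Longrightarrow> ecompl M c \<in> C"
    "\<lbrakk>c \<in> C; d \<in> C; esum M c d = Some z\<rbrakk> \<Longrightarrow> z \<in> C"
    "\<lbrakk>0 \<le> r; r \<le> 1; c \<in> C\<rbrakk> \<Longrightarrow> escale M r c \<in> C"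
  using C unfolding subeffect_def eone_def Ball_def atLeastAtMost_iff by blast+

lemma sub_stateD:
  shows "c \<in> C \<Longrightarrow> 0 \<le> k c" "c \<in> C \<Longrightarrow> k c \<le> 1" "k (eone M) = 1"
    "\<lbrakk>c \<in> C; d \<in> C; esum M c d = Some z\<rbrakk> \<Longrightarrow> k z = k c + k d"
    "\<lbrakk>0 \<le> r; r \<le> 1; c \<in> C\<rbrakk> \<Longrightarrow> k (escale M r c) = r * k c"
proof -
  interpret N: emodule "M\<lparr>ecarrier := C\<rparr>"
    using subeffect_EMod[OF C] by (simp add: emodule_iff)
  show "c \<in> C \<Longrightarrow> 0 \<le> k c" "c \<in> C \<Longrightarrow> k c \<le> 1" "k (eone M) = 1"
    "\<lbrakk>c \<in> C; d \<in> C; esum M c d = Some z\<rbrakk> \<Longrightarrow> k z = k c + k d"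
    "\<lbrakk>0 \<le> r; r \<le> 1; c \<in> C\<rbrakk> \<Longrightarrow> k (escale M r c) = r * k c"
    using N.stateD[OF k] by (simp_all add: eone_def)
qed

text \<open>The factor \<open>s\<close> stands in for multiples \<open>c/s\<close> that do not exist in \<open>M\<close>; without it the
  infimum would not be homogeneous.\<close>

definition upper :: "'a \<Rightarrow> real" where
  "upper = (\<lambda>x\<in>ecarrier M. Inf {k c / s | c s. c \<in> C \<and> 0 < s \<and> s \<le> 1 \<and> ele M (escale M s x) c})"

lemma upper_le:
  assumes "x \<in> ecarrier M" "c \<in> C" "0 < s" "s \<le> 1" "ele M (escale M s x) c"
  shows "upper x \<le> k c / s"
proof -
  have "bdd_below {k c / s | c s. c \<in> C \<and> 0 < s \<and> s \<le> 1 \<and> ele M (escale M s x) c}"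
    using sub_stateD(1) by (intro bdd_belowI[of _ 0]) auto
  then show ?thesis using assms unfolding upper_def by (auto intro!: cInf_lower)
qed

lemma upper_ge:
  assumes "x \<in> ecarrier M"
    and "\<And>c s. \<lbrakk>c \<in> C; 0 < s; s \<le> 1; ele M (escale M s x) c\<rbrakk> \<Longrightarrow> v \<le> k c / s"
  shows "v \<le> upper x"
proof -
  have "k (eone M) / 1 \<in> {k c / s | c s. c \<in> C \<and> 0 < s \<and> s \<le> 1 \<and> ele M (escale M s x) c}"
    using subD(3) assms(1) ele_one[OF assms(1)]
    by (intro CollectI exI[of _ "eone M"] exI[of _ 1]) (auto simp: scale_one)
  then have ne: "{k c / s | c s. c \<in> C \<and> 0 < s \<and> s \<le> 1 \<and> ele M (escale M s x) c} \<noteq> {}" by blast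
  have "upper x = Inf {k c / s | c s. c \<in> C \<and> 0 < s \<and> s \<le> 1 \<and> ele M (escale M s x) c}"
    using assms(1) by (simp add: upper_def)
  also have "v \<le> \<dots>" using assms(2) by (intro cInf_greatest[OF ne]) blast
  finally show ?thesis .
qed

lemma upper_nonneg: "x \<in> ecarrier M \<Longrightarrow> 0 \<le> upper x"
  using sub_stateD(1) by (intro upper_ge) auto

lemma upper_le_one: "x \<in> ecarrier M \<Longrightarrow> upper x \<le> 1"
  using upper_le[of x "eone M" 1] subD(3) sub_stateD(3) ele_one by (simp add: scale_one)

lemma upper_le_sub_state: "c \<in> C \<Longrightarrow> upper c \<le> k c"
  using upper_le[of c c 1] subD(1)[of c] ele_refl[of c] by (simp add: scale_one)

lemma upper_scale:
  assumes r: "0 \<le> r" "r \<le> 1" and x: "x \<in> ecarrier M"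
  shows "upper (escale M r x) = r * upper x"
proof (rule antisym)
  have rx: "escale M r x \<in> ecarrier M" using r x by (intro scale_closed) auto
  show "upper (escale M r x) \<le> r * upper x"
  proof (cases "r = 0")
    case True
    have "upper (ezero M) \<le> k (ezero M)" using upper_le_sub_state subD(2) by blast
    also have "k (ezero M) = 0"
      using sub_stateD(5)[of 0 "eone M"] subD(3) one_closed scale_zero_left by simp
    finally show ?thesis using True x scale_zero_left by simp
  next
    case False
    with r have r0: "0 < r" by simp
    have "upper (escale M r x) / r \<le> upper x"
    proof (rule upper_ge[OF x])
      fix c s assume c: "c \<in> C" "0 < s" "s \<le> 1" "ele M (escale M s x) c"
      have "ele M (escale M r (escale M s x)) (escale M r c)"
        using c r x subD(1) by (intro scale_mono) (auto intro!: scale_closed)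
      moreover have "escale M s (escale M r x) = escale M r (escale M s x)"
        using scale_scale[of s r x] scale_scale[of r s x] c r x by (simp add: mult.commute)
      ultimately have "upper (escale M r x) \<le> k (escale M r c) / s"
        using c r subD(6) by (intro upper_le[OF rx]) auto
      also have "\<dots> = r * (k c / s)" using sub_stateD(5)[OF r c(1)] by simp
      finally show "upper (escale M r x) / r \<le> k c / s"
        using r0 by (simp add: divide_le_eq mult.commute)
    qed
    then show ?thesis using r0 by (simp add: divide_le_eq mult.commute)
  qed
  show "r * upper x \<le> upper (escale M r x)"
  proof (cases "r = 0")
    case True
    then show ?thesis using upper_nonneg[OF rx] by simp
  next
    case False
    with r have r0: "0 < r" by simp
    show ?thesis
    proof (rule upper_ge[OF rx])
      fix c s assume c: "c \<in> C" "0 < s" "s \<le> 1" "ele M (escale M s (escale M r x)) c"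
      have sr: "0 < s * r" "s * r \<le> 1" using c r r0 by (auto intro: mult_le_one)
      have "upper x \<le> k c / (s * r)"
        using c r sr x scale_scale[of s r x] by (intro upper_le) auto
      then have "r * upper x \<le> r * (k c / (s * r))" using r0 by (intro mult_left_mono) auto
      then show "r * upper x \<le> k c / s" using r0 by simp
    qed
  qed
qed

lemma upper_subadd:
  assumes x: "x \<in> ecarrier M" and y: "y \<in> ecarrier M" and z: "esum M x y = Some z"
  shows "upper z \<le> upper x + upper y"
proof -
  have zc: "z \<in> ecarrier M" using sum_closed x y z by blast
  have *: "upper z \<le> k c / s + k d / t"
    if c: "c \<in> C" "0 < s" "s \<le> 1" "ele M (escale M s x) c"
      and d: "d \<in> C" "0 < t" "t \<le> 1" "ele M (escale M t y) d" for c s d t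
  proof -
    \<comment> \<open>As in \<open>step_subadd\<close>, the convex weights are chosen so that
      \<open>a s = b t\<close>. With this common value \<open>u\<close>, the element
      \<open>u z\<close> lies below a combination of \<open>c\<close> and \<open>d\<close>, which is
      in \<open>C\<close>.\<close>
    define a b where "a = t / (s + t)" and "b = s / (s + t)"
    have "s + t \<noteq> 0" using c d by simp
    then have ab: "0 < a" "a \<le> 1" "0 < b" "b \<le> 1" "a + b = 1" "a * s = b * t"
      using c d by (auto simp: a_def b_def field_simps add_divide_distrib[symmetric])
    define u where "u = a * s"
    have u: "0 < u" "u \<le> 1" "u = b * t"
      using ab c d mult_le_one[of a s] by (auto simp: u_def)
    have cc: "c \<in> ecarrier M" "d \<in> ecarrier M" using c d subD(1) by auto
    have l1: "ele M (escale M u x) (escale M a c)"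
      using scale_mono[of a "escale M s x" c] scale_scale[of a s x] scale_closed[of s x] ab c x cc
      by (simp add: u_def)
    have l2: "ele M (escale M u y) (escale M b d)"
      using scale_mono[of b "escale M t y" d] scale_scale[of b t y] scale_closed[of t y] ab d y cc
      by (simp add: u(3))
    have e: "esum M (escale M a c) (escale M b d) = Some (lc a c b d)"
      using ab cc by (intro lc_sum) auto
    have "\<exists>v\<in>ecarrier M. esum M (escale M u x) (escale M u y) = Some v \<and> ele M v (lc a c b d)"
      using x y u cc ab by (intro ele_add[OF _ _ _ _ l1 l2 e]) (auto intro!: scale_closed)
    then have "ele M (escale M u z) (lc a c b d)"
      using scale_add_right[of u x y z] u x y z by auto
    moreover have m: "escale M a c \<in> C" "escale M b d \<in> C" using subD(6) ab c d by auto
    ultimately have "upper z \<le> k (lc a c b d) / u"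
      using subD(5)[OF m e] u by (intro upper_le[OF zc]) auto
    also have "k (lc a c b d) = a * k c + b * k d"
      using sub_stateD(4)[OF m e] sub_stateD(5) ab c d by simp
    also have "(a * k c + b * k d) / u = a * k c / u + b * k d / u" by (simp add: add_divide_distrib)
    also have "a * k c / u = k c / s" using ab(1) by (simp add: u_def)
    also have "b * k d / u = k d / t" using ab(3) by (simp add: u(3))
    finally show ?thesis .
  qed
  have "upper z - upper y \<le> upper x"
  proof (rule upper_ge[OF x])
    fix c s assume c: "c \<in> C" "0 < s" "s \<le> 1" "ele M (escale M s x) c"
    have "upper z - k c / s \<le> upper y"
    proof (rule upper_ge[OF y])
      fix d t assume "d \<in> C" "0 < t" "t \<le> 1" "ele M (escale M t y) d"
      then show "upper z - k c / s \<le> k d / t" using *[OF c] by force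
    qed
    then show "upper z - upper y \<le> k c / s" by linarith
  qed
  then show ?thesis by linarith
qed

text \<open>For the lower bound, a majorant \<open>c\<close> of \<open>s z\<close> also contains the
  summand \<open>s r 1\<close> of \<open>s z\<close>. Removing it leaves an element \<open>d\<close>
  of \<open>C\<close> that majorises \<open>s x\<close> and has
  \<open>k d = k c - s r\<close>.\<close>

lemma upper_add_one:
  assumes x: "x \<in> ecarrier M" and r: "0 \<le> r" "r \<le> 1"
    and z: "esum M x (escale M r (eone M)) = Some z"
  shows "upper z = upper x + r"
proof (rule antisym)
  let ?r = "escale M r (eone M)"
  have rC: "?r \<in> C" "?r \<in> ecarrier M" using subD(1,3,6) r by auto
  have kr: "k ?r = r" using sub_stateD(3,5) subD(3) r by simp
  have zc: "z \<in> ecarrier M" using sum_closed x rC z by blast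
  show "upper z \<le> upper x + r"
    using upper_subadd[OF x rC(2) z] upper_le_sub_state[OF rC(1)] kr by linarith
  show "upper x + r \<le> upper z"
  proof (rule upper_ge[OF zc])
    fix c s assume c: "c \<in> C" "0 < s" "s \<le> 1" "ele M (escale M s z) c"
    have s: "s \<in> {0..1}" using c by simp
    obtain u where u: "u \<in> ecarrier M" "esum M (escale M s z) u = Some c"
      using c unfolding ele_def by blast
    have cl: "escale M s x \<in> ecarrier M" "escale M s ?r \<in> ecarrier M" "escale M s z \<in> ecarrier M"
      using scale_closed s x rC zc by auto
    have "padd (Some (escale M s ?r)) (padd (Some (escale M s x)) (Some u))
        = padd (padd (Some (escale M s x)) (Some (escale M s ?r))) (Some u)" by (simp add: padd_ac)
    also have "\<dots> = Some c"
      using cl u scale_add_right[OF s x rC(2) z] by (simp add: padd_Some)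
    finally obtain d where d: "padd (Some (escale M s x)) (Some u) = Some d"
      "padd (Some (escale M s ?r)) (Some d) = Some c"
      using padd_eq_SomeD by metis
    have srC: "escale M s ?r \<in> C" using subD(6) rC c by simp
    have d': "d \<in> ecarrier M" "esum M (escale M s x) u = Some d" "esum M (escale M s ?r) d = Some c"
      using padd_SomeD d by blast+
    have dC: "d \<in> C" using subeffect_diff[OF C c(1) srC d'(1,3)] .
    have "upper x \<le> k d / s"
      using d' u c dC cl sum_le_left by (intro upper_le[OF x]) auto
    moreover have "k c = s * r + k d"
      using sub_stateD(4)[OF srC dC d'(3)] sub_stateD(5)[of s ?r] rC kr c by simp
    ultimately show "upper x + r \<le> k c / s"
      using c by (simp add: add_divide_distrib)
  qed
qed

lemma upper_sub_states: "upper \<in> sub_states"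
  unfolding sub_states_def
  using upper_nonneg upper_le_one upper_scale upper_subadd upper_add_one
  by (auto simp: PiE_iff) (auto simp: upper_def)

text \<open>The last conclusion records that \<open>L w\<close> is the infimum
  \<open>upper w\<close>. It turns information about the value \<open>L w\<close> into an actual
  element of \<open>C\<close> above a multiple of \<open>w\<close>.\<close>

theorem extend_state:
  assumes w: "w \<in> ecarrier M"
  obtains L where "L \<in> states M" "\<And>c. c \<in> C \<Longrightarrow> L c = k c"
    "\<And>\<epsilon>. 0 < \<epsilon> \<Longrightarrow> \<exists>c\<in>C. \<exists>s. 0 < s \<and> s \<le> 1 \<and> ele M (escale M s w) c \<and> k c < s * (L w + \<epsilon>)"
proof -
  obtain L where L: "L \<in> states M" "\<And>x. x \<in> ecarrier M \<Longrightarrow> L x \<le> upper x" "L w = upper w"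
    using state_below_sub_state[OF upper_sub_states w] by blast
  have le: "L c \<le> k c" if "c \<in> C" for c
    using L(2)[of c] upper_le_sub_state[OF that] subD(1)[OF that] by linarith
  \<comment> \<open>Passing to the complement turns the upper bound \<open>L \<le> k\<close> on
    \<open>C\<close> into a lower bound.\<close>
  have "L c = k c" if c: "c \<in> C" for c
  proof -
    have "k c + k (ecompl M c) = 1"
      using sub_stateD(3,4) sum_compl[of c] subD(1,4) c by metis
    then show ?thesis
      using le[OF c] le[of "ecompl M c"] subD(1,4) c state_compl[OF L(1), of c] by force
  qed
  moreover have "\<exists>c\<in>C. \<exists>s. 0 < s \<and> s \<le> 1 \<and> ele M (escale M s w) c \<and> k c < s * (L w + \<epsilon>)" if "0 < \<epsilon>" for \<epsilon>
  proof (rule ccontr)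
    assume "\<not> ?thesis"
    then have "L w + \<epsilon> \<le> upper w"
      by (intro upper_ge[OF w]) (force simp: le_divide_eq mult.commute)
    then show False using L(3) that by simp
  qed
  ultimately show ?thesis using that L(1) by blast
qed

end

section \<open>States and the order of an Archimedean module\<close>

lemma trivial_carrier:
  assumes "eone M = ezero M" "x \<in> ecarrier M"
  shows "x = ezero M"
  using sum_one[OF assms(2)] assms sum_zero[OF assms(2)] by simp

lemma one_multiple_inj:
  assumes ne: "eone M \<noteq> ezero M" and r: "0 \<le> r" "r \<le> 1" "escale M r (eone M) = ezero M"
  shows "r = 0"
proof (rule ccontr)
  assume "r \<noteq> 0"
  have "ele M (escale M r (eone M)) (escale M r (ezero M))"
    using r scale_zero_right[of r] ele_refl[OF zero_closed] by simp
  then have "ele M (eone M) (ezero M)"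
    by (rule scale_le_cancel[OF _ r(2) one_closed zero_closed, rotated]) (use r(1) \<open>r \<noteq> 0\<close> in simp)
  then show False using ne ele_antisym[OF one_closed zero_closed] zero_ele[OF one_closed] by blast
qed

text \<open>If \<open>r + s > 1\<close>, reassociating the sum yields a defined sum of
  \<open>(r + s - 1) 1\<close> and 1. This forces \<open>(r + s - 1) 1 = 0\<close>, contrary to
  \<open>one_multiple_inj\<close>.\<close>

lemma one_multiple_sum:
  assumes ne: "eone M \<noteq> ezero M" and r: "0 \<le> r" "r \<le> 1" and s: "0 \<le> s" "s \<le> 1"
    and z: "esum M (escale M r (eone M)) (escale M s (eone M)) = Some z"
  shows "r + s \<le> 1"
proof (rule ccontr)
  let ?e = "\<lambda>r. escale M r (eone M)"
  assume n: "\<not> r + s \<le> 1"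
  have cl: "?e t \<in> ecarrier M" if "0 \<le> t" "t \<le> 1" for t using that one_closed by (intro scale_closed) auto
  have "padd (Some (?e (r + s - 1))) (Some (eone M))
      = padd (Some (?e (r + s - 1))) (padd (Some (?e (1 - r))) (Some (?e r)))"
    using scale_add_left[of "1 - r" r "eone M"] r one_closed cl by (simp add: padd_Some scale_one)
  also have "\<dots> = padd (Some (?e s)) (Some (?e r))"
    unfolding padd_assoc[symmetric]
    using scale_add_left[of "r + s - 1" "1 - r" "eone M"] r s n one_closed cl by (simp add: padd_Some)
  also have "\<dots> \<noteq> None" using z r s cl sum_commute[of "?e s" "?e r"] by (simp add: padd_Some)
  finally have "esum M (?e (r + s - 1)) (eone M) \<noteq> None"
    using cl[of "r + s - 1"] r s n one_closed by (simp add: padd_Some)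
  then have "?e (r + s - 1) = ezero M" using sum_one cl[of "r + s - 1"] r s n by simp
  then show False using one_multiple_inj[OF ne, of "r + s - 1"] r s n by simp
qed

lemma one_multiple_eq:
  assumes ne: "eone M \<noteq> ezero M" and r: "0 \<le> r" "r \<le> 1" and s: "0 \<le> s" "s \<le> 1"
    and e: "escale M r (eone M) = escale M s (eone M)"
  shows "r = s"
proof -
  have *: "a \<le> b" if ab: "0 \<le> a" "a \<le> 1" "0 \<le> b" "b \<le> 1" "escale M a (eone M) = escale M b (eone M)" for a b
  proof -
    have "esum M (escale M a (eone M)) (escale M (1 - b) (eone M)) = Some (escale M 1 (eone M))"
      unfolding ab(5) using scale_add_left[of b "1 - b" "eone M"] ab one_closed by simp
    then show ?thesis using one_multiple_sum[OF ne, of a "1 - b"] ab by simp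
  qed
  show ?thesis using *[of r s] *[of s r] assms by force
qed

text \<open>The state \<open>r 1 \<mapsto> r\<close> on the multiples of 1, well defined when 1
  differs from 0, is extended tightly at a point \<open>w\<close> that encodes \<open>x - y\<close>.
  By hypothesis the extension is at most 1/2 there. Tightness then yields a multiple of 1 above a
  multiple of \<open>w\<close>, and hence \<open>half_le M r x y\<close> for every positive
  \<open>r\<close>.\<close>

lemma ele_of_states:
  assumes arch: "archimedean M" and x: "x \<in> ecarrier M" and y: "y \<in> ecarrier M"
    and le: "\<And>k. k \<in> states M \<Longrightarrow> k x \<le> k y"
  shows "ele M x y"
proof (cases "eone M = ezero M")
  case True
  then show ?thesis using trivial_carrier x y ele_refl by metis
next
  case ne: False
  let ?e = "\<lambda>r. escale M r (eone M)"
  have ecl: "?e r \<in> ecarrier M" if "r \<in> {0..1}" for r using that one_closed by (rule scale_closed)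
  define C where "C = ?e ` {0..1}"
  define k where "k = restrict (inv_into {0..1} ?e) C"
  have inj: "inj_on ?e {0..1}" using one_multiple_eq[OF ne] by (intro inj_onI) auto
  have ke: "k (?e r) = r" if "r \<in> {0..1}" for r
    using inv_into_f_f[OF inj that] that by (simp add: k_def C_def)
  have sm: "r + s \<le> 1 \<and> z = ?e (r + s)"
    if "r \<in> {0..1}" "s \<in> {0..1}" "esum M (?e r) (?e s) = Some z" for r s z
    using that one_multiple_sum[OF ne, of r s z] scale_add_left[of r s "eone M"] one_closed by auto
  have C: "subeffect M C"
    unfolding subeffect_def
  proof (intro conjI ballI allI impI)
    show "C \<subseteq> ecarrier M" using ecl by (auto simp: C_def simp del: atLeastAtMost_iff)
    show "ezero M \<in> C" unfolding C_def
      by (rule image_eqI[of _ _ 0]) (use scale_zero_left one_closed in auto)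
  next
    fix c assume "c \<in> C"
    then obtain r where r: "r \<in> {0..1}" "c = ?e r" unfolding C_def by blast
    have "?e (1 - r) = ecompl M c"
      using r ecl[of r] ecl[of "1 - r"] scale_add_left[of r "1 - r" "eone M"] one_closed
      by (intro compl_unique) (auto simp: scale_one)
    then show "ecompl M c \<in> C"
      unfolding C_def using r by (intro image_eqI[of _ _ "1 - r"]) auto
  next
    fix c d z assume "c \<in> C" "d \<in> C" and z: "esum M c d = Some z"
    then obtain r s where "r \<in> {0..1}" "c = ?e r" "s \<in> {0..1}" "d = ?e s" unfolding C_def by blast
    then show "z \<in> C" unfolding C_def using sm[of r s z] z by (intro image_eqI[of _ _ "r + s"]) auto
  next
    fix r c assume r: "r \<in> {0..1::real}" and "c \<in> C"
    then obtain s where s: "s \<in> {0..1}" "c = ?e s" unfolding C_def by blast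
    then show "escale M r c \<in> C"
      unfolding C_def using r scale_scale[of r s "eone M"] one_closed
      by (intro image_eqI[of _ _ "r * s"]) (auto intro: mult_le_one)
  qed
  interpret N: emodule "M\<lparr>ecarrier := C\<rparr>"
    using subeffect_EMod[OF C] by (simp add: emodule_iff)
  have k: "k \<in> states (M\<lparr>ecarrier := C\<rparr>)"
    unfolding N.state_iff
  proof (intro conjI ballI allI impI PiE_I)
    fix c assume "c \<in> ecarrier (M\<lparr>ecarrier := C\<rparr>)"
    then obtain r where "r \<in> {0..1}" "c = ?e r" by (auto simp: C_def)
    then show "k c \<in> {0..1}" using ke by simp
  next
    fix c assume "c \<notin> ecarrier (M\<lparr>ecarrier := C\<rparr>)"
    then show "k c = undefined" by (simp add: k_def)
  next
    show "k (eone (M\<lparr>ecarrier := C\<rparr>)) = 1"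
      using ke[of 1] scale_one[OF one_closed] by (simp add: eone_def)
  next
    fix c d z assume "c \<in> ecarrier (M\<lparr>ecarrier := C\<rparr>)" "d \<in> ecarrier (M\<lparr>ecarrier := C\<rparr>)"
      and z: "esum (M\<lparr>ecarrier := C\<rparr>) c d = Some z"
    then obtain r s where rs: "r \<in> {0..1}" "c = ?e r" "s \<in> {0..1}" "d = ?e s" by (auto simp: C_def)
    then have "r + s \<le> 1" "z = ?e (r + s)" using sm[of r s z] z by auto
    then show "k z = k c + k d" using ke rs by auto
  next
    fix r c assume r: "r \<in> {0..1::real}" and "c \<in> ecarrier (M\<lparr>ecarrier := C\<rparr>)"
    then obtain s where s: "s \<in> {0..1}" "c = ?e s" by (auto simp: C_def)
    have "r * s \<in> {0..1}" using r s by (auto intro: mult_le_one)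
    then show "k (escale (M\<lparr>ecarrier := C\<rparr>) r c) = r * k c"
      using ke[of "r * s"] ke[of s] r s scale_scale[of r s "eone M"] one_closed by simp
  qed
  \<comment> \<open>This is \<open>(x - y)/2\<close> shifted by 1/2 into the module: a state
    \<open>k\<close> takes the value \<open>1/2 + (k x - k y)/2\<close> at \<open>w\<close>.\<close>
  define w where "w = lc (1/2) x (1/2) (ecompl M y)"
  have wc: "w \<in> ecarrier M" unfolding w_def using x y compl_closed by (intro lc_sum) auto
  obtain L where L: "L \<in> states M"
    and app: "\<And>\<epsilon>. 0 < \<epsilon> \<Longrightarrow> \<exists>c\<in>C. \<exists>s. 0 < s \<and> s \<le> 1 \<and> ele M (escale M s w) c \<and> k c < s * (L w + \<epsilon>)"
    using extend_state[OF C k wc] by metis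
  have Lw: "L w \<le> 1/2"
    using le[OF L] state_lc[OF L, of "1/2" "1/2" x "ecompl M y"] state_compl[OF L y] x y
      compl_closed[OF y] unfolding w_def by linarith
  have "half_le M r x y" if r: "r \<in> {0<..1}" for r
  proof -
    obtain c s where c: "c \<in> C" "0 < s" "s \<le> 1" "ele M (escale M s w) c" "k c < s * (L w + r / 2)"
      using app[of "r/2"] r by auto
    obtain t where t: "t \<in> {0..1}" "c = ?e t" using c unfolding C_def by blast
    let ?u = "1/2 + r/2"
    have u: "?u \<in> {0..1}" "s \<in> {0..1}" "s * ?u \<in> {0..1}" using r c by (auto intro: mult_le_one)
    have "s * (L w + r/2) \<le> s * ?u" using Lw c by (intro mult_left_mono) auto
    then have tu: "t \<le> s * ?u" using c(5)[unfolded t(2) ke[OF t(1)]] by (rule order_trans[OF less_imp_le, rotated])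
    have "ele M (?e t) (?e (s * ?u))"
      using scale_add_left[of t "s * ?u - t" "eone M"] tu t u one_closed ecl[of "s * ?u - t"]
      unfolding ele_def by auto
    then have "ele M (escale M s w) (?e (s * ?u))"
      by (rule ele_trans[OF scale_closed[OF u(2) wc] _ ecl[OF u(3)] c(4)[unfolded t(2)], rotated]) (rule ecl[OF t(1)])
    then have "ele M (escale M s w) (escale M s (?e ?u))"
      using scale_scale[OF u(2,1) one_closed] by simp
    then have wu: "ele M w (?e ?u)"
      by (rule scale_le_cancel[OF c(2,3) wc ecl[OF u(1)]])
    have w: "esum M (escale M (1/2) x) (escale M (1/2) (ecompl M y)) = Some w"
      unfolding w_def using x compl_closed[OF y] by (intro lc_sum) auto
    have cl: "escale M (1/2) x \<in> ecarrier M" "escale M (1/2) y \<in> ecarrier M"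
      "escale M (1/2) (ecompl M y) \<in> ecarrier M" "?e (r/2) \<in> ecarrier M" "?e (1/2) \<in> ecarrier M"
      using r by (auto intro!: scale_closed x y one_closed compl_closed[OF y])
    \<comment> \<open>\<open>(1/2 + r/2) 1\<close> is \<open>y/2 \<oplus> (r/2) 1\<close> plus half
      the complement of \<open>y\<close>. The latter is also a summand of \<open>w\<close>, so it
      can be cancelled from \<open>w \<le> (1/2 + r/2) 1\<close>.\<close>
    have "padd (padd (Some (escale M (1/2) y)) (Some (?e (r/2)))) (Some (escale M (1/2) (ecompl M y)))
      = padd (padd (Some (escale M (1/2) y)) (Some (escale M (1/2) (ecompl M y)))) (Some (?e (r/2)))"
      by (simp add: padd_ac)
    also have "\<dots> = Some (?e ?u)"
      using cl scale_compl[of "1/2" y] y scale_add_left[of "1/2" "r/2" "eone M"] one_closed r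
      by (simp add: padd_Some)
    finally obtain z where z: "padd (Some (escale M (1/2) y)) (Some (?e (r/2))) = Some z"
      "padd (Some z) (Some (escale M (1/2) (ecompl M y))) = Some (?e ?u)"
      using padd_eq_SomeD by metis
    then have "z \<in> ecarrier M" "esum M z (escale M (1/2) (ecompl M y)) = Some (?e ?u)"
      "esum M (escale M (1/2) y) (?e (r/2)) = Some z"
      using padd_SomeD by blast+
    with wu w show ?thesis
      unfolding half_le_def using ele_add_cancel[OF cl(1) _ cl(3)] by blast
  qed
  then show ?thesis using arch x y unfolding archimedean_def by blast
qed

lemma eq_of_states:
  assumes "archimedean M" "x \<in> ecarrier M" "y \<in> ecarrier M"
    and "\<And>k. k \<in> states M \<Longrightarrow> k x = k y"
  shows "x = y"
proof (rule ele_antisym[OF assms(2,3)])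
  show "ele M x y" by (intro ele_of_states[OF assms(1-3)] eq_refl assms(4))
  show "ele M y x" by (intro ele_of_states[OF assms(1,3,2)] eq_refl assms(4)[symmetric])
qed

lemma sum_defined_of_states:
  assumes "archimedean M" "x \<in> ecarrier M" "y \<in> ecarrier M"
    and "\<And>k. k \<in> states M \<Longrightarrow> k x + k y \<le> 1"
  obtains z where "z \<in> ecarrier M" "esum M x y = Some z"
    "\<And>k. k \<in> states M \<Longrightarrow> k z = k x + k y"
proof -
  have "ele M x (ecompl M y)"
    using assms(4) by (intro ele_of_states[OF assms(1,2) compl_closed[OF assms(3)]])
      (simp add: state_compl[OF _ assms(3)] le_diff_eq)
  then obtain z where "esum M x y = Some z" using sum_defined_iff assms by blast
  then show ?thesis using that assms sum_closed stateD(5) by metis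
qed

lemma half_le_iff_states:
  assumes arch: "archimedean M" and c: "x \<in> ecarrier M" "y \<in> ecarrier M" and r: "r \<in> {0..1}"
  shows "half_le M r x y \<longleftrightarrow> (\<forall>k\<in>states M. k x \<le> k y + r)"
proof
  assume *: "\<forall>k\<in>states M. k x \<le> k y + r"
  have r2: "0 \<le> r/2" "1/2 + r/2 \<le> 1" using r by auto
  note l = lc_sum[OF _ r2 c(2) one_closed]
  have "ele M (escale M (1/2) x) (lc (1/2) y (r/2) (eone M))"
    using * c one_closed r l
    by (intro ele_of_states[OF arch]) (auto simp: state_lc stateD intro!: scale_closed)
  then show "half_le M r x y" unfolding half_le_def using l by force
qed (use state_half_le c r in blast)

end

section \<open>The metric of an effect module of functions\<close>

text \<open>Covers two situations at once: an Archimedean module evaluated at its states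
  (\<open>states_rep\<close>) and a submodule of a cube evaluated at points
  (\<open>subcube_rep\<close>). In both, \<open>edist\<close> becomes the supremum distance of the
  evaluations.\<close>

locale emodule_rep = emodule M for M :: "'a emod" +
  fixes I :: "'i set" and ev :: "'i \<Rightarrow> 'a \<Rightarrow> real"
  assumes ev_range: "\<lbrakk>i \<in> I; x \<in> ecarrier M\<rbrakk> \<Longrightarrow> ev i x \<in> {0..1}"
    and half_le_iff: "\<lbrakk>x \<in> ecarrier M; y \<in> ecarrier M; r \<in> {0<..1}\<rbrakk> \<Longrightarrow>
      half_le M r x y \<longleftrightarrow> (\<forall>i\<in>I. ev i x \<le> ev i y + r)"
    and ev_eqI: "\<lbrakk>x \<in> ecarrier M; y \<in> ecarrier M; \<And>i. i \<in> I \<Longrightarrow> ev i x = ev i y\<rbrakk> \<Longrightarrow> x = y"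
begin

lemma ev_le_add_one: "\<lbrakk>i \<in> I; x \<in> ecarrier M; y \<in> ecarrier M\<rbrakk> \<Longrightarrow> ev i x \<le> ev i y + 1"
  using ev_range[of i x] ev_range[of i y] by simp

lemma Inf_half_le_iff:
  assumes c: "x \<in> ecarrier M" "y \<in> ecarrier M" and d: "0 \<le> d"
  shows "Inf {r \<in> {0<..1}. half_le M r x y} \<le> d \<longleftrightarrow> (\<forall>i\<in>I. ev i x \<le> ev i y + d)"
proof -
  define A where "A = {r \<in> {0<..1::real}. \<forall>i\<in>I. ev i x \<le> ev i y + r}"
  have A: "{r \<in> {0<..1}. half_le M r x y} = A"
    using half_le_iff[OF c] unfolding A_def by blast
  have one: "1 \<in> A" using ev_le_add_one c by (simp add: A_def)
  have bdd: "bdd_below A" by (intro bdd_belowI[of _ 0]) (auto simp: A_def)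
  show ?thesis
    unfolding A
  proof
    assume le: "Inf A \<le> d"
    show "\<forall>i\<in>I. ev i x \<le> ev i y + d"
    proof
      fix i assume "i \<in> I"
      then have "ev i x - ev i y \<le> Inf A"
        using one by (intro cInf_greatest) (auto simp: A_def algebra_simps)
      then show "ev i x \<le> ev i y + d" using le by linarith
    qed
  next
    assume *: "\<forall>i\<in>I. ev i x \<le> ev i y + d"
    show "Inf A \<le> d"
    proof (rule field_le_epsilon)
      fix e :: real assume e: "0 < e"
      \<comment> \<open>The cap at 1 keeps the radius in the range over which \<open>edist\<close>
        takes its infimum; at radius 1 the inequality holds by \<open>ev_range\<close>.\<close>
      have "min 1 (d + e) \<in> A"
        using ev_le_add_one c * e d by (fastforce simp: A_def min_def)
      then have "Inf A \<le> min 1 (d + e)" using bdd by (rule cInf_lower)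
      then show "Inf A \<le> d + e" by simp
    qed
  qed
qed

lemma edist_le_iff:
  assumes "x \<in> ecarrier M" "y \<in> ecarrier M" "0 \<le> d"
  shows "edist M x y \<le> d \<longleftrightarrow> (\<forall>i\<in>I. \<bar>ev i x - ev i y\<bar> \<le> d)"
proof -
  have "edist M x y \<le> d \<longleftrightarrow> (\<forall>i\<in>I. ev i x \<le> ev i y + d) \<and> (\<forall>i\<in>I. ev i y \<le> ev i x + d)"
    using assms Inf_half_le_iff[of x y d] Inf_half_le_iff[of y x d] by (simp add: edist_def)
  then show ?thesis by (force simp: abs_le_iff algebra_simps)
qed

lemma edist_nonneg: "0 \<le> edist M x y"
proof (cases "x \<in> ecarrier M \<and> y \<in> ecarrier M")
  case True
  have "half_le M 1 x y" using True ev_le_add_one by (subst half_le_iff) auto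
  then have "0 \<le> Inf {r \<in> {0<..1}. half_le M r x y}"
    by (intro cInf_greatest) (auto intro!: exI[of _ 1])
  then show ?thesis using True by (simp add: edist_def)
qed (auto simp: edist_def)

lemma edist_ev: "\<lbrakk>x \<in> ecarrier M; y \<in> ecarrier M; i \<in> I\<rbrakk> \<Longrightarrow> \<bar>ev i x - ev i y\<bar> \<le> edist M x y"
  using edist_le_iff[OF _ _ edist_nonneg, of x y x y] by simp

lemma Metric_space_edist: "Metric_space (ecarrier M) (edist M)"
proof
  fix x y z
  show "0 \<le> edist M x y" by (rule edist_nonneg)
  show "edist M x y = edist M y x" by (simp add: edist_def max.commute)
  show "edist M x y = 0 \<longleftrightarrow> x = y" if "x \<in> ecarrier M" "y \<in> ecarrier M"
  proof
    assume "edist M x y = 0"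
    then show "x = y" using that edist_ev[OF that] by (intro ev_eqI) force+
  next
    assume "x = y"
    then show "edist M x y = 0" using edist_le_iff[OF that, of 0] edist_nonneg[of x y] by simp
  qed
  show "edist M x z \<le> edist M x y + edist M y z"
    if c: "x \<in> ecarrier M" "y \<in> ecarrier M" "z \<in> ecarrier M"
  proof -
    have "\<bar>ev i x - ev i z\<bar> \<le> edist M x y + edist M y z" if "i \<in> I" for i
      using edist_ev[OF c(1,2) that] edist_ev[OF c(2,3) that] by linarith
    then show ?thesis using edist_nonneg[of x y] edist_nonneg[of y z] by (subst edist_le_iff) (use c in auto)
  qed
qed

text \<open>The metric notions use strict bounds, while \<open>edist_le_iff\<close> speaks of weak
  ones. Passing from \<open>e\<close> to \<open>e/2\<close> bridges the two.\<close>

lemma mcomplete_iff: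
  "Metric_space.mcomplete (ecarrier M) (edist M) \<longleftrightarrow>
    (\<forall>s::nat \<Rightarrow> 'a. range s \<subseteq> ecarrier M \<and> (\<forall>e>0. \<exists>N. \<forall>m\<ge>N. \<forall>n\<ge>N. \<forall>i\<in>I. \<bar>ev i (s m) - ev i (s n)\<bar> \<le> e) \<longrightarrow>
      (\<exists>x\<in>ecarrier M. \<forall>e>0. \<exists>N. \<forall>n\<ge>N. \<forall>i\<in>I. \<bar>ev i (s n) - ev i x\<bar> \<le> e))"
proof -
  interpret Metric_space "ecarrier M" "edist M" by (rule Metric_space_edist)
  have half: "(\<forall>e>0. P e) \<longleftrightarrow> (\<forall>e>0. Q e)"
    if "\<And>e. 0 < e \<Longrightarrow> P e \<Longrightarrow> Q e" "\<And>e. 0 < e \<Longrightarrow> Q (e/2) \<Longrightarrow> P e" for P Q :: "real \<Rightarrow> bool"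
    using that half_gt_zero by blast
  have lt: "d < e" if "d \<le> e/2" "0 < e" for d e :: real using that by simp
  have cauchy: "(\<forall>e>0. \<exists>N. \<forall>m n. N \<le> m \<longrightarrow> N \<le> n \<longrightarrow> edist M (s m) (s n) < e) \<longleftrightarrow>
      (\<forall>e>0. \<exists>N. \<forall>m\<ge>N. \<forall>n\<ge>N. \<forall>i\<in>I. \<bar>ev i (s m) - ev i (s n)\<bar> \<le> e)" if "range s \<subseteq> ecarrier M" for s :: "nat \<Rightarrow> 'a"
  proof (rule half)
    fix e :: real assume e: "0 < e"
    have c: "s n \<in> ecarrier M" for n using that by blast
    show "\<exists>N. \<forall>m n. N \<le> m \<longrightarrow> N \<le> n \<longrightarrow> edist M (s m) (s n) < e \<Longrightarrow>
      \<exists>N. \<forall>m\<ge>N. \<forall>n\<ge>N. \<forall>i\<in>I. \<bar>ev i (s m) - ev i (s n)\<bar> \<le> e"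
      using edist_ev[OF c c] by (meson less_imp_le order_trans)
    show "\<exists>N. \<forall>m\<ge>N. \<forall>n\<ge>N. \<forall>i\<in>I. \<bar>ev i (s m) - ev i (s n)\<bar> \<le> e/2 \<Longrightarrow>
      \<exists>N. \<forall>m n. N \<le> m \<longrightarrow> N \<le> n \<longrightarrow> edist M (s m) (s n) < e"
      using edist_le_iff[OF c c, of "e/2"] e lt[OF _ e] by (meson half_gt_zero less_imp_le)
  qed
  have lim: "(\<forall>e>0. \<exists>N. \<forall>n\<ge>N. s n \<in> ecarrier M \<and> edist M (s n) x < e) \<longleftrightarrow>
      (\<forall>e>0. \<exists>N. \<forall>n\<ge>N. \<forall>i\<in>I. \<bar>ev i (s n) - ev i x\<bar> \<le> e)"
    if "range s \<subseteq> ecarrier M" "x \<in> ecarrier M" for x and s :: "nat \<Rightarrow> 'a"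
  proof (rule half)
    fix e :: real assume e: "0 < e"
    have c: "s n \<in> ecarrier M" for n using that by blast
    have "edist M (s n) x < e \<Longrightarrow> \<forall>i\<in>I. \<bar>ev i (s n) - ev i x\<bar> \<le> e" for n
      using edist_ev[OF c that(2)] by (meson less_imp_le order_trans)
    then show "\<exists>N. \<forall>n\<ge>N. s n \<in> ecarrier M \<and> edist M (s n) x < e \<Longrightarrow>
      \<exists>N. \<forall>n\<ge>N. \<forall>i\<in>I. \<bar>ev i (s n) - ev i x\<bar> \<le> e" by blast
    have "\<forall>i\<in>I. \<bar>ev i (s n) - ev i x\<bar> \<le> e/2 \<Longrightarrow> edist M (s n) x < e" for n
      using edist_le_iff[OF c that(2), of "e/2" n] e lt[of "edist M (s n) x" e] by simp
    then show "\<exists>N. \<forall>n\<ge>N. \<forall>i\<in>I. \<bar>ev i (s n) - ev i x\<bar> \<le> e/2 \<Longrightarrow>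
      \<exists>N. \<forall>n\<ge>N. s n \<in> ecarrier M \<and> edist M (s n) x < e"
      using c by blast
  qed
  have "mcomplete \<longleftrightarrow> (\<forall>s::nat \<Rightarrow> 'a. range s \<subseteq> ecarrier M \<and>
      (\<forall>e>0. \<exists>N. \<forall>m n. N \<le> m \<longrightarrow> N \<le> n \<longrightarrow> edist M (s m) (s n) < e) \<longrightarrow>
      (\<exists>x\<in>ecarrier M. \<forall>e>0. \<exists>N. \<forall>n\<ge>N. s n \<in> ecarrier M \<and> edist M (s n) x < e))"
    unfolding mcomplete_def MCauchy_def limitin_metric eventually_sequentially Bex_def by (rule refl)
  moreover have "(range s \<subseteq> ecarrier M \<and>
      (\<forall>e>0. \<exists>N. \<forall>m n. N \<le> m \<longrightarrow> N \<le> n \<longrightarrow> edist M (s m) (s n) < e) \<longrightarrow>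
      (\<exists>x\<in>ecarrier M. \<forall>e>0. \<exists>N. \<forall>n\<ge>N. s n \<in> ecarrier M \<and> edist M (s n) x < e)) \<longleftrightarrow>
    (range s \<subseteq> ecarrier M \<and> (\<forall>e>0. \<exists>N. \<forall>m\<ge>N. \<forall>n\<ge>N. \<forall>i\<in>I. \<bar>ev i (s m) - ev i (s n)\<bar> \<le> e) \<longrightarrow>
      (\<exists>x\<in>ecarrier M. \<forall>e>0. \<exists>N. \<forall>n\<ge>N. \<forall>i\<in>I. \<bar>ev i (s n) - ev i x\<bar> \<le> e))" for s :: "nat \<Rightarrow> 'a"
  proof (cases "range s \<subseteq> ecarrier M")
    case True
    show ?thesis by (simp only: cauchy[OF True] lim[OF True] cong: bex_cong)
  qed simp
  ultimately show ?thesis by presburger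
qed

end

section \<open>Effect modules of functions\<close>

abbreviation cube :: "'a set \<Rightarrow> ('a \<Rightarrow> real) set" where
  "cube X \<equiv> X \<rightarrow>\<^sub>E {0..1}"

lemma pow_emod_simps [simp]:
  "ecarrier (pow_emod X) = X \<rightarrow>\<^sub>E {0..1}"
  "ezero (pow_emod X) = (\<lambda>x\<in>X. 0)"
  "ecompl (pow_emod X) p = (\<lambda>x\<in>X. 1 - p x)"
  "escale (pow_emod X) r p = (\<lambda>x\<in>X. r * p x)"
  "eone (pow_emod X) = (\<lambda>x\<in>X. 1)"
  by (auto simp: pow_emod_def eone_def)

lemma pow_emod_sum: "esum (pow_emod X) p q =
    (if \<forall>x\<in>X. p x + q x \<le> 1 then Some (\<lambda>x\<in>X. p x + q x) else None)"
  by (simp add: pow_emod_def)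

lemma unit_cubeD: "\<lbrakk>p \<in> cube X; x \<in> X\<rbrakk> \<Longrightarrow> 0 \<le> p x \<and> p x \<le> (1::real)"
  by (auto simp: PiE_iff)

lemma unit_cube_eqI:
  "\<lbrakk>p \<in> X \<rightarrow>\<^sub>E A; q \<in> X \<rightarrow>\<^sub>E B; \<And>x. x \<in> X \<Longrightarrow> p x = q x\<rbrakk> \<Longrightarrow> p = q"
  by (rule PiE_ext[of p X "\<lambda>_. A \<union> B" q]) (auto simp: PiE_iff)

lemma pow_emod_sum_Some:
  "esum (pow_emod X) p q = Some s \<longleftrightarrow> (\<forall>x\<in>X. p x + q x \<le> 1) \<and> s = (\<lambda>x\<in>X. p x + q x)"
  by (auto simp: pow_emod_sum)

lemma pow_emod_EMod: "pow_emod X \<in> EMod"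
  unfolding EMod_def mem_Collect_eq
proof unfold_locales
  fix p q s assume pqs: "p \<in> ecarrier (pow_emod X)" "q \<in> ecarrier (pow_emod X)" "s \<in> ecarrier (pow_emod X)"
  have nn: "0 \<le> p x" "0 \<le> q x" "0 \<le> s x" if "x \<in> X" for x
    using unit_cubeD[of p X x] unit_cubeD[of q X x] unit_cubeD[of s X x] pqs that by simp_all
  have le: "p x + q x \<le> 1" if "x \<in> X" "p x + q x + s x \<le> 1" for x using nn that by force
  have le': "q x + s x \<le> 1" if "x \<in> X" "p x + (q x + s x) \<le> 1" for x using nn that by force
  show "Option.bind (esum (pow_emod X) p q) (\<lambda>u. esum (pow_emod X) u s) =
    Option.bind (esum (pow_emod X) q s) (\<lambda>v. esum (pow_emod X) p v)"
  proof (cases "\<forall>x\<in>X. p x + q x + s x \<le> 1")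
    case True
    then show ?thesis using le le' by (auto simp: pow_emod_sum add.assoc)
  next
    case False
    then show ?thesis by (auto simp: pow_emod_sum add.assoc)
  qed
next
  fix p q assume p: "p \<in> ecarrier (pow_emod X)" and q: "q \<in> ecarrier (pow_emod X)"
    and e: "esum (pow_emod X) p q = Some (eone (pow_emod X))"
  have "p x + q x = 1" if "x \<in> X" for x
    using e that by (auto simp: pow_emod_sum_Some dest!: fun_cong[of _ _ x])
  then show "q = ecompl (pow_emod X) p"
    using q by (intro ext) (auto simp: PiE_iff extensional_def algebra_simps)
next
  fix p assume p: "p \<in> ecarrier (pow_emod X)" and e: "esum (pow_emod X) p (eone (pow_emod X)) \<noteq> None"
  have "p x = 0" if "x \<in> X" for x
  proof -
    have "p x + 1 \<le> 1" using e that by (auto simp: pow_emod_sum split: if_splits)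
    then show ?thesis using unit_cubeD[of p X x] p that by simp
  qed
  then show "p = ezero (pow_emod X)"
    using p by (intro ext) (auto simp: PiE_iff extensional_def)
next
  fix r s :: real and p assume r: "r \<in> {0..1}" and s: "s \<in> {0..1}" and rs: "r + s \<le> 1"
    and p: "p \<in> ecarrier (pow_emod X)"
  have "r * p x + s * p x \<le> 1" if "x \<in> X" for x
    using mult_le_one[of "r + s" "p x"] unit_cubeD[of p X x] p r s rs that by (simp add: algebra_simps)
  then show "esum (pow_emod X) (escale (pow_emod X) r p) (escale (pow_emod X) s p) =
    Some (escale (pow_emod X) (r + s) p)"
    by (auto simp: pow_emod_sum algebra_simps)
next
  fix r :: real and p q s assume r: "r \<in> {0..1}" and p: "p \<in> ecarrier (pow_emod X)"
    and q: "q \<in> ecarrier (pow_emod X)" and e: "esum (pow_emod X) p q = Some s"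
  have "r * p x + r * q x \<le> 1" if "x \<in> X" for x
    using mult_le_one[of r "p x + q x"] unit_cubeD[of p X x] unit_cubeD[of q X x] p q r e that
    by (simp add: algebra_simps pow_emod_sum_Some)
  then show "esum (pow_emod X) (escale (pow_emod X) r p) (escale (pow_emod X) r q) =
    Some (escale (pow_emod X) r s)"
    using e by (auto simp: pow_emod_sum_Some algebra_simps)
qed (auto simp: pow_emod_sum PiE_iff extensional_def algebra_simps mult_le_one split: if_splits)

interpretation pow: emodule "pow_emod X" for X
  by (simp add: emodule_iff pow_emod_EMod)

context
  fixes X :: "'a set" and C
  assumes C: "subeffect (pow_emod X) C"
begin

lemma subcubeD: "p \<in> C \<Longrightarrow> p \<in> cube X"
  using C by (auto simp: subeffect_def)

text \<open>The difference of two comparable functions in \<open>C\<close> lies in \<open>C\<close>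
  by \<open>subeffect_diff\<close>, so passing to a submodule does not change the pointwise
  order.\<close>

lemma subcube_ele:
  assumes p: "p \<in> C" and q: "q \<in> C"
  shows "ele ((pow_emod X)\<lparr>ecarrier := C\<rparr>) p q \<longleftrightarrow> (\<forall>x\<in>X. p x \<le> q x)"
proof
  assume "ele ((pow_emod X)\<lparr>ecarrier := C\<rparr>) p q"
  then obtain u where u: "u \<in> C" "esum (pow_emod X) p u = Some q" by (auto simp: ele_def)
  then show "\<forall>x\<in>X. p x \<le> q x"
    using subcubeD by (fastforce simp: pow_emod_sum_Some dest: unit_cubeD)
next
  assume le: "\<forall>x\<in>X. p x \<le> q x"
  define u where "u = (\<lambda>x\<in>X. q x - p x)"
  have uc: "u \<in> cube X"
    using le subcubeD[OF p] subcubeD[OF q] by (fastforce simp: u_def dest: unit_cubeD)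
  have e: "esum (pow_emod X) p u = Some q"
    using subcubeD[OF q] unfolding pow_emod_sum_Some
    by (auto simp: u_def PiE_iff extensional_def)
  have "u \<in> C" using pow.subeffect_diff[OF C q p _ e] uc by simp
  then show "ele ((pow_emod X)\<lparr>ecarrier := C\<rparr>) p q" using e by (auto simp: ele_def)
qed

lemma subcube_half_le:
  assumes p: "p \<in> C" and q: "q \<in> C" and r: "r \<in> {0..1}"
  shows "half_le ((pow_emod X)\<lparr>ecarrier := C\<rparr>) r p q \<longleftrightarrow> (\<forall>x\<in>X. p x \<le> q x + r)"
proof -
  let ?z = "\<lambda>x\<in>X. 1/2 * q x + r/2"
  have le: "1/2 * q x + r/2 \<le> 1" if "x \<in> X" for x
    using unit_cubeD[OF subcubeD[OF q] that] r by simp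
  have e: "esum (pow_emod X) (escale (pow_emod X) (1/2) q) (escale (pow_emod X) (r/2) (eone (pow_emod X))) = Some ?z"
    using le by (auto simp: pow_emod_sum_Some)
  have cl: "\<And>s p. \<lbrakk>s \<in> {0..1}; p \<in> C\<rbrakk> \<Longrightarrow> escale (pow_emod X) s p \<in> C" "eone (pow_emod X) \<in> C"
    "\<And>p q z. \<lbrakk>p \<in> C; q \<in> C; esum (pow_emod X) p q = Some z\<rbrakk> \<Longrightarrow> z \<in> C"
    using C unfolding subeffect_def eone_def by blast+
  have z: "?z \<in> C" using r by (intro cl(3)[OF _ _ e] cl(1,2) q) auto
  have p2: "escale (pow_emod X) (1/2) p \<in> C" by (intro cl(1) p) simp
  have "half_le ((pow_emod X)\<lparr>ecarrier := C\<rparr>) r p q \<longleftrightarrow>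
      ele ((pow_emod X)\<lparr>ecarrier := C\<rparr>) (escale (pow_emod X) (1/2) p) ?z"
    using e by (simp add: half_le_def eone_def)
  also have "\<dots> \<longleftrightarrow> (\<forall>x\<in>X. p x \<le> q x + r)"
    by (subst subcube_ele[OF p2 z]) auto
  finally show ?thesis .
qed

lemma subcube_emodule: "emodule ((pow_emod X)\<lparr>ecarrier := C\<rparr>)"
  using pow.subeffect_EMod[OF C] by (simp add: emodule_iff)

lemma subcube_rep: "emodule_rep ((pow_emod X)\<lparr>ecarrier := C\<rparr>) X (\<lambda>x p. p x)"
proof (rule emodule_rep.intro[OF subcube_emodule], unfold_locales)
  fix x p assume "x \<in> X" "p \<in> ecarrier ((pow_emod X)\<lparr>ecarrier := C\<rparr>)"
  then show "p x \<in> {0..1}" using unit_cubeD[OF subcubeD, of p x] by simp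
next
  fix p q assume "p \<in> ecarrier ((pow_emod X)\<lparr>ecarrier := C\<rparr>)" "q \<in> ecarrier ((pow_emod X)\<lparr>ecarrier := C\<rparr>)"
    "\<And>x. x \<in> X \<Longrightarrow> p x = q x"
  then show "p = q" using unit_cube_eqI[OF subcubeD subcubeD, of p q] by simp
qed (simp add: subcube_half_le)

lemma subcube_archimedean: "archimedean ((pow_emod X)\<lparr>ecarrier := C\<rparr>)"
  unfolding archimedean_def
proof (intro ballI impI)
  fix p q assume pq: "p \<in> ecarrier ((pow_emod X)\<lparr>ecarrier := C\<rparr>)" "q \<in> ecarrier ((pow_emod X)\<lparr>ecarrier := C\<rparr>)"
    and h: "\<forall>r\<in>{0<..1}. half_le ((pow_emod X)\<lparr>ecarrier := C\<rparr>) r p q"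
  have "p x \<le> q x" if "x \<in> X" for x
  proof (rule field_le_epsilon)
    fix e :: real assume "0 < e"
    then have "p x \<le> q x + min 1 e"
      using h[rule_format, of "min 1 e"] pq that by (simp add: subcube_half_le)
    then show "p x \<le> q x + e" by simp
  qed
  then show "ele ((pow_emod X)\<lparr>ecarrier := C\<rparr>) p q" using subcube_ele pq by simp
qed

text \<open>A uniformly Cauchy sequence converges uniformly to its pointwise limit, so completeness
  reduces to closure of \<open>C\<close> under uniform limits.\<close>

lemma subcube_BEMod:
  assumes closed: "\<And>s p. \<lbrakk>range s \<subseteq> C; p \<in> cube X;
      \<And>e. 0 < e \<Longrightarrow> \<exists>N::nat. \<forall>n\<ge>N. \<forall>x\<in>X. \<bar>s n x - p x\<bar> \<le> e\<rbrakk> \<Longrightarrow> p \<in> C"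
  shows "(pow_emod X)\<lparr>ecarrier := C\<rparr> \<in> BEMod"
proof -
  interpret emodule_rep "(pow_emod X)\<lparr>ecarrier := C\<rparr>" X "\<lambda>x p. p x" by (rule subcube_rep)
  have "\<exists>p\<in>C. \<forall>e>0. \<exists>N. \<forall>n\<ge>N. \<forall>x\<in>X. \<bar>s n x - p x\<bar> \<le> e"
    if s: "range s \<subseteq> C" and cau: "\<forall>e>0. \<exists>N. \<forall>m\<ge>N. \<forall>n\<ge>N. \<forall>x\<in>X. \<bar>s m x - s n x\<bar> \<le> e"
    for s :: "nat \<Rightarrow> 'a \<Rightarrow> real"
  proof -
    have "Cauchy (\<lambda>n. s n x)" if "x \<in> X" for x
    proof (rule metric_CauchyI)
      fix e :: real assume "0 < e"
      then obtain N where "\<forall>m\<ge>N. \<forall>n\<ge>N. \<forall>x\<in>X. \<bar>s m x - s n x\<bar> \<le> e/2"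
        using cau half_gt_zero by blast
      then show "\<exists>N. \<forall>m\<ge>N. \<forall>n\<ge>N. dist (s m x) (s n x) < e"
        using that \<open>0 < e\<close> by (intro exI[of _ N]) (fastforce simp: dist_real_def)
    qed
    then have "\<forall>x\<in>X. \<exists>l. (\<lambda>n. s n x) \<longlonglongrightarrow> l"
      using Cauchy_convergent convergent_def by blast
    then obtain l where l: "\<And>x. x \<in> X \<Longrightarrow> (\<lambda>n. s n x) \<longlonglongrightarrow> l x" by metis
    define p where "p = restrict l X"
    have s01: "0 \<le> s n x \<and> s n x \<le> 1" if "x \<in> X" for n x
      using unit_cubeD[OF subcubeD that] s by blast
    have "0 \<le> l x" "l x \<le> 1" if "x \<in> X" for x
      using LIMSEQ_le_const[OF l[OF that], of 0] LIMSEQ_le_const2[OF l[OF that], of 1] s01[OF that] by simp_all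
    then have p: "p \<in> cube X" by (auto simp: p_def)
    have unif: "\<exists>N. \<forall>n\<ge>N. \<forall>x\<in>X. \<bar>s n x - p x\<bar> \<le> e" if e: "0 < e" for e
    proof -
      obtain N where N: "\<forall>m\<ge>N. \<forall>n\<ge>N. \<forall>x\<in>X. \<bar>s m x - s n x\<bar> \<le> e"
        using cau e by blast
      have "\<bar>s n x - p x\<bar> \<le> e" if "N \<le> n" "x \<in> X" for n x
      proof -
        have "(\<lambda>m. \<bar>s n x - s m x\<bar>) \<longlonglongrightarrow> \<bar>s n x - l x\<bar>"
          by (intro tendsto_intros l that)
        then have "\<bar>s n x - l x\<bar> \<le> e"
          by (rule LIMSEQ_le_const2) (use N that in blast)
        then show ?thesis using that by (simp add: p_def)
      qed
      then show ?thesis by blast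
    qed
    show ?thesis using closed[OF s p unif] unif by blast
  qed
  then have "Metric_space.mcomplete (ecarrier ((pow_emod X)\<lparr>ecarrier := C\<rparr>)) (edist ((pow_emod X)\<lparr>ecarrier := C\<rparr>))"
    unfolding mcomplete_iff by simp
  then show ?thesis
    using subcube_archimedean pow.subeffect_EMod[OF C] by (simp add: BEMod_def)
qed

end

section \<open>The expectation monad\<close>

lemma Exp_iff: "h \<in> Exp X \<longleftrightarrow> h \<in> (cube X) \<rightarrow>\<^sub>E {0..1} \<and> h (\<lambda>x\<in>X. 1) = 1 \<and>
    (\<forall>p\<in>cube X. \<forall>q\<in>cube X. (\<forall>x\<in>X. p x + q x \<le> 1) \<longrightarrow> h (\<lambda>x\<in>X. p x + q x) = h p + h q) \<and>
    (\<forall>r\<in>{0..1}. \<forall>p\<in>cube X. h (\<lambda>x\<in>X. r * p x) = r * h p)"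
  unfolding Exp_def pow.state_iff pow_emod_simps pow_emod_sum_Some by blast

lemma ExpI:
  assumes "h \<in> extensional (cube X)"
    and "\<And>p. p \<in> cube X \<Longrightarrow> 0 \<le> h p \<and> h p \<le> 1"
    and "h (\<lambda>x\<in>X. 1) = 1"
    and "\<And>p q. \<lbrakk>p \<in> cube X; q \<in> cube X; \<And>x. x \<in> X \<Longrightarrow> p x + q x \<le> 1\<rbrakk> \<Longrightarrow>
      h (\<lambda>x\<in>X. p x + q x) = h p + h q"
    and "\<And>r p. \<lbrakk>0 \<le> r; r \<le> 1; p \<in> cube X\<rbrakk> \<Longrightarrow> h (\<lambda>x\<in>X. r * p x) = r * h p"
  shows "h \<in> Exp X"
  unfolding Exp_iff using assms by (auto simp: PiE_iff)

lemma Exp_range: "\<lbrakk>h \<in> Exp X; p \<in> cube X\<rbrakk> \<Longrightarrow> 0 \<le> h p \<and> h p \<le> 1"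
  using pow.stateD(1,2)[of h X p] by (simp add: Exp_def)

lemma Exp_ext: "h \<in> Exp X \<Longrightarrow> h \<in> extensional (cube X)"
  using pow.stateD(4)[of h X] by (simp add: Exp_def)

lemma Exp_one: "h \<in> Exp X \<Longrightarrow> h (\<lambda>x\<in>X. 1) = 1"
  by (simp add: Exp_iff)

lemma Exp_add:
  "\<lbrakk>h \<in> Exp X; p \<in> cube X; q \<in> cube X; \<And>x. x \<in> X \<Longrightarrow> p x + q x \<le> 1\<rbrakk> \<Longrightarrow>
    h (\<lambda>x\<in>X. p x + q x) = h p + h q"
  unfolding Exp_iff by blast

lemma Exp_scale: "\<lbrakk>h \<in> Exp X; p \<in> cube X; 0 \<le> r; r \<le> 1\<rbrakk> \<Longrightarrow> h (\<lambda>x\<in>X. r * p x) = r * h p"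
  unfolding Exp_iff by simp

lemma Exp_eqI: "\<lbrakk>h \<in> Exp X; k \<in> Exp X; \<And>p. p \<in> cube X \<Longrightarrow> h p = k p\<rbrakk> \<Longrightarrow> h = k"
  by (rule extensionalityI[OF Exp_ext Exp_ext])

lemma Exp_compl: "\<lbrakk>h \<in> Exp X; p \<in> cube X\<rbrakk> \<Longrightarrow> h (\<lambda>x\<in>X. 1 - p x) = 1 - h p"
  using pow.state_compl[of h X p] by (simp add: Exp_def)

text \<open>Makes the results on submodules of a cube applicable to the cube itself.\<close>

lemma subeffect_carrier: "subeffect (pow_emod X) (cube X)"
  unfolding subeffect_def
  unfolding pow_emod_simps(1)[symmetric]
  by (intro conjI subset_refl ballI allI impI pow.zero_closed pow.compl_closed pow.scale_closed)
    (assumption | erule (2) pow.sum_closed)+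

lemma Exp_le:
  assumes h: "h \<in> Exp X" and p: "p \<in> cube X" and q: "q \<in> cube X"
    and r: "0 \<le> r" and le: "\<And>x. x \<in> X \<Longrightarrow> p x \<le> q x + r"
  shows "h p \<le> h q + r"
proof (cases "r \<le> 1")
  case True
  have "subeffect (pow_emod X) (cube X)"
    by (rule subeffect_carrier)
  from subcube_half_le[OF this p q, of r] have "half_le (pow_emod X) r p q"
    using le r True by (simp add: pow_emod_def)
  then show ?thesis
    using pow.state_half_le[of h X p q r] h p q r True by (simp add: Exp_def)
qed (use Exp_range[OF h p] Exp_range[OF h q] in linarith)

lemma Exp_close:
  assumes "h \<in> Exp X" "p \<in> cube X" "q \<in> cube X" "0 \<le> r"
    and le: "\<And>x. x \<in> X \<Longrightarrow> \<bar>p x - q x\<bar> \<le> r"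
  shows "\<bar>h p - h q\<bar> \<le> r"
proof -
  have "p x \<le> q x + r" "q x \<le> p x + r" if "x \<in> X" for x using le[OF that] by linarith+
  then show ?thesis using Exp_le[OF assms(1-4)] Exp_le[OF assms(1,3,2,4)] by force
qed

lemma cube_scale: "\<lbrakk>p \<in> cube X; 0 \<le> r; r \<le> 1\<rbrakk> \<Longrightarrow> (\<lambda>x\<in>X. r * p x) \<in> cube X"
  using pow.scale_closed[of r p X] by simp

lemma cube_compl: "p \<in> cube X \<Longrightarrow> (\<lambda>x\<in>X. 1 - p x) \<in> cube X"
  using pow.compl_closed[of p X] by simp

lemma cube_add:
  "\<lbrakk>p \<in> cube X; q \<in> cube X; \<And>x. x \<in> X \<Longrightarrow> p x + q x \<le> 1\<rbrakk> \<Longrightarrow>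
    (\<lambda>x\<in>X. p x + q x) \<in> cube X"
  using pow.sum_closed[of p X q] by (simp add: pow_emod_sum)

lemma cube_one: "(\<lambda>x\<in>X. 1) \<in> cube X"
  by simp

lemma compose_cube: "\<lbrakk>f \<in> X \<rightarrow> Y; p \<in> cube Y\<rbrakk> \<Longrightarrow> compose X p f \<in> cube X"
  by (auto simp: compose_def PiE_iff Pi_iff)

lemma Exp_map_in:
  assumes h: "h \<in> Exp X" and f: "f \<in> X \<rightarrow> Y"
  shows "Exp_map X Y f h \<in> Exp Y"
proof (rule ExpI)
  have one: "compose X (\<lambda>y\<in>Y. 1) f = (\<lambda>x\<in>X. 1::real)"
    using f by (auto simp: compose_def Pi_iff intro!: restrict_ext)
  show "Exp_map X Y f h (\<lambda>x\<in>Y. 1) = 1"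
    using Exp_one[OF h] by (simp add: Exp_map_def one)
  fix p :: "'b \<Rightarrow> real" assume p: "p \<in> cube Y"
  show "0 \<le> Exp_map X Y f h p \<and> Exp_map X Y f h p \<le> 1"
    using Exp_range[OF h compose_cube[OF f p]] p by (simp add: Exp_map_def)
  {
    fix q :: "'b \<Rightarrow> real" assume q: "q \<in> cube Y" and le: "\<And>x. x \<in> Y \<Longrightarrow> p x + q x \<le> 1"
    have pq: "(\<lambda>x\<in>Y. p x + q x) \<in> cube Y"
      by (rule cube_add[OF p q le])
    have "h (\<lambda>x\<in>X. compose X p f x + compose X q f x) = h (compose X p f) + h (compose X q f)"
      using f le by (intro Exp_add[OF h] compose_cube[OF f] p q) (auto simp: compose_def)
    also have "(\<lambda>x\<in>X. compose X p f x + compose X q f x) = compose X (\<lambda>x\<in>Y. p x + q x) f"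
      using f by (auto simp: compose_def Pi_iff intro!: restrict_ext)
    finally show "Exp_map X Y f h (\<lambda>x\<in>Y. p x + q x) = Exp_map X Y f h p + Exp_map X Y f h q"
      using p q pq by (simp add: Exp_map_def)
  }
  {
    fix r :: real assume r: "0 \<le> r" "r \<le> 1"
    have rp: "(\<lambda>x\<in>Y. r * p x) \<in> cube Y"
      by (rule cube_scale[OF p r])
    have "h (\<lambda>x\<in>X. r * compose X p f x) = r * h (compose X p f)"
      using Exp_scale[OF h compose_cube[OF f p] r] .
    also have "(\<lambda>x\<in>X. r * compose X p f x) = compose X (\<lambda>x\<in>Y. r * p x) f"
      using f by (auto simp: compose_def Pi_iff intro!: restrict_ext)
    finally show "Exp_map X Y f h (\<lambda>x\<in>Y. r * p x) = r * Exp_map X Y f h p"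
      using p rp by (simp add: Exp_map_def)
  }
qed (simp add: Exp_map_def)

lemma Exp_unit_in: "x \<in> X \<Longrightarrow> Exp_unit X x \<in> Exp X"
  unfolding Exp_unit_def
proof (rule ExpI, goal_cases)
  case (4 p q)
  then have "(\<lambda>x\<in>X. p x + q x) \<in> cube X"
    by (intro cube_add)
  then show ?case using 4 by simp
next
  case (5 r p)
  then have "(\<lambda>x\<in>X. r * p x) \<in> cube X"
    by (intro cube_scale)
  then show ?case using 5 by simp
qed (auto dest: unit_cubeD)

section \<open>The adjunction\<close>

lemma Exp_mult_apply: "p \<in> cube X \<Longrightarrow> Exp_mult X H p = H (\<lambda>k\<in>Exp X. k p)"
  by (simp add: Exp_mult_def)

lemma Exp_mult_in:
  assumes H: "H \<in> Exp (Exp X)"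
  shows "Exp_mult X H \<in> Exp X"
proof (rule ExpI)
  have ev: "(\<lambda>k\<in>Exp X. k p) \<in> cube (Exp X)" if "p \<in> cube X" for p
    using Exp_range[OF _ that] by simp
  have "(\<lambda>k\<in>Exp X. k (\<lambda>x\<in>X. 1)) = (\<lambda>k\<in>Exp X. 1)"
    by (auto simp: Exp_one intro!: restrict_ext)
  then show "Exp_mult X H (\<lambda>x\<in>X. 1) = 1"
    using Exp_one[OF H] by (simp add: Exp_mult_def)
  fix p :: "'a \<Rightarrow> real" assume p: "p \<in> cube X"
  show "0 \<le> Exp_mult X H p \<and> Exp_mult X H p \<le> 1"
    using Exp_range[OF H ev[OF p]] p by (simp add: Exp_mult_def)
  {
    fix q :: "'a \<Rightarrow> real" assume q: "q \<in> cube X" and le: "\<And>x. x \<in> X \<Longrightarrow> p x + q x \<le> 1"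
    have pq: "(\<lambda>x\<in>X. p x + q x) \<in> cube X" by (rule cube_add[OF p q le])
    have add: "k (\<lambda>x\<in>X. p x + q x) = k p + k q" if "k \<in> Exp X" for k
      by (rule Exp_add[OF that p q le])
    have "H (\<lambda>k\<in>Exp X. (\<lambda>k\<in>Exp X. k p) k + (\<lambda>k\<in>Exp X. k q) k) = H (\<lambda>k\<in>Exp X. k p) + H (\<lambda>k\<in>Exp X. k q)"
      using Exp_range[OF _ pq] add by (intro Exp_add[OF H] ev p q) simp
    also have "(\<lambda>k\<in>Exp X. (\<lambda>k\<in>Exp X. k p) k + (\<lambda>k\<in>Exp X. k q) k) = (\<lambda>k\<in>Exp X. k (\<lambda>x\<in>X. p x + q x))"
      using add by (auto intro!: restrict_ext)
    finally show "Exp_mult X H (\<lambda>x\<in>X. p x + q x) = Exp_mult X H p + Exp_mult X H q"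
      by (simp only: Exp_mult_apply p q pq)
  }
  {
    fix r :: real assume r: "0 \<le> r" "r \<le> 1"
    have rp: "(\<lambda>x\<in>X. r * p x) \<in> cube X" by (rule cube_scale[OF p r])
    have "H (\<lambda>k\<in>Exp X. r * (\<lambda>k\<in>Exp X. k p) k) = r * H (\<lambda>k\<in>Exp X. k p)"
      by (rule Exp_scale[OF H ev[OF p] r])
    also have "(\<lambda>k\<in>Exp X. r * (\<lambda>k\<in>Exp X. k p) k) = (\<lambda>k\<in>Exp X. k (\<lambda>x\<in>X. r * p x))"
      using Exp_scale[OF _ p r] by (auto intro!: restrict_ext)
    finally show "Exp_mult X H (\<lambda>x\<in>X. r * p x) = r * Exp_mult X H p"
      by (simp only: Exp_mult_apply p rp)
  }
qed (simp add: Exp_mult_def)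

section \<open>Algebra maps into the unit interval\<close>

lemma AlgD:
  assumes "A \<in> Alg"
  shows "h \<in> Exp (acarrier A) \<Longrightarrow> astruct A h \<in> acarrier A"
    "astruct A \<in> extensional (Exp (acarrier A))"
    "x \<in> acarrier A \<Longrightarrow> astruct A (Exp_unit (acarrier A) x) = x"
    "H \<in> Exp (Exp (acarrier A)) \<Longrightarrow> astruct A (Exp_mult (acarrier A) H) =
      astruct A (Exp_map (Exp (acarrier A)) (acarrier A) (astruct A) H)"
  using assms unfolding Alg_def by (simp_all add: PiE_iff)

lemma Alg_homD:
  assumes "f \<in> Alg_hom A B"
  shows "f \<in> acarrier A \<rightarrow> acarrier B" "f \<in> extensional (acarrier A)"
    "x \<in> acarrier A \<Longrightarrow> f x \<in> acarrier B"
    "h \<in> Exp (acarrier A) \<Longrightarrow> f (astruct A h) = astruct B (Exp_map (acarrier A) (acarrier B) f h)"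
  using assms unfolding Alg_hom_def by (auto simp: PiE_iff)

lemma compose_id_cube: "f \<in> X \<rightarrow>\<^sub>E Y \<Longrightarrow> compose X (\<lambda>x\<in>Y. x) f = f"
  by (intro extensionalityI[of _ X]) (auto simp: compose_def PiE_iff)

lemma Alg_hom_unit_iff: "f \<in> Alg_hom A unit_alg \<longleftrightarrow>
    f \<in> cube (acarrier A) \<and> (\<forall>h\<in>Exp (acarrier A). f (astruct A h) = h f)"
proof -
  have "astruct unit_alg (Exp_map (acarrier A) {0..1} f h) = h f"
    if "f \<in> cube (acarrier A)" "h \<in> Exp (acarrier A)" for h
  proof -
    have "Exp_map (acarrier A) {0..1} f h \<in> Exp {0..1}"
      using that by (intro Exp_map_in) (auto simp: PiE_iff)
    then show ?thesis
      using compose_id_cube[OF that(1)] by (simp add: unit_alg_def Exp_map_def)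
  qed
  moreover have "acarrier unit_alg = {0..1}" by (simp add: unit_alg_def)
  ultimately show ?thesis unfolding Alg_hom_def by auto
qed

lemma Alg_hom_unitD:
  assumes "f \<in> Alg_hom A unit_alg"
  shows "f \<in> cube (acarrier A)" "h \<in> Exp (acarrier A) \<Longrightarrow> f (astruct A h) = h f"
  using assms by (simp_all add: Alg_hom_unit_iff)

lemma Alg_hom_comp_unit:
  assumes A: "A \<in> Alg" and f: "f \<in> Alg_hom A B" and g: "g \<in> Alg_hom B unit_alg"
  shows "compose (acarrier A) g f \<in> Alg_hom A unit_alg"
  unfolding Alg_hom_unit_iff
proof (intro conjI ballI)
  show "compose (acarrier A) g f \<in> cube (acarrier A)"
    by (rule compose_cube[OF Alg_homD(1)[OF f] Alg_hom_unitD(1)[OF g]])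
  fix h assume h: "h \<in> Exp (acarrier A)"
  have "g (f (astruct A h)) = h (compose (acarrier A) g f)"
    using Alg_homD(4)[OF f h] Alg_hom_unitD(2)[OF g Exp_map_in[OF h Alg_homD(1)[OF f]]] Alg_hom_unitD(1)[OF g]
    by (simp add: Exp_map_def)
  then show "compose (acarrier A) g f (astruct A h) = h (compose (acarrier A) g f)"
    using AlgD(1)[OF A h] by (simp add: compose_def)
qed

text \<open>For fixed \<open>h\<close>, both sides of \<open>f (\<alpha> h) = h f\<close> respect
  the pointwise operations in \<open>f\<close>, because \<open>h\<close> is a state.\<close>

lemma subeffect_Alg_hom:
  assumes A: "A \<in> Alg"
  shows "subeffect (pow_emod (acarrier A)) (Alg_hom A unit_alg)"
  unfolding subeffect_def
proof (intro conjI ballI allI impI)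
  let ?X = "acarrier A"
  note st = AlgD(1)[OF A]
  show "Alg_hom A unit_alg \<subseteq> ecarrier (pow_emod ?X)"
    using Alg_hom_unitD(1) by auto
  show "ezero (pow_emod ?X) \<in> Alg_hom A unit_alg"
    unfolding Alg_hom_unit_iff using st pow.state_zero[of _ ?X, folded Exp_def] by simp
  {
    fix f assume f: "f \<in> Alg_hom A unit_alg"
    note fc = Alg_hom_unitD(1)[OF f]
    show "ecompl (pow_emod ?X) f \<in> Alg_hom A unit_alg"
      unfolding Alg_hom_unit_iff pow_emod_simps using st Alg_hom_unitD(2)[OF f]
      by (intro conjI cube_compl fc ballI) (simp add: Exp_compl[OF _ fc])
    fix g s assume g: "g \<in> Alg_hom A unit_alg" and e: "esum (pow_emod ?X) f g = Some s"
    note gc = Alg_hom_unitD(1)[OF g]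
    have le: "f x + g x \<le> 1" if "x \<in> ?X" for x using e that by (simp add: pow_emod_sum_Some)
    have s: "s = (\<lambda>x\<in>?X. f x + g x)" using e by (simp add: pow_emod_sum_Some)
    show "s \<in> Alg_hom A unit_alg"
      unfolding Alg_hom_unit_iff s using st Alg_hom_unitD(2)[OF f] Alg_hom_unitD(2)[OF g]
      by (intro conjI cube_add fc gc le ballI) (simp_all add: Exp_add[OF _ fc gc le])
  }
  fix r :: real and f assume r: "r \<in> {0..1}" and f: "f \<in> Alg_hom A unit_alg"
  then show "escale (pow_emod ?X) r f \<in> Alg_hom A unit_alg"
    unfolding Alg_hom_unit_iff pow_emod_simps using st
    by (intro conjI cube_scale ballI) (simp_all add: Exp_scale)
qed

text \<open>States are nonexpansive for the supremum distance (\<open>Exp_close\<close>), so the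
  equation \<open>f (\<alpha> h) = h f\<close> passes to uniform limits.\<close>

lemma emod_of_alg_BEMod:
  assumes A: "A \<in> Alg"
  shows "emod_of_alg A \<in> BEMod"
  unfolding emod_of_alg_def
proof (rule subcube_BEMod[OF subeffect_Alg_hom[OF A]])
  fix s p assume s: "range s \<subseteq> Alg_hom A unit_alg" and p: "p \<in> cube (acarrier A)"
    and lim: "\<And>e. 0 < e \<Longrightarrow> \<exists>N::nat. \<forall>n\<ge>N. \<forall>x\<in>acarrier A. \<bar>s n x - p x\<bar> \<le> e"
  have "p (astruct A h) = h p" if h: "h \<in> Exp (acarrier A)" for h
  proof -
    have "\<bar>p (astruct A h) - h p\<bar> \<le> e" if e: "0 < e" for e
    proof -
      obtain n where n: "\<And>x. x \<in> acarrier A \<Longrightarrow> \<bar>s n x - p x\<bar> \<le> e/2"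
        using lim[of "e/2"] e by auto
      have sn: "s n \<in> Alg_hom A unit_alg" using s by blast
      have "\<bar>h (s n) - h p\<bar> \<le> e/2"
        using n e by (intro Exp_close[OF h Alg_hom_unitD(1)[OF sn] p]) auto
      then show ?thesis
        using n[OF AlgD(1)[OF A h]] Alg_hom_unitD(2)[OF sn h] by linarith
    qed
    then have "\<bar>p (astruct A h) - h p\<bar> \<le> 0" by (rule field_le_epsilon[where y = 0, simplified])
    then show ?thesis by simp
  qed
  then show "p \<in> Alg_hom A unit_alg" using p by (simp add: Alg_hom_unit_iff)
qed

lemma emod_of_alg_simps [simp]:
  "ecarrier (emod_of_alg A) = Alg_hom A unit_alg"
  "esum (emod_of_alg A) = esum (pow_emod (acarrier A))"
  "eone (emod_of_alg A) = (\<lambda>x\<in>acarrier A. 1)"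
  "escale (emod_of_alg A) r p = (\<lambda>x\<in>acarrier A. r * p x)"
  by (auto simp: emod_of_alg_def pow_emod_def eone_def intro!: restrict_ext)

lemma emod_of_alg_map_hom:
  assumes A: "A \<in> Alg" and B: "B \<in> Alg" and f: "f \<in> Alg_hom A B"
  shows "emod_of_alg_map A B f \<in> EMod_hom (emod_of_alg B) (emod_of_alg A)"
proof -
  interpret eB: emodule "emod_of_alg B" using emod_of_alg_BEMod[OF B] by (simp add: emodule_iff BEMod_def)
  note fx = Alg_homD(3)[OF f]
  show ?thesis
    unfolding EMod_hom_def mem_Collect_eq
  proof (intro conjI ballI allI impI)
    show "emod_of_alg_map A B f \<in> ecarrier (emod_of_alg B) \<rightarrow>\<^sub>E ecarrier (emod_of_alg A)"
      using Alg_hom_comp_unit[OF A f] by (auto simp: emod_of_alg_map_def)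
    show "emod_of_alg_map A B f (eone (emod_of_alg B)) = eone (emod_of_alg A)"
      using eB.one_closed fx by (auto simp: emod_of_alg_map_def compose_def intro!: restrict_ext)
    fix p q s assume p: "p \<in> ecarrier (emod_of_alg B)" and q: "q \<in> ecarrier (emod_of_alg B)"
      and e: "esum (emod_of_alg B) p q = Some s"
    have "s \<in> ecarrier (emod_of_alg B)" using eB.sum_closed p q e by blast
    then show "esum (emod_of_alg A) (emod_of_alg_map A B f p) (emod_of_alg_map A B f q) =
      Some (emod_of_alg_map A B f s)"
      using p q e fx
      by (auto simp: emod_of_alg_map_def compose_def pow_emod_sum_Some intro!: restrict_ext)
  next
    fix r :: real and p assume r: "r \<in> {0..1}" and p: "p \<in> ecarrier (emod_of_alg B)"
    have "escale (emod_of_alg B) r p \<in> ecarrier (emod_of_alg B)" using eB.scale_closed r p by blast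
    then show "emod_of_alg_map A B f (escale (emod_of_alg B) r p) =
      escale (emod_of_alg A) r (emod_of_alg_map A B f p)"
      using p fx by (auto simp: emod_of_alg_map_def compose_def intro!: restrict_ext)
  qed
qed

lemma emod_of_alg_map_id:
  "emod_of_alg_map A A (\<lambda>x\<in>acarrier A. x) = (\<lambda>g\<in>ecarrier (emod_of_alg A). g)"
proof -
  have "compose (acarrier A) g (\<lambda>x\<in>acarrier A. x) = g" if "g \<in> Alg_hom A unit_alg" for g
    using Alg_homD(2)[OF that] by (intro extensionalityI[of _ "acarrier A"]) (auto simp: compose_def)
  then show ?thesis by (auto simp: emod_of_alg_map_def intro!: restrict_ext)
qed

lemma emod_of_alg_map_comp:
  assumes B: "B \<in> Alg" and f: "f \<in> Alg_hom A B" and g: "g \<in> Alg_hom B C"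
  shows "emod_of_alg_map A C (compose (acarrier A) g f) =
    compose (ecarrier (emod_of_alg C)) (emod_of_alg_map A B f) (emod_of_alg_map B C g)"
  using Alg_hom_comp_unit[OF B g] Alg_homD(3)[OF f]
  by (auto simp: emod_of_alg_map_def compose_def[of "Alg_hom C unit_alg"] intro!: restrict_ext)
     (auto simp: compose_def intro!: restrict_ext)

section \<open>The algebra of states of an effect module\<close>

definition hat :: "'a emod \<Rightarrow> 'a \<Rightarrow> ('a \<Rightarrow> real) \<Rightarrow> real" where
  "hat M y = (\<lambda>k\<in>states M. k y)"

lemma alg_of_emod_simps [simp]:
  "acarrier (alg_of_emod M) = states M"
  "h \<in> Exp (states M) \<Longrightarrow> astruct (alg_of_emod M) h = (\<lambda>y\<in>ecarrier M. h (hat M y))"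
  by (simp_all add: alg_of_emod_def hat_def)

lemma adj_counit_eq: "adj_counit M = (\<lambda>y\<in>ecarrier M. hat M y)"
  by (simp add: adj_counit_def hat_def)

context emodule
begin

lemma hat_cube: "y \<in> ecarrier M \<Longrightarrow> hat M y \<in> cube (states M)"
  using stateD(1,2) by (auto simp: hat_def)

lemma hat_add:
  "\<lbrakk>x \<in> ecarrier M; y \<in> ecarrier M; esum M x y = Some z\<rbrakk> \<Longrightarrow>
    hat M z = (\<lambda>k\<in>states M. hat M x k + hat M y k)"
  by (auto simp: hat_def stateD(5) intro!: restrict_ext)

lemma hat_scale:
  "\<lbrakk>y \<in> ecarrier M; 0 \<le> r; r \<le> 1\<rbrakk> \<Longrightarrow>
    hat M (escale M r y) = (\<lambda>k\<in>states M. r * hat M y k)"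
  by (auto simp: hat_def stateD(6) intro!: restrict_ext)

lemma hat_one: "hat M (eone M) = (\<lambda>k\<in>states M. 1)"
  by (auto simp: hat_def stateD(3) intro!: restrict_ext)

lemma hat_sum_le:
  assumes "x \<in> ecarrier M" "y \<in> ecarrier M" "esum M x y = Some z" "k \<in> states M"
  shows "hat M x k + hat M y k \<le> 1"
  using stateD(5)[OF assms(4,1-3)] stateD(2)[OF assms(4), of z] sum_closed[OF assms(1-3)] assms(4)
  by (simp add: hat_def)

lemma alg_of_emod_struct:
  assumes h: "h \<in> Exp (states M)"
  shows "(\<lambda>y\<in>ecarrier M. h (hat M y)) \<in> states M"
  unfolding state_iff
proof (intro conjI ballI allI impI)
  show "(\<lambda>y\<in>ecarrier M. h (hat M y)) \<in> ecarrier M \<rightarrow>\<^sub>E {0..1}"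
    using Exp_range[OF h hat_cube] by auto
  show "(\<lambda>y\<in>ecarrier M. h (hat M y)) (eone M) = 1"
    using Exp_one[OF h] one_closed by (simp add: hat_one)
  fix x y z assume x: "x \<in> ecarrier M" and y: "y \<in> ecarrier M" and z: "esum M x y = Some z"
  then show "(\<lambda>y\<in>ecarrier M. h (hat M y)) z = (\<lambda>y\<in>ecarrier M. h (hat M y)) x + (\<lambda>y\<in>ecarrier M. h (hat M y)) y"
    using Exp_add[OF h hat_cube[OF x] hat_cube[OF y] hat_sum_le[OF x y z]] sum_closed[OF x y z]
    by (simp add: hat_add)
next
  fix r x assume "r \<in> {0..1::real}" "x \<in> ecarrier M"
  then show "(\<lambda>y\<in>ecarrier M. h (hat M y)) (escale M r x) = r * (\<lambda>y\<in>ecarrier M. h (hat M y)) x"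
    using Exp_scale[OF h hat_cube, of x r] scale_closed[of r x] by (simp add: hat_scale)
qed

text \<open>Both laws are checked at each \<open>y\<close>. The multiplication law comes down to the
  fact that \<open>hat M y\<close> after the structure map is evaluation at
  \<open>hat M y\<close>.\<close>

lemma alg_of_emod_Alg: "alg_of_emod M \<in> Alg"
  unfolding Alg_def mem_Collect_eq alg_of_emod_simps(1)
proof (intro conjI ballI)
  let ?S = "states M"
  have st: "astruct (alg_of_emod M) \<in> Exp ?S \<rightarrow> ?S"
    using alg_of_emod_struct by simp
  have "astruct (alg_of_emod M) \<in> extensional (Exp ?S)" by (simp add: alg_of_emod_def)
  with st show "astruct (alg_of_emod M) \<in> Exp ?S \<rightarrow>\<^sub>E ?S"
    unfolding PiE_def by (rule IntI)
  {
    fix k assume k: "k \<in> ?S"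
    have "Exp_unit ?S k (hat M y) = k y" if "y \<in> ecarrier M" for y
      using hat_cube[OF that] k by (simp add: Exp_unit_def) (simp add: hat_def)
    then show "astruct (alg_of_emod M) (Exp_unit ?S k) = k"
      using stateD(4)[OF k] Exp_unit_in[OF k]
      by (auto intro!: extensionalityI[of _ "ecarrier M"])
  }
  fix H assume H: "H \<in> Exp (Exp ?S)"
  have E: "Exp_map (Exp ?S) ?S (astruct (alg_of_emod M)) H \<in> Exp ?S"
    by (rule Exp_map_in[OF H st])
  have mult: "Exp_mult ?S H \<in> Exp ?S"
    by (rule Exp_mult_in[OF H])
  have "compose (Exp ?S) (hat M y) (astruct (alg_of_emod M)) = (\<lambda>k\<in>Exp ?S. k (hat M y))"
    if "y \<in> ecarrier M" for y
    using that alg_of_emod_struct by (auto simp: compose_def hat_def[of M y] intro!: restrict_ext)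
  then show "astruct (alg_of_emod M) (Exp_mult ?S H) =
      astruct (alg_of_emod M) (Exp_map (Exp ?S) ?S (astruct (alg_of_emod M)) H)"
    using E mult hat_cube
    by (auto simp: Exp_mult_def[of ?S H] Exp_map_def[of "Exp ?S"] intro!: restrict_ext)
qed

end

lemma alg_of_emod_map_hom:
  assumes M: "M \<in> EMod" and N: "N \<in> EMod" and f: "f \<in> EMod_hom M N"
  shows "alg_of_emod_map M N f \<in> Alg_hom (alg_of_emod N) (alg_of_emod M)"
proof -
  interpret M: emodule M using M by (simp add: emodule_iff)
  interpret N: emodule N using N by (simp add: emodule_iff)
  let ?S = "states M" and ?T = "states N"
  have fx: "f y \<in> ecarrier N" if "y \<in> ecarrier M" for y
    using f that by (auto simp: EMod_hom_def)
  have map: "alg_of_emod_map M N f k \<in> ?S" if k: "k \<in> ?T" for k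
    unfolding M.state_iff
  proof (intro conjI ballI allI impI)
    show "alg_of_emod_map M N f k \<in> ecarrier M \<rightarrow>\<^sub>E {0..1}"
      using fx N.stateD(1,2)[OF k] k by (auto simp: alg_of_emod_map_def compose_def)
    have "f (eone M) = eone N" using f by (simp add: EMod_hom_def)
    then show "alg_of_emod_map M N f k (eone M) = 1"
      using N.stateD(3)[OF k] M.one_closed k by (simp add: alg_of_emod_map_def compose_def)
    fix x y z assume x: "x \<in> ecarrier M" and y: "y \<in> ecarrier M" and z: "esum M x y = Some z"
    then have "esum N (f x) (f y) = Some (f z)" using f by (simp add: EMod_hom_def)
    then show "alg_of_emod_map M N f k z = alg_of_emod_map M N f k x + alg_of_emod_map M N f k y"
      using N.stateD(5)[OF k fx[OF x] fx[OF y]] x y M.sum_closed[OF x y z] k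
      by (simp add: alg_of_emod_map_def compose_def)
  next
    fix r x assume r: "r \<in> {0..1::real}" and x: "x \<in> ecarrier M"
    have "f (escale M r x) = escale N r (f x)" using f r x by (simp add: EMod_hom_def)
    then show "alg_of_emod_map M N f k (escale M r x) = r * alg_of_emod_map M N f k x"
      using N.stateD(6)[OF k _ _ fx[OF x], of r] r x M.scale_closed[OF r x] k
      by (simp add: alg_of_emod_map_def compose_def)
  qed
  show ?thesis
    unfolding Alg_hom_def mem_Collect_eq alg_of_emod_simps(1)
  proof (intro conjI ballI)
    show "alg_of_emod_map M N f \<in> ?T \<rightarrow>\<^sub>E ?S"
      using map by (auto simp: PiE_iff alg_of_emod_map_def)
    fix h assume h: "h \<in> Exp ?T"
    have E: "Exp_map ?T ?S (alg_of_emod_map M N f) h \<in> Exp ?S"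
      using map by (intro Exp_map_in[OF h]) auto
    have "compose ?T (hat M y) (alg_of_emod_map M N f) = hat N (f y)" if "y \<in> ecarrier M" for y
      using map that by (auto simp: compose_def hat_def intro!: restrict_ext)
        (simp add: alg_of_emod_map_def compose_def)
    then show "alg_of_emod_map M N f (astruct (alg_of_emod N) h) =
        astruct (alg_of_emod M) (Exp_map ?T ?S (alg_of_emod_map M N f) h)"
      using h E M.hat_cube N.alg_of_emod_struct[OF h] fx
      by (auto simp: Exp_map_def[of ?T] alg_of_emod_map_def[of M N f] compose_def[of "ecarrier M"] intro!: restrict_ext)
  qed
qed

lemma alg_of_emod_map_id:
  "alg_of_emod_map M M (\<lambda>y\<in>ecarrier M. y) = (\<lambda>k\<in>acarrier (alg_of_emod M). k)"
proof -
  have "compose (ecarrier M) k (\<lambda>y\<in>ecarrier M. y) = k" if "k \<in> states M" for k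
    using that by (intro extensionalityI[of _ "ecarrier M"]) (auto simp: compose_def EMod_hom_def PiE_iff)
  then show ?thesis by (auto simp: alg_of_emod_map_def intro!: restrict_ext)
qed

lemma EMod_hom_comp_state:
  assumes "M \<in> EMod" "N \<in> EMod" "f \<in> EMod_hom M N" "k \<in> states N"
  shows "compose (ecarrier M) k f \<in> states M"
  using Alg_homD(3)[OF alg_of_emod_map_hom[OF assms(1-3)], of k] assms(4)
  by (simp add: alg_of_emod_map_def)

lemma alg_of_emod_map_comp:
  assumes N: "N \<in> EMod" and P: "P \<in> EMod" and f: "f \<in> EMod_hom M N" and g: "g \<in> EMod_hom N P"
  shows "alg_of_emod_map M P (compose (ecarrier M) g f) =
    compose (acarrier (alg_of_emod P)) (alg_of_emod_map M N f) (alg_of_emod_map N P g)"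
proof -
  have "f y \<in> ecarrier N" if "y \<in> ecarrier M" for y
    using f that by (auto simp: EMod_hom_def)
  then show ?thesis
    using EMod_hom_comp_state[OF N P g]
    by (auto simp: alg_of_emod_map_def compose_def[of "states P"] intro!: restrict_ext)
       (auto simp: compose_def intro!: restrict_ext)
qed

section \<open>Unit, counit and triangle identities\<close>

lemma eval_state:
  assumes A: "A \<in> Alg" and x: "x \<in> acarrier A"
  shows "(\<lambda>g\<in>Alg_hom A unit_alg. g x) \<in> states (emod_of_alg A)"
proof -
  interpret eA: emodule "emod_of_alg A" using emod_of_alg_BEMod[OF A] by (simp add: emodule_iff BEMod_def)
  show ?thesis
    unfolding eA.state_iff
  proof (intro conjI ballI allI impI)
    show "(\<lambda>g\<in>Alg_hom A unit_alg. g x) \<in> ecarrier (emod_of_alg A) \<rightarrow>\<^sub>E {0..1}"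
      using unit_cubeD[OF Alg_hom_unitD(1) x] by auto
    show "(\<lambda>g\<in>Alg_hom A unit_alg. g x) (eone (emod_of_alg A)) = 1"
      using eA.one_closed x by simp
    fix p q s assume "p \<in> ecarrier (emod_of_alg A)" "q \<in> ecarrier (emod_of_alg A)"
      "esum (emod_of_alg A) p q = Some s"
    then show "(\<lambda>g\<in>Alg_hom A unit_alg. g x) s = (\<lambda>g\<in>Alg_hom A unit_alg. g x) p + (\<lambda>g\<in>Alg_hom A unit_alg. g x) q"
      using eA.sum_closed[of p q s] x by (simp add: pow_emod_sum_Some)
  next
    fix r p assume "r \<in> {0..1::real}" "p \<in> ecarrier (emod_of_alg A)"
    then show "(\<lambda>g\<in>Alg_hom A unit_alg. g x) (escale (emod_of_alg A) r p) = r * (\<lambda>g\<in>Alg_hom A unit_alg. g x) p"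
      using eA.scale_closed[of r p] x by simp
  qed
qed

text \<open>\<open>hat (emod_of_alg A) g\<close> after the unit is \<open>g\<close>, so at each
  \<open>g\<close> the claim is the equation \<open>g (\<alpha> h) = h g\<close>.\<close>

lemma adj_unit_hom:
  assumes A: "A \<in> Alg"
  shows "adj_unit A \<in> Alg_hom A (alg_of_emod (emod_of_alg A))"
  unfolding Alg_hom_def mem_Collect_eq alg_of_emod_simps(1)
proof (intro conjI ballI)
  let ?X = "acarrier A" and ?S = "states (emod_of_alg A)"
  interpret eA: emodule "emod_of_alg A" using emod_of_alg_BEMod[OF A] by (simp add: emodule_iff BEMod_def)
  have u: "adj_unit A \<in> ?X \<rightarrow> ?S"
    using eval_state[OF A] by (simp add: adj_unit_def)
  have "adj_unit A \<in> extensional ?X" by (simp add: adj_unit_def)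
  with u show "adj_unit A \<in> ?X \<rightarrow>\<^sub>E ?S" unfolding PiE_def by (rule IntI)
  fix h assume h: "h \<in> Exp ?X"
  have "compose ?X (hat (emod_of_alg A) g) (adj_unit A) = g" if g: "g \<in> Alg_hom A unit_alg" for g
    using Alg_homD(2)[OF g] eval_state[OF A] g
    by (intro extensionalityI[of _ ?X]) (auto simp: compose_def adj_unit_def hat_def)
  then show "adj_unit A (astruct A h) = astruct (alg_of_emod (emod_of_alg A)) (Exp_map ?X ?S (adj_unit A) h)"
    using Exp_map_in[OF h u] AlgD(1)[OF A h] Alg_hom_unitD(2)[OF _ h] eA.hat_cube
    by (auto simp: adj_unit_def[of A] Exp_map_def[of ?X] intro!: restrict_ext)
qed

lemma adj_unit_natural:
  assumes A: "A \<in> Alg" and B: "B \<in> Alg" and f: "f \<in> Alg_hom A B"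
  shows "compose (acarrier A) (adj_unit B) f = compose (acarrier A)
    (alg_of_emod_map (emod_of_alg B) (emod_of_alg A) (emod_of_alg_map A B f)) (adj_unit A)"
  using Alg_homD(3)[OF f] Alg_hom_comp_unit[OF A f] eval_state[OF A]
  by (auto simp: adj_unit_def alg_of_emod_map_def emod_of_alg_map_def compose_def intro!: restrict_ext)

lemma (in emodule) hat_hom:
  assumes y: "y \<in> ecarrier M"
  shows "hat M y \<in> Alg_hom (alg_of_emod M) unit_alg"
  unfolding Alg_hom_unit_iff alg_of_emod_simps(1)
proof (intro conjI ballI hat_cube y)
  fix h assume h: "h \<in> Exp (states M)"
  have "hat M y k = k y" if "k \<in> states M" for k using that by (simp add: hat_def)
  from this[OF alg_of_emod_struct[OF h]] show "hat M y (astruct (alg_of_emod M) h) = h (hat M y)"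
    using h y by simp
qed

lemma adj_counit_hom:
  assumes M: "M \<in> EMod"
  shows "adj_counit M \<in> EMod_hom M (emod_of_alg (alg_of_emod M))"
proof -
  interpret emodule M using M by (simp add: emodule_iff)
  show ?thesis
    unfolding EMod_hom_def mem_Collect_eq adj_counit_eq
  proof (intro conjI ballI allI impI)
    show "(\<lambda>y\<in>ecarrier M. hat M y) \<in> ecarrier M \<rightarrow>\<^sub>E ecarrier (emod_of_alg (alg_of_emod M))"
      using hat_hom by simp
    show "(\<lambda>y\<in>ecarrier M. hat M y) (eone M) = eone (emod_of_alg (alg_of_emod M))"
      using one_closed by (simp add: hat_one)
    fix x y z assume c: "x \<in> ecarrier M" "y \<in> ecarrier M" "esum M x y = Some z"
    then show "esum (emod_of_alg (alg_of_emod M)) ((\<lambda>y\<in>ecarrier M. hat M y) x) ((\<lambda>y\<in>ecarrier M. hat M y) y)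
      = Some ((\<lambda>y\<in>ecarrier M. hat M y) z)"
      using sum_closed[OF c] hat_sum_le[OF c] hat_add[OF c] by (simp add: pow_emod_sum_Some)
  next
    fix r :: real and x assume "r \<in> {0..1}" "x \<in> ecarrier M"
    then show "(\<lambda>y\<in>ecarrier M. hat M y) (escale M r x) =
      escale (emod_of_alg (alg_of_emod M)) r ((\<lambda>y\<in>ecarrier M. hat M y) x)"
      using scale_closed[of r x] hat_scale[of x r] by simp
  qed
qed

lemma adj_counit_natural:
  assumes M: "M \<in> EMod" and N: "N \<in> EMod" and f: "f \<in> EMod_hom M N"
  shows "compose (ecarrier M) (adj_counit N) f = compose (ecarrier M)
    (emod_of_alg_map (alg_of_emod N) (alg_of_emod M) (alg_of_emod_map M N f)) (adj_counit M)"
proof -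
  interpret M: emodule M using M by (simp add: emodule_iff)
  have "f y \<in> ecarrier N" if "y \<in> ecarrier M" for y
    using f that by (auto simp: EMod_hom_def)
  moreover note M.hat_hom EMod_hom_comp_state[OF M N f]
  ultimately show ?thesis
    by (auto simp: adj_counit_eq emod_of_alg_map_def compose_def[of "ecarrier M" "adj_counit N"]
          compose_def[of "ecarrier M" "restrict _ _"] intro!: restrict_ext)
       (auto simp: hat_def alg_of_emod_map_def compose_def intro!: restrict_ext)
qed

lemma triangle_left:
  assumes A: "A \<in> Alg"
  shows "compose (ecarrier (emod_of_alg A))
      (emod_of_alg_map A (alg_of_emod (emod_of_alg A)) (adj_unit A)) (adj_counit (emod_of_alg A)) =
    (\<lambda>g\<in>ecarrier (emod_of_alg A). g)"
proof -
  interpret eA: emodule "emod_of_alg A" using emod_of_alg_BEMod[OF A] by (simp add: emodule_iff BEMod_def)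
  have "compose (acarrier A) (hat (emod_of_alg A) g) (adj_unit A) = g" if g: "g \<in> Alg_hom A unit_alg" for g
    using Alg_homD(2)[OF g] eval_state[OF A] g
    by (intro extensionalityI[of _ "acarrier A"]) (auto simp: compose_def adj_unit_def hat_def)
  then show ?thesis
    using eA.hat_hom by (auto simp: adj_counit_eq emod_of_alg_map_def compose_def[of "Alg_hom A unit_alg"] intro!: restrict_ext)
qed

lemma triangle_right:
  assumes M: "M \<in> EMod"
  shows "compose (acarrier (alg_of_emod M))
      (alg_of_emod_map M (emod_of_alg (alg_of_emod M)) (adj_counit M)) (adj_unit (alg_of_emod M)) =
    (\<lambda>k\<in>acarrier (alg_of_emod M). k)"
proof -
  interpret emodule M using M by (simp add: emodule_iff)
  have "compose (ecarrier M) (adj_unit (alg_of_emod M) k) (adj_counit M) = k" if k: "k \<in> states M" for k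
    using stateD(4)[OF k] hat_hom k
    by (intro extensionalityI[of _ "ecarrier M"]) (auto simp: compose_def adj_unit_def adj_counit_eq, simp add: hat_def)
  then show ?thesis
    using eval_state[OF alg_of_emod_Alg]
    by (auto simp: alg_of_emod_map_def compose_def[of "states M"] adj_unit_def intro!: restrict_ext)
qed

section \<open>The equivalence\<close>

text \<open>As for any monad: the functor sends mutually inverse maps to mutually inverse maps, so
  the equation for \<open>f\<close> can be solved for its inverse.\<close>

lemma bij_Alg_iso:
  assumes A: "A \<in> Alg" and B: "B \<in> Alg" and f: "f \<in> Alg_hom A B"
    and bij: "bij_betw f (acarrier A) (acarrier B)"
  shows "Alg_iso A B f"
proof -
  let ?X = "acarrier A" and ?Y = "acarrier B"
  define g where "g = (\<lambda>y\<in>?Y. inv_into ?X f y)"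
  have gX: "g y \<in> ?X" if "y \<in> ?Y" for y
    using bij that by (auto simp: g_def bij_betw_def inv_into_into)
  have fg: "f (g y) = y" if "y \<in> ?Y" for y
    using bij that by (auto simp: g_def bij_betw_def f_inv_into_f)
  have gf: "g (f x) = x" if "x \<in> ?X" for x
    using bij that Alg_homD(3)[OF f that] by (auto simp: g_def bij_betw_def inv_into_f_f)
  have gY: "g \<in> ?Y \<rightarrow> ?X" using gX by blast
  have "g \<in> Alg_hom B A"
    unfolding Alg_hom_def mem_Collect_eq
  proof (intro conjI ballI)
    show "g \<in> ?Y \<rightarrow>\<^sub>E ?X" using gX by (auto simp: PiE_iff) (simp add: g_def)
    fix k assume k: "k \<in> Exp ?Y"
    have E: "Exp_map ?Y ?X g k \<in> Exp ?X" by (rule Exp_map_in[OF k gY])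
    have "Exp_map ?X ?Y f (Exp_map ?Y ?X g k) = k"
    proof (rule Exp_eqI[OF Exp_map_in[OF E Alg_homD(1)[OF f]] k])
      fix p :: "'b \<Rightarrow> real" assume p: "p \<in> cube ?Y"
      have "compose ?Y (compose ?X p f) g = p"
        using p gX fg by (intro extensionalityI[of _ ?Y]) (auto simp: compose_def PiE_iff)
      then show "Exp_map ?X ?Y f (Exp_map ?Y ?X g k) p = k p"
        using p compose_cube[OF Alg_homD(1)[OF f] p] by (simp add: Exp_map_def)
    qed
    then have "astruct B k = f (astruct A (Exp_map ?Y ?X g k))"
      using Alg_homD(4)[OF f E] by simp
    then show "g (astruct B k) = astruct A (Exp_map ?Y ?X g k)"
      using gf AlgD(1)[OF A E] by simp
  qed
  moreover have "compose ?X g f = (\<lambda>x\<in>?X. x)" "compose ?Y f g = (\<lambda>y\<in>?Y. y)"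
    using fg gf by (auto simp: compose_def intro!: restrict_ext)
  ultimately show ?thesis unfolding Alg_iso_def using f by blast
qed

lemma adj_unit_surj:
  assumes A: "A \<in> Alg" and k: "k \<in> states (emod_of_alg A)"
  shows "\<exists>x\<in>acarrier A. adj_unit A x = k"
proof -
  note sub = subeffect_Alg_hom[OF A]
  obtain L where L: "L \<in> states (pow_emod (acarrier A))"
    and Lk: "\<And>c. c \<in> Alg_hom A unit_alg \<Longrightarrow> L c = k c"
    using pow.extend_state[OF sub k[unfolded emod_of_alg_def] pow.one_closed] by metis
  have LE: "L \<in> Exp (acarrier A)" using L by (simp add: Exp_def)
  have "adj_unit A (astruct A L) = k"
  proof (rule extensionalityI[of _ "Alg_hom A unit_alg"])
    show "k \<in> extensional (Alg_hom A unit_alg)"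
      using k by (auto simp: EMod_hom_def PiE_iff)
  qed (use AlgD(1)[OF A LE] Alg_hom_unitD(2)[OF _ LE] Lk in \<open>simp_all add: adj_unit_def\<close>)
  then show ?thesis using AlgD(1)[OF A LE] by blast
qed

lemma adj_unit_iso:
  assumes A: "A \<in> Alg"
    and sep: "\<And>x y. \<lbrakk>x \<in> acarrier A; y \<in> acarrier A; \<And>g. g \<in> Alg_hom A unit_alg \<Longrightarrow> g x = g y\<rbrakk> \<Longrightarrow> x = y"
  shows "Alg_iso A (alg_of_emod (emod_of_alg A)) (adj_unit A)"
proof (rule bij_Alg_iso[OF A _ adj_unit_hom[OF A]])
  interpret eA: emodule "emod_of_alg A" using emod_of_alg_BEMod[OF A] by (simp add: emodule_iff BEMod_def)
  show "alg_of_emod (emod_of_alg A) \<in> Alg" by (rule eA.alg_of_emod_Alg)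
  show "bij_betw (adj_unit A) (acarrier A) (acarrier (alg_of_emod (emod_of_alg A)))"
  proof (rule bij_betw_imageI)
    show "inj_on (adj_unit A) (acarrier A)"
    proof (rule inj_onI)
      fix x y assume xy: "x \<in> acarrier A" "y \<in> acarrier A" "adj_unit A x = adj_unit A y"
      have "g x = g y" if "g \<in> Alg_hom A unit_alg" for g
        using fun_cong[OF xy(3), of g] xy(1,2) that by (simp add: adj_unit_def)
      then show "x = y" using sep xy(1,2) by blast
    qed
    show "adj_unit A ` acarrier A = acarrier (alg_of_emod (emod_of_alg A))"
      using adj_unit_surj[OF A] Alg_homD(3)[OF adj_unit_hom[OF A]] by force
  qed
qed

section \<open>Algebra maps on a state space\<close>

lemma pow_ele:
  assumes "p \<in> cube X" "q \<in> cube X"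
  shows "ele (pow_emod X) p q \<longleftrightarrow> (\<forall>x\<in>X. p x \<le> q x)"
  using subcube_ele[OF subeffect_carrier assms] by (simp add: pow_emod_def)

context emodule
begin

text \<open>The elements of the cube over two copies of the state space that have the form
  \<open>(b + v, c - v)\<close> with \<open>v\<close> a nonnegative multiple of the evaluation at a point of \<open>M\<close>.
  A state that extends the average from here to the whole cube consists, up to a factor 2, of two
  states that agree on \<open>M\<close>; this replaces the Jordan decomposition of a functional vanishing on \<open>M\<close>.\<close>

definition antidiag :: "(('a \<Rightarrow> real) \<times> bool \<Rightarrow> real) set" where
  "antidiag = {F \<in> cube (states M \<times> UNIV). \<exists>a b c y. 0 \<le> a \<and> y \<in> ecarrier M \<and>
     (\<forall>k\<in>states M. F (k, True) = a * k y + b \<and> F (k, False) = c - a * k y)}"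

lemma antidiagI:
  assumes "F \<in> cube (states M \<times> UNIV)" "0 \<le> a" "y \<in> ecarrier M"
    "\<And>k. k \<in> states M \<Longrightarrow> F (k, True) = a * k y + b \<and> F (k, False) = c - a * k y"
  shows "F \<in> antidiag"
  unfolding antidiag_def using assms by blast

lemma antidiagD:
  assumes "F \<in> antidiag"
  shows "F \<in> cube (states M \<times> UNIV)"
    "\<exists>a y b c. 0 \<le> a \<and> y \<in> ecarrier M \<and>
     (\<forall>k\<in>states M. F (k, True) = a * k y + b \<and> F (k, False) = c - a * k y)"
  using assms unfolding antidiag_def by blast+

lemma subeffect_antidiag: "subeffect (pow_emod (states M \<times> UNIV)) antidiag"
  unfolding subeffect_def
proof (intro conjI ballI allI impI)
  let ?S = "states M"
  show "antidiag \<subseteq> ecarrier (pow_emod (?S \<times> UNIV))"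
    by (auto simp: antidiag_def)
  show "ezero (pow_emod (?S \<times> UNIV)) \<in> antidiag"
    by (rule antidiagI[of _ 0 "eone M" 0 0]) (auto simp: one_closed)
  {
    fix F assume FA: "F \<in> antidiag"
    obtain a y b c where F0: "0 \<le> a" "y \<in> ecarrier M"
      "\<forall>k\<in>?S. F (k, True) = a * k y + b \<and> F (k, False) = c - a * k y" using antidiagD(2)[OF FA] by blast
    note F = antidiagD(1)[OF FA] F0(1,2) F0(3)[rule_format]
    show "ecompl (pow_emod (?S \<times> UNIV)) F \<in> antidiag"
    \<comment> \<open>The coefficient of the evaluation must stay nonnegative, so the sign is
      absorbed by the complement of \<open>y\<close>:
      \<open>1 - (a k y + b) = a (1 - k y) + (1 - b - a)\<close>.\<close>
    proof (rule antidiagI[of _ a "ecompl M y" "1 - b - a" "1 - c + a"])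
      show "ecompl (pow_emod (?S \<times> UNIV)) F \<in> cube (?S \<times> UNIV)"
        using cube_compl[OF F(1)] by simp
    qed (use F compl_closed[OF F(3)] in \<open>auto simp: state_compl algebra_simps\<close>)
    fix G s assume GA: "G \<in> antidiag" and e: "esum (pow_emod (?S \<times> UNIV)) F G = Some s"
    obtain a' y' b' c' where G0: "0 \<le> a'" "y' \<in> ecarrier M"
      "\<forall>k\<in>?S. G (k, True) = a' * k y' + b' \<and> G (k, False) = c' - a' * k y'" using antidiagD(2)[OF GA] by blast
    note G = antidiagD(1)[OF GA] G0(1,2) G0(3)[rule_format]
    have sc: "s \<in> cube (?S \<times> UNIV)"
      using pow.sum_closed[OF _ _ e] F(1) G(1) by simp
    have s: "s = (\<lambda>t\<in>?S \<times> UNIV. F t + G t)" using e by (simp add: pow_emod_sum_Some)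
    have "\<exists>z\<in>ecarrier M. \<forall>k\<in>?S. (a + a') * k z = a * k y + a' * k y'"
    proof (cases "a + a' = 0")
      case True
      then have "a = 0" "a' = 0" using F(2) G(2) by linarith+
      then show ?thesis using F(3) by auto
    next
      case False
      \<comment> \<open>Coefficients outside the unit interval are allowed in
        \<open>antidiag\<close>, so \<open>a y + a' y'\<close> may be written as
        \<open>a + a'\<close> times a convex combination, which exists in \<open>M\<close>.\<close>
      let ?z = "lc (a / (a + a')) y (a' / (a + a')) y'"
      have *: "0 \<le> a / (a + a')" "0 \<le> a' / (a + a')" "a / (a + a') + a' / (a + a') = 1"
        using F(2) G(2) False by (auto simp: add_divide_distrib[symmetric])
      have "(a + a') * k ?z = a * k y + a' * k y'" if "k \<in> ?S" for k
      proof -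
        have "k ?z = (a * k y + a' * k y') / (a + a')"
          using state_lc[OF that *(1,2) _ F(3) G(3)] *(3) by (simp add: add_divide_distrib)
        then show ?thesis using False by simp
      qed
      then show ?thesis using lc_sum(2)[OF *(1,2) _ F(3) G(3)] *(3) by auto
    qed
    then obtain z where z: "z \<in> ecarrier M" "\<And>k. k \<in> ?S \<Longrightarrow> (a + a') * k z = a * k y + a' * k y'" by blast
    show "s \<in> antidiag"
      by (rule antidiagI[OF sc, of "a + a'" z "b + b'" "c + c'"])
        (use F(2,4) G(2,4) z in \<open>auto simp: s\<close>)
  }
  fix r :: real and F assume r: "r \<in> {0..1}" and FA: "F \<in> antidiag"
  obtain a y b c where F0: "0 \<le> a" "y \<in> ecarrier M"
    "\<forall>k\<in>?S. F (k, True) = a * k y + b \<and> F (k, False) = c - a * k y" using antidiagD(2)[OF FA] by blast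
  note F = antidiagD(1)[OF FA] F0(1,2) F0(3)[rule_format]
  show "escale (pow_emod (?S \<times> UNIV)) r F \<in> antidiag"
  proof (rule antidiagI[of _ "r * a" y "r * b" "r * c"])
    show "escale (pow_emod (?S \<times> UNIV)) r F \<in> cube (?S \<times> UNIV)"
      using cube_scale[OF F(1)] r by simp
  qed (use F r in \<open>auto simp: distrib_left right_diff_distrib mult.assoc\<close>)
qed

text \<open>On \<open>antidiag\<close> the terms with \<open>k\<close> cancel and the value is
  \<open>(b + c)/2\<close>; the state \<open>k\<close> only serves to express it.\<close>

definition avg :: "('a \<Rightarrow> real) \<Rightarrow> (('a \<Rightarrow> real) \<times> bool \<Rightarrow> real) \<Rightarrow> real" where
  "avg k = (\<lambda>F\<in>antidiag. (F (k, True) + F (k, False)) / 2)"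

lemma avg_state:
  assumes k: "k \<in> states M"
  shows "avg k \<in> states ((pow_emod (states M \<times> UNIV))\<lparr>ecarrier := antidiag\<rparr>)"
proof -
  let ?T = "states M \<times> (UNIV :: bool set)"
  let ?N = "(pow_emod ?T)\<lparr>ecarrier := antidiag\<rparr>"
  interpret N: emodule ?N
    using subcube_emodule[OF subeffect_antidiag] .
  have T: "(k, b) \<in> ?T" for b using k by simp
  show ?thesis
    unfolding N.state_iff
  proof (intro conjI ballI allI impI)
    show "avg k \<in> ecarrier ?N \<rightarrow>\<^sub>E {0..1}"
    proof (rule PiE_I)
      fix F assume "F \<in> ecarrier ?N"
      then have F: "F \<in> antidiag" by simp
      then show "avg k F \<in> {0..1}"
        using unit_cubeD[OF subcubeD[OF subeffect_antidiag F] T[of True]]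
          unit_cubeD[OF subcubeD[OF subeffect_antidiag F] T[of False]] by (simp add: avg_def)
    qed (simp add: avg_def)
    show "avg k (eone ?N) = 1"
      using N.one_closed k by (simp add: avg_def eone_def)
    fix F G s assume FG: "F \<in> ecarrier ?N" "G \<in> ecarrier ?N" "esum ?N F G = Some s"
    then show "avg k s = avg k F + avg k G"
      using N.sum_closed[OF FG] k by (simp add: avg_def pow_emod_sum_Some add_divide_distrib)
  next
    fix r F assume rF: "r \<in> {0..1::real}" "F \<in> ecarrier ?N"
    then show "avg k (escale ?N r F) = r * avg k F"
      using N.scale_closed[OF rF] k by (simp add: avg_def algebra_simps)
  qed
qed

text \<open>The average is extended tightly at \<open>w = ((1 + f)/2, (1 - f)/2)\<close>. The two
  halves of the extension agree on \<open>M\<close>, hence on the algebra map \<open>f\<close>, and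
  the contributions of \<open>f\<close> cancel: \<open>L w = 1/2\<close>. Tightness gives an element
  of \<open>antidiag\<close> above \<open>s w\<close> with average close to \<open>s/2\<close>. Its
  first component bounds \<open>f\<close> from one side and its second from the other.\<close>

lemma uniform_approx:
  assumes f: "f \<in> Alg_hom (alg_of_emod M) unit_alg" and k0: "k0 \<in> states M" and e: "0 < e"
  obtains a y b where "0 \<le> a" "y \<in> ecarrier M"
    "\<And>k. k \<in> states M \<Longrightarrow> f k \<le> a * k y + b \<and> a * k y + b \<le> f k + e"
proof -
  let ?S = "states M"
  let ?T = "?S \<times> (UNIV :: bool set)"
  have fc: "f \<in> cube ?S" using Alg_hom_unitD(1)[OF f] by simp
  define w where "w = (\<lambda>t\<in>?T. if snd t then 1/2 + 1/2 * f (fst t) else 1/2 - 1/2 * f (fst t))"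
  have wc: "w \<in> cube ?T"
  proof (rule PiE_I)
    fix t assume "t \<in> ?T"
    then show "w t \<in> {0..1}" using unit_cubeD[OF fc, of "fst t"] by (auto simp: w_def)
  qed (simp add: w_def)
  obtain L where L: "L \<in> Exp ?T" and Lavg: "\<And>F. F \<in> antidiag \<Longrightarrow> L F = avg k0 F"
    and app: "\<And>\<epsilon>. 0 < \<epsilon> \<Longrightarrow> \<exists>F\<in>antidiag. \<exists>s. 0 < s \<and> s \<le> 1 \<and>
      ele (pow_emod ?T) (escale (pow_emod ?T) s w) F \<and> avg k0 F < s * (L w + \<epsilon>)"
    using pow.extend_state[OF subeffect_antidiag avg_state[OF k0], of w] wc unfolding Exp_def by auto
  define emb :: "bool \<Rightarrow> (('a \<Rightarrow> real) \<Rightarrow> real) \<Rightarrow> ('a \<Rightarrow> real) \<times> bool \<Rightarrow> real"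
    where "emb i p = (\<lambda>t\<in>?T. if snd t = i then p (fst t) else 0)" for i p
  have embc: "emb i p \<in> cube ?T" if "p \<in> cube ?S" for i p
    using unit_cubeD[OF that] by (auto simp: emb_def)
  \<comment> \<open>The indicator of one copy lies in \<open>antidiag\<close> with
    \<open>a = 0\<close> and has average 1/2. This is why the restriction of \<open>L\<close> to one
    copy is doubled in \<open>h\<close>.\<close>
  have emb_one: "L (emb i (\<lambda>k\<in>?S. 1)) = 1/2" for i
  proof -
    have "emb i (\<lambda>k\<in>?S. 1) \<in> antidiag"
      by (rule antidiagI[OF embc[OF cube_one], of 0 "eone M" i "if i then 1 else 0" "if i then 0 else 1"])
        (auto simp: one_closed emb_def)
    then show ?thesis using Lavg k0 by (cases i) (simp_all add: avg_def emb_def)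
  qed
  define h where "h i = (\<lambda>p\<in>cube ?S. 2 * L (emb i p))" for i
  have h: "h i \<in> Exp ?S" for i
  proof (rule ExpI)
    show "h i (\<lambda>x\<in>?S. 1) = 1" using emb_one[of i] by (simp add: h_def)
    fix p assume p: "p \<in> cube ?S"
    have "L (emb i p) \<le> L (emb i (\<lambda>k\<in>?S. 1)) + 0"
      using unit_cubeD[OF p] by (intro Exp_le[OF L embc[OF p] embc[OF cube_one]]) (auto simp: emb_def)
    then show "0 \<le> h i p \<and> h i p \<le> 1"
      using p emb_one[of i] Exp_range[OF L embc[OF p], of i] by (simp add: h_def)
    {
      fix q assume q: "q \<in> cube ?S" and le: "\<And>k. k \<in> ?S \<Longrightarrow> p k + q k \<le> 1"
      have "(\<lambda>t\<in>?T. emb i p t + emb i q t) = emb i (\<lambda>k\<in>?S. p k + q k)"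
        by (auto simp: emb_def intro!: restrict_ext)
      moreover have "emb i p t + emb i q t \<le> 1" if "t \<in> ?T" for t
        using that le by (auto simp: emb_def)
      ultimately have "L (emb i (\<lambda>k\<in>?S. p k + q k)) = L (emb i p) + L (emb i q)"
        using Exp_add[OF L embc[OF p, of i] embc[OF q, of i]] by simp
      then show "h i (\<lambda>k\<in>?S. p k + q k) = h i p + h i q"
        by (simp only: h_def restrict_apply' p q cube_add[OF p q le] distrib_left)
    }
    fix r :: real assume r: "0 \<le> r" "r \<le> 1"
    have "(\<lambda>t\<in>?T. r * emb i p t) = emb i (\<lambda>k\<in>?S. r * p k)"
      by (auto simp: emb_def intro!: restrict_ext)
    then show "h i (\<lambda>k\<in>?S. r * p k) = r * h i p"
      using Exp_scale[OF L embc[OF p, of i] r] by (simp only: h_def restrict_apply' p cube_scale[OF p r])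
  qed (simp add: h_def)
  have split: "2 * L (\<lambda>t\<in>?T. emb True p t + emb False q t) = h True p + h False q"
    if p: "p \<in> cube ?S" and q: "q \<in> cube ?S" for p q
  proof -
    have "emb True p t + emb False q t \<le> 1" if "t \<in> ?T" for t
      using that unit_cubeD[OF p, of "fst t"] unit_cubeD[OF q, of "fst t"] by (auto simp: emb_def)
    then have "L (\<lambda>t\<in>?T. emb True p t + emb False q t) = L (emb True p) + L (emb False q)"
      by (rule Exp_add[OF L embc[OF p] embc[OF q]])
    then show ?thesis by (simp only: h_def restrict_apply' p q distrib_left)
  qed
  \<comment> \<open>The pair of \<open>hat M y\<close> and \<open>1 - hat M y\<close> belongs to
    \<open>antidiag\<close> (\<open>a = 1\<close>, \<open>b = 0\<close>, \<open>c = 1\<close>), so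
    its \<open>L\<close>-value is known to be 1/2.\<close>
  have "h True (hat M y) = h False (hat M y)" if y: "y \<in> ecarrier M" for y
  proof -
    note yc = hat_cube[OF y]
    let ?F = "\<lambda>t\<in>?T. emb True (hat M y) t + emb False (\<lambda>k\<in>?S. 1 - hat M y k) t"
    have FA: "?F \<in> antidiag"
    proof (rule antidiagI[of _ 1 y 0 1])
      show "?F \<in> cube ?T"
        using unit_cubeD[OF yc] by (auto simp: emb_def)
    qed (auto simp: emb_def hat_def y)
    have "2 * L ?F = 1" unfolding Lavg[OF FA] using FA k0 by (simp add: avg_def emb_def)
    then have "h True (hat M y) + h False (\<lambda>k\<in>?S. 1 - hat M y k) = 1"
      using split[OF yc cube_compl[OF yc]] by simp
    then show ?thesis using Exp_compl[OF h yc] by simp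
  qed
  \<comment> \<open>The structure map sees a state on the cube only through its values at the
    functions \<open>hat M y\<close>, and \<open>f\<close> at that point recovers the value at
    \<open>f\<close>.\<close>
  then have "astruct (alg_of_emod M) (h True) = astruct (alg_of_emod M) (h False)"
    using h by (auto intro!: restrict_ext)
  then have hf: "h True f = h False f"
    using Alg_hom_unitD(2)[OF f] h by simp metis
  have "w = (\<lambda>t\<in>?T. emb True (\<lambda>k\<in>?S. (\<lambda>k\<in>?S. 1/2 * (\<lambda>k\<in>?S. 1) k) k + (\<lambda>k\<in>?S. 1/2 * f k) k) t
      + emb False (\<lambda>k\<in>?S. 1/2 * (\<lambda>k\<in>?S. 1 - f k) k) t)"
    by (auto simp: w_def emb_def intro!: restrict_ext)
  moreover have c1: "(\<lambda>k\<in>?S. 1/2 * (\<lambda>k\<in>?S. 1) k) \<in> cube ?S"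
    "(\<lambda>k\<in>?S. 1/2 * f k) \<in> cube ?S" "(\<lambda>k\<in>?S. 1/2 * (\<lambda>k\<in>?S. 1 - f k) k) \<in> cube ?S"
    by (intro cube_scale cube_one cube_compl fc; simp)+
  moreover have c2: "(\<lambda>k\<in>?S. 1/2 * (\<lambda>k\<in>?S. 1) k) k + (\<lambda>k\<in>?S. 1/2 * f k) k \<le> 1" if "k \<in> ?S" for k
    using unit_cubeD[OF fc that] that by simp
  moreover have e1: "h i (\<lambda>k\<in>?S. 1/2 * (\<lambda>k\<in>?S. 1) k) = 1/2 * 1" for i
    by (subst Exp_scale[OF h cube_one]) (simp_all add: Exp_one[OF h])
  moreover have e2: "h i (\<lambda>k\<in>?S. 1/2 * f k) = 1/2 * h i f" for i
    by (rule Exp_scale[OF h fc]) simp_all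
  moreover have e3: "h i (\<lambda>k\<in>?S. 1/2 * (\<lambda>k\<in>?S. 1 - f k) k) = 1/2 * (1 - h i f)" for i
    by (subst Exp_scale[OF h cube_compl[OF fc]]) (simp_all add: Exp_compl[OF h fc])
  ultimately have "2 * L w = h True (\<lambda>k\<in>?S. (\<lambda>k\<in>?S. 1/2 * (\<lambda>k\<in>?S. 1) k) k + (\<lambda>k\<in>?S. 1/2 * f k) k)
      + h False (\<lambda>k\<in>?S. 1/2 * (\<lambda>k\<in>?S. 1 - f k) k)"
    using split[OF cube_add[OF c1(1,2) c2] c1(3)] by simp
  also have "h True (\<lambda>k\<in>?S. (\<lambda>k\<in>?S. 1/2 * (\<lambda>k\<in>?S. 1) k) k + (\<lambda>k\<in>?S. 1/2 * f k) k) = 1/2 * 1 + 1/2 * h True f"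
    by (simp only: Exp_add[OF h c1(1,2) c2] e1 e2)
  also have "h False (\<lambda>k\<in>?S. 1/2 * (\<lambda>k\<in>?S. 1 - f k) k) = 1/2 * (1 - h False f)"
    by (simp only: e3)
  finally have Lw: "L w = 1/2" using hf by (simp add: diff_divide_distrib)
  obtain F s where F: "F \<in> antidiag" and s: "0 < s" "s \<le> 1"
    and le: "ele (pow_emod ?T) (escale (pow_emod ?T) s w) F" and av: "avg k0 F < s * (1/2 + e/4)"
    using app[of "e/4"] e Lw by auto
  note Fc = antidiagD(1)[OF F]
  obtain a y b c where a: "0 \<le> a" and y: "y \<in> ecarrier M"
    and Fk0: "\<forall>k\<in>?S. F (k, True) = a * k y + b \<and> F (k, False) = c - a * k y"
    using antidiagD(2)[OF F] by blast
  note Fk = Fk0[rule_format]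
  have pt: "s * w t \<le> F t" if "t \<in> ?T" for t
    using le pow_ele[OF cube_scale[OF wc, of s] Fc] s that by (cases t) simp
  have "b + c < s * (1 + e/2)"
    using av F Fk[OF k0] by (simp add: avg_def algebra_simps)
  then have bc: "(b + c) / s < 1 + e/2" using s by (simp add: pos_divide_less_eq mult.commute)
  show ?thesis
  \<comment> \<open>Obtained by solving \<open>(1 + f)/2 \<le> (a y + b)/s\<close> for
    \<open>f\<close>. The upper bound comes from \<open>(1 - f)/2 \<le> (c - a y)/s\<close> together
    with \<open>(b + c)/s < 1 + e/2\<close>.\<close>
  proof (rule that[of "2 * a / s" y "2 * b / s - 1"])
    show "0 \<le> 2 * a / s" using a s by simp
    show "y \<in> ecarrier M" by (fact y)
    fix k assume k: "k \<in> ?S"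
    let ?v = "2 * a / s * k y + (2 * b / s - 1)"
    have "s * (1/2 + 1/2 * f k) \<le> a * k y + b" "s * (1/2 - 1/2 * f k) \<le> c - a * k y"
      using pt[of "(k, True)"] pt[of "(k, False)"] Fk[OF k] k by (simp_all add: w_def)
    then have "1/2 + 1/2 * f k \<le> (a * k y + b) / s" "1/2 - 1/2 * f k \<le> (c - a * k y) / s"
      using s by (simp_all add: pos_le_divide_eq mult.commute)
    moreover have "?v = 2 * ((a * k y + b) / s) - 1" using s by (simp add: field_simps)
    moreover have "(c - a * k y) / s = (b + c) / s - (a * k y + b) / s"
      by (simp add: diff_divide_distrib[symmetric])
    ultimately show "f k \<le> ?v \<and> ?v \<le> f k + e" using bc by linarith
  qed
qed

text \<open>Division by a large power of 2 makes the coefficients small enough to form the element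
  inside \<open>M\<close>. It is then doubled \<open>n\<close> times; each double exists because all
  states take values at most 1/2 at the element being doubled.\<close>

lemma affine_of_hat:
  assumes arch: "archimedean M" and a: "0 \<le> a" and y: "y \<in> ecarrier M"
    and range: "\<And>k. k \<in> states M \<Longrightarrow> 0 \<le> a * k y + b \<and> a * k y + b \<le> 1"
  shows "\<exists>z\<in>ecarrier M. \<forall>k\<in>states M. k z = a * k y + b"
proof -
  let ?S = "states M"
  obtain n where n: "a + \<bar>b\<bar> < 2 ^ n" using real_arch_pow[of 2] by auto
  let ?N = "(2::real) ^ n"
  have s: "0 \<le> a / ?N" "0 \<le> \<bar>b\<bar> / ?N" "a / ?N + \<bar>b\<bar> / ?N \<le> 1"
    using a n by (auto simp: add_divide_distrib[symmetric])
  then have s1: "a / ?N \<le> 1" "\<bar>b\<bar> / ?N \<le> 1" by linarith+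
  have "\<exists>u\<in>ecarrier M. \<forall>k\<in>?S. k u = (a * k y + b) / ?N"
  proof (cases "0 \<le> b")
    case True
    have "k (lc (a / ?N) y (\<bar>b\<bar> / ?N) (eone M)) = (a * k y + b) / ?N" if "k \<in> ?S" for k
      using state_lc[OF that s y one_closed] stateD(3)[OF that] True by (simp add: add_divide_distrib)
    then show ?thesis using lc_sum(2)[OF s y one_closed] by blast
  next
    case False
    \<comment> \<open>Subtraction through complements: for negative \<open>b\<close>, the complement
      of \<open>(a/N) y\<close> plus \<open>(|b|/N) 1\<close> has the complement
      \<open>(a y + b)/N\<close>. The sum exists by the lower bound in \<open>range\<close>.\<close>
    let ?v = "ecompl M (escale M (a / ?N) y)" and ?c = "escale M (\<bar>b\<bar> / ?N) (eone M)"
    have cl: "escale M (a / ?N) y \<in> ecarrier M" "?v \<in> ecarrier M" "?c \<in> ecarrier M"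
      using s s1 y one_closed by (auto intro!: scale_closed compl_closed)
    have kv: "k ?v = 1 - a / ?N * k y" "k ?c = \<bar>b\<bar> / ?N" if "k \<in> ?S" for k
      using state_compl[OF that cl(1)] stateD(6)[OF that s(1) s1(1) y]
        stateD(6)[OF that s(2) s1(2) one_closed] stateD(3)[OF that] by simp_all
    have "k ?v + k ?c \<le> 1" if "k \<in> ?S" for k
    proof -
      have "0 \<le> (a * k y + b) / ?N" using range[OF that] by simp
      then show ?thesis using kv[OF that] False by (simp add: add_divide_distrib)
    qed
    then obtain t where t: "t \<in> ecarrier M" "\<And>k. k \<in> ?S \<Longrightarrow> k t = k ?v + k ?c"
      using sum_defined_of_states[OF arch cl(2,3)] by metis
    have "k (ecompl M t) = (a * k y + b) / ?N" if "k \<in> ?S" for k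
      using state_compl[OF that t(1)] t(2)[OF that] kv[OF that] False by (simp add: add_divide_distrib)
    then show ?thesis using compl_closed[OF t(1)] by blast
  qed
  then show ?thesis
  proof (induction n)
    case 0
    then show ?case by simp
  next
    case (Suc n)
    obtain u where u: "u \<in> ecarrier M" "\<And>k. k \<in> ?S \<Longrightarrow> k u = (a * k y + b) / 2 ^ Suc n"
      using Suc(2) by blast
    have uu: "k u + k u = (a * k y + b) / 2 ^ n" if "k \<in> ?S" for k
      using u(2)[OF that] by simp
    have "k u + k u \<le> 1" if "k \<in> ?S" for k
    proof -
      have "a * k y + b \<le> 2 ^ n" using range[OF that] one_le_power[of "2::real" n] by linarith
      then show ?thesis unfolding uu[OF that] by simp
    qed
    then obtain z where "z \<in> ecarrier M" "\<And>k. k \<in> ?S \<Longrightarrow> k z = k u + k u"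
      using sum_defined_of_states[OF arch u(1) u(1)] by metis
    then have "\<exists>z\<in>ecarrier M. \<forall>k\<in>?S. k z = (a * k y + b) / 2 ^ n" using uu by auto
    then show ?case by (rule Suc(1))
  qed
qed

lemma states_rep:
  assumes "archimedean M"
  shows "emodule_rep M (states M) (\<lambda>k. k)"
  by unfold_locales
    (use stateD(1,2) half_le_iff_states[OF assms] eq_of_states[OF assms] in \<open>auto\<close>)

lemma Alg_hom_alg_of_emod:
  assumes M: "M \<in> BEMod" and f: "f \<in> Alg_hom (alg_of_emod M) unit_alg"
  shows "\<exists>y\<in>ecarrier M. hat M y = f"
\<comment> \<open>Without states all functions on the state space coincide, and there is no state
  \<open>k0\<close> with which to form \<open>avg k0\<close>.\<close>
proof (cases "states M = {}")
  case True
  have "hat M (eone M) = f"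
    using Alg_homD(2)[OF f] True by (intro extensionalityI[of _ "states M"]) (auto simp: hat_def)
  then show ?thesis using one_closed by blast
next
  case False
  let ?S = "states M"
  obtain k0 where k0: "k0 \<in> ?S" using False by blast
  have arch: "archimedean M" using M by (simp add: BEMod_def)
  interpret R: emodule_rep M ?S "\<lambda>k. k" by (rule states_rep[OF arch])
  have fc: "f \<in> cube ?S" using Alg_hom_unitD(1)[OF f] by simp
  have "\<exists>z\<in>ecarrier M. \<forall>k\<in>?S. \<bar>k z - f k\<bar> \<le> e" if e: "0 < e" for e
  proof -
    obtain a y b where ab: "0 \<le> a" "y \<in> ecarrier M"
      "\<And>k. k \<in> ?S \<Longrightarrow> f k \<le> a * k y + b \<and> a * k y + b \<le> f k + e"
      using uniform_approx[OF f k0 e] by blast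
    \<comment> \<open>The approximant takes values in \<open>[0, 1 + e]\<close>. Division by
      \<open>1 + e\<close> brings it into the unit interval, as \<open>affine_of_hat\<close>
      requires, and the distance to \<open>f\<close> stays within \<open>e\<close>.\<close>
    have eq: "a / (1 + e) * k y + b / (1 + e) = (a * k y + b) / (1 + e)" for k
      by (simp add: add_divide_distrib)
    have "0 \<le> (a * k y + b) / (1 + e) \<and> (a * k y + b) / (1 + e) \<le> 1" if "k \<in> ?S" for k
      using ab(3)[OF that] unit_cubeD[OF fc that] e by (simp add: divide_le_eq zero_le_divide_iff)
    then obtain z where z: "z \<in> ecarrier M" "\<And>k. k \<in> ?S \<Longrightarrow> k z = (a * k y + b) / (1 + e)"
      using affine_of_hat[OF arch _ ab(2), of "a / (1 + e)" "b / (1 + e)"] ab(1) e unfolding eq by auto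
    have "\<bar>k z - f k\<bar> \<le> e" if k: "k \<in> ?S" for k
    proof -
      have f01: "0 \<le> f k" "f k \<le> 1" using unit_cubeD[OF fc k] by auto
      define v where "v = a * k y + b"
      have v: "f k \<le> v" "v \<le> f k + e" using ab(3)[OF k] by (simp_all add: v_def)
      have "f k * e \<le> e" "0 \<le> f k * e" "0 \<le> e * e" using f01 e by simp_all
      then have "(f k - e) * (1 + e) \<le> v" "v \<le> (f k + e) * (1 + e)"
        using v unfolding distrib_left left_diff_distrib distrib_right mult_1_right by linarith+
      then have "f k - e \<le> k z" "k z \<le> f k + e"
        unfolding z(2)[OF k] v_def[symmetric] using e by (simp_all add: pos_le_divide_eq pos_divide_le_eq)
      then show ?thesis by linarith
    qed
    then show ?thesis using z(1) by blast
  qed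
  then have "\<forall>n. \<exists>z\<in>ecarrier M. \<forall>k\<in>?S. \<bar>k z - f k\<bar> \<le> 1 / Suc n" by simp
  then obtain s where s: "\<And>n. s n \<in> ecarrier M" "\<And>n k. k \<in> ?S \<Longrightarrow> \<bar>k (s n) - f k\<bar> \<le> 1 / Suc n"
    by metis
  have small: "\<exists>N. \<forall>n\<ge>N. 1 / Suc n \<le> e" if "0 < e" for e :: real
  proof -
    obtain N where N: "inverse (Suc N) < e" using reals_Archimedean[OF \<open>0 < e\<close>] by blast
    have "1 / Suc n \<le> 1 / Suc N" if "N \<le> n" for n using that by (simp add: frac_le)
    then show ?thesis using N by (intro exI[of _ N]) (force simp: inverse_eq_divide)
  qed
  have "\<exists>N. \<forall>m\<ge>N. \<forall>n\<ge>N. \<forall>k\<in>?S. \<bar>k (s m) - k (s n)\<bar> \<le> e" if e: "0 < e" for e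
  proof -
    obtain N where N: "\<And>n. N \<le> n \<Longrightarrow> 1 / Suc n \<le> e/2" using small[OF half_gt_zero[OF e]] by blast
    have "\<bar>k (s m) - k (s n)\<bar> \<le> e" if "N \<le> m" "N \<le> n" "k \<in> ?S" for m n k
      using s(2)[OF that(3), of m] s(2)[OF that(3), of n] N[OF that(1)] N[OF that(2)] by linarith
    then show ?thesis by blast
  qed
  then have "range s \<subseteq> ecarrier M \<and>
      (\<forall>e>0. \<exists>N. \<forall>m\<ge>N. \<forall>n\<ge>N. \<forall>k\<in>?S. \<bar>k (s m) - k (s n)\<bar> \<le> e)"
    using s(1) by (simp add: image_subset_iff)
  moreover have "Metric_space.mcomplete (ecarrier M) (edist M)" using M by (simp add: BEMod_def)
  ultimately have "\<exists>y\<in>ecarrier M. \<forall>e>0. \<exists>N. \<forall>n\<ge>N. \<forall>k\<in>?S. \<bar>k (s n) - k y\<bar> \<le> e"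
    unfolding R.mcomplete_iff by (elim allE[of _ s] mp)
  then obtain y where y: "y \<in> ecarrier M"
    and lim: "\<And>e. 0 < e \<Longrightarrow> \<exists>N. \<forall>n\<ge>N. \<forall>k\<in>?S. \<bar>k (s n) - k y\<bar> \<le> e"
    by blast
  have "k y = f k" if k: "k \<in> ?S" for k
  proof -
    have "\<bar>k y - f k\<bar> \<le> e" if e: "0 < e" for e
    proof -
      obtain N where N: "\<And>n. N \<le> n \<Longrightarrow> \<bar>k (s n) - k y\<bar> \<le> e/2"
        using lim[OF half_gt_zero[OF e]] k by blast
      obtain N' where N': "\<And>n. N' \<le> n \<Longrightarrow> 1 / Suc n \<le> e/2"
        using small[OF half_gt_zero[OF e]] by blast
      show ?thesis
        using N[of "max N N'"] N'[of "max N N'"] s(2)[OF k, of "max N N'"] by linarith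
    qed
    then have "\<bar>k y - f k\<bar> \<le> 0" by (rule field_le_epsilon[where y = 0, simplified])
    then show ?thesis by simp
  qed
  then have "hat M y = f"
    using fc by (intro extensionalityI[of _ ?S]) (auto simp: hat_def PiE_iff)
  then show ?thesis using y by blast
qed

lemma adj_counit_iso:
  assumes M: "M \<in> BEMod"
  shows "EMod_iso M (emod_of_alg (alg_of_emod M)) (adj_counit M)"
proof -
  let ?S = "states M" and ?N = "emod_of_alg (alg_of_emod M)"
  have arch: "archimedean M" and ME: "M \<in> EMod" using M by (simp_all add: BEMod_def)
  have hatk: "hat M y k = k y" if "k \<in> ?S" for k y using that by (simp add: hat_def)
  have inj: "x = y" if "x \<in> ecarrier M" "y \<in> ecarrier M" "hat M x = hat M y" for x y
    using eq_of_states[OF arch that(1,2)] hatk that(3) by metis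
  define g where "g = (\<lambda>f\<in>Alg_hom (alg_of_emod M) unit_alg. SOME y. y \<in> ecarrier M \<and> hat M y = f)"
  have g: "g f \<in> ecarrier M" "hat M (g f) = f" if "f \<in> Alg_hom (alg_of_emod M) unit_alg" for f
    using someI_ex[of "\<lambda>y. y \<in> ecarrier M \<and> hat M y = f"] Alg_hom_alg_of_emod[OF M that] that
    by (auto simp: g_def)
  have gI: "g (hat M y) = y" if "y \<in> ecarrier M" for y
    using inj[OF g(1) that g(2)] hat_hom[OF that] by blast
  have "g \<in> EMod_hom ?N M"
    unfolding EMod_hom_def mem_Collect_eq emod_of_alg_simps
  proof (intro conjI ballI allI impI)
    show "g \<in> Alg_hom (alg_of_emod M) unit_alg \<rightarrow>\<^sub>E ecarrier M"
      using g(1) by (auto simp: PiE_iff) (simp add: g_def)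
    show "g (\<lambda>x\<in>acarrier (alg_of_emod M). 1) = eone M"
      using gI[OF one_closed] hat_one by simp
    fix p q s assume p: "p \<in> Alg_hom (alg_of_emod M) unit_alg" and q: "q \<in> Alg_hom (alg_of_emod M) unit_alg"
      and e: "esum (pow_emod (acarrier (alg_of_emod M))) p q = Some s"
    \<comment> \<open>The inverse has to send defined sums to defined sums; in an Archimedean module
      the states decide definedness.\<close>
    have "k (g p) + k (g q) \<le> 1" if "k \<in> ?S" for k
    proof -
      have "p k + q k \<le> 1" using e that by (simp add: pow_emod_sum_Some)
      then show ?thesis using hatk[OF that, of "g p"] hatk[OF that, of "g q"] g(2)[OF p] g(2)[OF q] by simp
    qed
    then obtain z where z: "z \<in> ecarrier M" "esum M (g p) (g q) = Some z"
      using sum_defined_of_states[OF arch g(1)[OF p] g(1)[OF q]] by metis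
    have hz: "hat M z = s"
      using hat_add[OF g(1)[OF p] g(1)[OF q] z(2)] e g(2)[OF p] g(2)[OF q] by (simp add: pow_emod_sum_Some)
    show "esum M (g p) (g q) = Some (g s)" using z(2) gI[OF z(1), unfolded hz] by simp
  next
    fix r :: real and p assume r: "r \<in> {0..1}" and p: "p \<in> Alg_hom (alg_of_emod M) unit_alg"
    have "hat M (escale M r (g p)) = (\<lambda>x\<in>acarrier (alg_of_emod M). r * p x)"
      using hat_scale[OF g(1)[OF p], of r] r g(2)[OF p] by simp
    then show "g (\<lambda>x\<in>acarrier (alg_of_emod M). r * p x) = escale M r (g p)"
      using gI[OF scale_closed[OF r g(1)[OF p]]] by simp
  qed
  moreover have "compose (ecarrier M) g (adj_counit M) = (\<lambda>x\<in>ecarrier M. x)"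
    using gI by (auto simp: compose_def adj_counit_eq intro!: restrict_ext)
  moreover have "compose (ecarrier ?N) (adj_counit M) g = (\<lambda>y\<in>ecarrier ?N. y)"
    using g by (auto simp: compose_def adj_counit_eq intro!: restrict_ext)
  ultimately show ?thesis
    unfolding EMod_iso_def using adj_counit_hom[OF ME] by blast
qed

end

section \<open>Ultrafilters and distributions inside the expectation monad\<close>

text \<open>A minimal proper filter below \<open>F\<close>. The infimum of a chain of proper filters
  is proper because the chain is directed. At a minimal \<open>m\<close>, either
  \<open>\<not> P\<close> holds eventually or restricting \<open>m\<close> to \<open>P\<close> stays
  proper and so changes nothing.\<close>

lemma ultrafilter_exists:
  assumes "F \<noteq> bot"
  obtains G where "G \<le> F" "G \<noteq> bot" "\<And>P. eventually P G \<or> eventually (\<lambda>x. \<not> P x) G"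
proof -
  define A where "A = {G. G \<noteq> bot \<and> G \<le> F}"
  have "\<exists>m\<in>A. \<forall>a\<in>A. a \<le> m \<longrightarrow> a = m"
  proof (rule predicate_Zorn)
    show "partial_order_on A (relation_of (\<lambda>G H. H \<le> G) A)"
      by (rule partial_order_on_relation_ofI) auto
    fix C assume C: "C \<in> Chains (relation_of (\<lambda>G H. H \<le> G) A)"
    have CA: "C \<subseteq> A" using C unfolding Chains_def relation_of_def by blast
    show "\<exists>u\<in>A. \<forall>a\<in>C. u \<le> a"
    proof (cases "C = {}")
      case True
      then show ?thesis using assms by (auto simp: A_def)
    next
      case False
      have "\<exists>x\<in>C. x \<le> inf G H" if "G \<in> C" "H \<in> C" for G H
        using C that unfolding Chains_def relation_of_def by fastforce
      then have "Inf C \<noteq> bot"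
        using eventually_Inf_base[OF False] CA by (auto simp: trivial_limit_def A_def)
      moreover obtain G where G: "G \<in> C" using False by blast
      have "Inf C \<le> F" using Inf_lower[OF G] G CA by (auto simp: A_def)
      ultimately have "Inf C \<in> A" by (simp add: A_def)
      then show ?thesis using Inf_lower by blast
    qed
  qed
  then obtain m where m: "m \<in> A" "\<And>a. \<lbrakk>a \<in> A; a \<le> m\<rbrakk> \<Longrightarrow> a = m" by blast
  have "eventually P m \<or> eventually (\<lambda>x. \<not> P x) m" for P
  proof (cases "eventually (\<lambda>x. \<not> P x) m")
    case False
    let ?G = "inf m (principal {x. P x})"
    have "?G \<noteq> bot" using False by (simp add: trivial_limit_def eventually_inf_principal)
    then have "?G \<in> A" using m(1) by (auto simp: A_def intro: le_infI1)
    then have "?G = m" by (intro m(2)) simp_all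
    moreover have "eventually P ?G" by (simp add: eventually_inf_principal)
    ultimately show ?thesis by simp
  qed simp
  then show ?thesis using m(1) that by (auto simp: A_def)
qed

lemma ultrafiltersD:
  assumes "F \<in> ultrafilters X"
  shows "F \<noteq> bot" "eventually (\<lambda>x. x \<in> X) F" "\<not> eventually P F \<Longrightarrow> eventually (\<lambda>x. \<not> P x) F"
  using assms by (auto simp: ultrafilters_def)

lemma ultrafilters_filtermap:
  assumes F: "F \<in> ultrafilters X" and f: "f \<in> X \<rightarrow> Y"
  shows "filtermap f F \<in> ultrafilters Y"
proof -
  have "eventually (\<lambda>x. f x \<in> Y) F"
    using ultrafiltersD(2)[OF F] by (rule eventually_mono) (use f in auto)
  then show ?thesis
    using F by (auto simp: ultrafilters_def filtermap_bot_iff eventually_filtermap)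
qed

text \<open>The infimum is the limit of \<open>p\<close> along \<open>F\<close>. For the lower
  bound, the ultrafilter property turns the failure of \<open>p x \<le> a\<close> into eventual
  \<open>p x > a\<close>. The state laws then become limit laws.\<close>

lemma uf_to_Exp_tendsto:
  assumes F: "F \<in> ultrafilters X" and p: "p \<in> cube X"
  shows "(p \<longlongrightarrow> uf_to_Exp X F p) F"
proof -
  let ?A = "{s \<in> {0..1}. eventually (\<lambda>x. p x \<le> s) F}"
  have ev: "eventually (\<lambda>x. 0 \<le> p x \<and> p x \<le> 1) F"
    using ultrafiltersD(2)[OF F] by (rule eventually_mono) (rule unit_cubeD[OF p])
  then have one: "1 \<in> ?A" by (auto elim: eventually_mono)
  have l: "uf_to_Exp X F p = Inf ?A" using p by (simp add: uf_to_Exp_def)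
  have bdd: "bdd_below ?A" by (intro bdd_belowI[of _ 0]) auto
  show ?thesis
    unfolding l
  proof (rule order_tendstoI)
    fix a assume a: "Inf ?A < a"
    then obtain s where s: "s \<in> ?A" "s < a" using cInf_lessD[of ?A a] one by blast
    then show "eventually (\<lambda>x. p x < a) F" by (auto elim: eventually_mono)
  next
    fix a assume a: "a < Inf ?A"
    have "a < 1" using a cInf_lower[OF one bdd] by linarith
    show "eventually (\<lambda>x. a < p x) F"
    proof (cases "a < 0")
      case True
      then show ?thesis using ev by (auto elim: eventually_mono)
    next
      case False
      have "\<not> eventually (\<lambda>x. p x \<le> a) F"
      proof
        assume "eventually (\<lambda>x. p x \<le> a) F"
        then have "a \<in> ?A" using False \<open>a < 1\<close> by simp
        then show False using cInf_lower[OF _ bdd, of a] a by linarith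
      qed
      then show ?thesis using ultrafiltersD(3)[OF F] by (fastforce simp: not_le)
    qed
  qed
qed

lemma uf_to_Exp_eq:
  assumes F: "F \<in> ultrafilters X" and p: "p \<in> cube X" and l: "(p \<longlongrightarrow> l) F"
  shows "uf_to_Exp X F p = l"
  using tendsto_unique[OF ultrafiltersD(1)[OF F] uf_to_Exp_tendsto[OF F p] l] .

lemma tendsto_cong_ultra:
  assumes F: "F \<in> ultrafilters X" and eq: "\<And>x. x \<in> X \<Longrightarrow> p x = q x" and l: "(p \<longlongrightarrow> l) F"
  shows "(q \<longlongrightarrow> l) F"
proof -
  have "eventually (\<lambda>x. p x = q x) F"
    using ultrafiltersD(2)[OF F] by (rule eventually_mono) (rule eq)
  then show ?thesis using l tendsto_cong by blast
qed

lemma uf_to_Exp_in: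
  assumes F: "F \<in> ultrafilters X"
  shows "uf_to_Exp X F \<in> Exp X"
proof (rule ExpI)
  note T = uf_to_Exp_tendsto[OF F]
  show "uf_to_Exp X F (\<lambda>x\<in>X. 1) = 1"
    by (rule uf_to_Exp_eq[OF F cube_one]) (rule tendsto_cong_ultra[OF F, of "\<lambda>_. 1"], auto)
  fix p assume p: "p \<in> cube X"
  have ev: "eventually (\<lambda>x. 0 \<le> p x) F" "eventually (\<lambda>x. p x \<le> 1) F"
    using ultrafiltersD(2)[OF F] by (auto elim!: eventually_mono dest: unit_cubeD[OF p])
  show "0 \<le> uf_to_Exp X F p \<and> uf_to_Exp X F p \<le> 1"
    using tendsto_lowerbound[OF T[OF p] ev(1) ultrafiltersD(1)[OF F]]
      tendsto_upperbound[OF T[OF p] ev(2) ultrafiltersD(1)[OF F]] by blast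
  {
    fix q assume q: "q \<in> cube X" and le: "\<And>x. x \<in> X \<Longrightarrow> p x + q x \<le> 1"
    show "uf_to_Exp X F (\<lambda>x\<in>X. p x + q x) = uf_to_Exp X F p + uf_to_Exp X F q"
      by (rule uf_to_Exp_eq[OF F cube_add[OF p q le]], assumption)
        (rule tendsto_cong_ultra[OF F _ tendsto_add[OF T[OF p] T[OF q]]], simp)
  }
  {
    fix r :: real assume r: "0 \<le> r" "r \<le> 1"
    show "uf_to_Exp X F (\<lambda>x\<in>X. r * p x) = r * uf_to_Exp X F p"
      by (rule uf_to_Exp_eq[OF F cube_scale[OF p r]])
        (rule tendsto_cong_ultra[OF F _ tendsto_mult_left[OF T[OF p]]], simp)
  }
qed (simp add: uf_to_Exp_def)

lemma Exp_map_uf: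
  assumes F: "F \<in> ultrafilters X" and f: "f \<in> X \<rightarrow> Y"
  shows "Exp_map X Y f (uf_to_Exp X F) = uf_to_Exp Y (filtermap f F)"
proof (rule Exp_eqI[OF Exp_map_in[OF uf_to_Exp_in[OF F] f] uf_to_Exp_in[OF ultrafilters_filtermap[OF F f]]])
  fix p :: "'b \<Rightarrow> real" assume p: "p \<in> cube Y"
  have "((\<lambda>x. p (f x)) \<longlongrightarrow> uf_to_Exp Y (filtermap f F) p) F"
    using uf_to_Exp_tendsto[OF ultrafilters_filtermap[OF F f] p] by (simp add: filterlim_filtermap)
  then have "(compose X p f \<longlongrightarrow> uf_to_Exp Y (filtermap f F) p) F"
    by (rule tendsto_cong_ultra[OF F, rotated]) (simp add: compose_def)
  then show "Exp_map X Y f (uf_to_Exp X F) p = uf_to_Exp Y (filtermap f F) p"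
    using uf_to_Exp_eq[OF F compose_cube[OF f p]] p by (simp add: Exp_map_def)
qed

section \<open>Finitely supported distributions and density in the expectation monad\<close>

lemma DistrD: "\<phi> \<in> Distr X \<Longrightarrow> finite (set_pmf \<phi>)" "\<phi> \<in> Distr X \<Longrightarrow> set_pmf \<phi> \<subseteq> X"
  by (simp_all add: Distr_def)

lemma Distr_map: "\<lbrakk>\<phi> \<in> Distr X; f \<in> X \<rightarrow> Y\<rbrakk> \<Longrightarrow> map_pmf f \<phi> \<in> Distr Y"
  by (auto simp: Distr_def)

lemma Distr_join: "\<Phi> \<in> Distr (Distr X) \<Longrightarrow> join_pmf \<Phi> \<in> Distr X"
  by (auto simp: Distr_def)

lemma expectation_finite:
  fixes p :: "'a \<Rightarrow> real"
  assumes "finite A" "set_pmf \<phi> \<subseteq> A"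
  shows "measure_pmf.expectation \<phi> p = (\<Sum>x\<in>A. p x * pmf \<phi> x)"
  using assms by (intro integral_measure_pmf_real) auto

lemma expectation_join:
  fixes p :: "'a \<Rightarrow> real"
  assumes \<Phi>: "\<Phi> \<in> Distr (Distr X)"
  shows "measure_pmf.expectation (join_pmf \<Phi>) p =
    measure_pmf.expectation \<Phi> (\<lambda>\<phi>. measure_pmf.expectation \<phi> p)"
proof -
  let ?A = "set_pmf (join_pmf \<Phi>)"
  have fin: "finite ?A" "finite (set_pmf \<Phi>)"
    using DistrD(1)[OF Distr_join[OF \<Phi>]] DistrD(1)[OF \<Phi>] .
  have "measure_pmf.expectation (join_pmf \<Phi>) p = (\<Sum>x\<in>?A. p x * (\<Sum>\<phi>\<in>set_pmf \<Phi>. pmf \<phi> x * pmf \<Phi> \<phi>))"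
    using fin by (subst expectation_finite[OF fin(1)]) (simp_all add: pmf_join expectation_finite[OF fin(2)])
  also have "\<dots> = (\<Sum>\<phi>\<in>set_pmf \<Phi>. (\<Sum>x\<in>?A. p x * pmf \<phi> x) * pmf \<Phi> \<phi>)"
    unfolding sum_distrib_left sum_distrib_right by (subst sum.swap) (simp add: mult.assoc)
  also have "\<dots> = (\<Sum>\<phi>\<in>set_pmf \<Phi>. measure_pmf.expectation \<phi> p * pmf \<Phi> \<phi>)"
    using fin by (intro sum.cong refl) (subst expectation_finite[OF fin(1)], auto)
  also have "\<dots> = measure_pmf.expectation \<Phi> (\<lambda>\<phi>. measure_pmf.expectation \<phi> p)"
    by (rule expectation_finite[OF fin(2) subset_refl, symmetric])
  finally show ?thesis .
qed

lemma distr_to_Exp_expectation: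
  assumes "\<phi> \<in> Distr X" "p \<in> cube X"
  shows "distr_to_Exp X \<phi> p = measure_pmf.expectation \<phi> p"
  using expectation_finite[OF DistrD(1)[OF assms(1)] subset_refl, of p] assms(2)
  by (simp add: distr_to_Exp_def mult.commute)

lemma distr_to_Exp_in:
  assumes \<phi>: "\<phi> \<in> Distr X"
  shows "distr_to_Exp X \<phi> \<in> Exp X"
proof (rule ExpI)
  let ?S = "set_pmf \<phi>"
  have X: "x \<in> X" if "x \<in> ?S" for x using DistrD(2)[OF \<phi>] that by blast
  have D: "distr_to_Exp X \<phi> p = (\<Sum>x\<in>?S. pmf \<phi> x * p x)" if "p \<in> cube X" for p
    using that by (simp add: distr_to_Exp_def)
  have sum1: "(\<Sum>x\<in>?S. pmf \<phi> x) = 1"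
    by (rule sum_pmf_eq_1[OF DistrD(1)[OF \<phi>] subset_refl])
  show "distr_to_Exp X \<phi> (\<lambda>x\<in>X. 1) = 1"
    unfolding D[OF cube_one] using sum1 X by simp
  fix p assume p: "p \<in> cube X"
  have "(\<Sum>x\<in>?S. pmf \<phi> x * p x) \<le> (\<Sum>x\<in>?S. pmf \<phi> x * 1)"
    using X unit_cubeD[OF p] by (intro sum_mono mult_left_mono) auto
  then show "0 \<le> distr_to_Exp X \<phi> p \<and> distr_to_Exp X \<phi> p \<le> 1"
    unfolding D[OF p] using sum1 X unit_cubeD[OF p] by (auto intro!: sum_nonneg mult_nonneg_nonneg)
  {
    fix q assume q: "q \<in> cube X" and le: "\<And>x. x \<in> X \<Longrightarrow> p x + q x \<le> 1"
    have pq: "(\<lambda>x\<in>X. p x + q x) \<in> cube X" by (rule cube_add[OF p q le])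
    show "distr_to_Exp X \<phi> (\<lambda>x\<in>X. p x + q x) = distr_to_Exp X \<phi> p + distr_to_Exp X \<phi> q"
      unfolding D[OF p] D[OF q] D[OF pq] sum.distrib[symmetric]
      using X by (intro sum.cong refl) (simp add: distrib_left)
  }
  {
    fix r :: real assume r: "0 \<le> r" "r \<le> 1"
    show "distr_to_Exp X \<phi> (\<lambda>x\<in>X. r * p x) = r * distr_to_Exp X \<phi> p"
      unfolding D[OF p] D[OF cube_scale[OF p r]] sum_distrib_left
      using X by (intro sum.cong refl) simp
  }
qed (simp add: distr_to_Exp_def)

lemma Exp_map_distr:
  assumes \<phi>: "\<phi> \<in> Distr X" and f: "f \<in> X \<rightarrow> Y"
  shows "Exp_map X Y f (distr_to_Exp X \<phi>) = distr_to_Exp Y (map_pmf f \<phi>)"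
proof (rule Exp_eqI[OF Exp_map_in[OF distr_to_Exp_in[OF \<phi>] f] distr_to_Exp_in[OF Distr_map[OF \<phi> f]]])
  fix p :: "'b \<Rightarrow> real" assume p: "p \<in> cube Y"
  have "measure_pmf.expectation \<phi> (compose X p f) = measure_pmf.expectation \<phi> (\<lambda>x. p (f x))"
    using DistrD(2)[OF \<phi>] by (intro integral_cong_AE) (auto simp: AE_measure_pmf_iff compose_def)
  then show "Exp_map X Y f (distr_to_Exp X \<phi>) p = distr_to_Exp Y (map_pmf f \<phi>) p"
    using distr_to_Exp_expectation[OF \<phi> compose_cube[OF f p]]
      distr_to_Exp_expectation[OF Distr_map[OF \<phi> f] p] p by (simp add: Exp_map_def)
qed

text \<open>Membership in the cube is carried along because the induction step applies
  \<open>Exp_add\<close> to the previous partial sum.\<close>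

lemma Exp_sum:
  assumes h: "h \<in> Exp X" and "finite K" and g: "\<And>c. c \<in> K \<Longrightarrow> g c \<in> cube X"
    and le: "\<And>x. x \<in> X \<Longrightarrow> (\<Sum>c\<in>K. g c x) \<le> 1"
  shows "h (\<lambda>x\<in>X. \<Sum>c\<in>K. g c x) = (\<Sum>c\<in>K. h (g c)) \<and> (\<lambda>x\<in>X. \<Sum>c\<in>K. g c x) \<in> cube X"
  using assms(2-4)
proof (induction K)
  case empty
  have "h (\<lambda>x\<in>X. 0) = 0" using pow.state_zero[of h X] h by (simp add: Exp_def)
  moreover have "(\<lambda>x\<in>X. 0) \<in> cube X" by simp
  ultimately show ?case unfolding sum.empty by (rule conjI)
next
  case (insert c K)
  let ?s = "\<lambda>x\<in>X. \<Sum>c\<in>K. g c x"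
  have "0 \<le> g c x" if "x \<in> X" for x using unit_cubeD[OF insert(4)[of c] that] by simp
  then have le: "(\<Sum>c\<in>K. g c x) \<le> 1" if "x \<in> X" for x using insert(5)[OF that] insert(1,2) that by force
  have "h ?s = (\<Sum>c\<in>K. h (g c)) \<and> ?s \<in> cube X"
    by (rule insert(3)[OF insert(4)[OF insertI2] le])
  then have IH: "h ?s = (\<Sum>c\<in>K. h (g c))" "?s \<in> cube X"
    by blast+
  have le: "g c x + ?s x \<le> 1" if "x \<in> X" for x using insert(5)[OF that] insert(1,2) that by simp
  have eq: "(\<lambda>x\<in>X. \<Sum>c\<in>insert c K. g c x) = (\<lambda>x\<in>X. g c x + ?s x)"
    using insert(1,2) by (auto intro!: restrict_ext)
  have gc: "g c \<in> cube X" by (rule insert(4)) simp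
  show ?case
    unfolding eq unfolding sum.insert[OF insert(1,2)]
    by (intro conjI cube_add[OF gc IH(2) le], subst Exp_add[OF h gc IH(2) le]) (simp_all only: IH(1))
qed

text \<open>The set \<open>X\<close> is cut into the finitely many pieces on which every \<open>\<lfloor>n p\<rfloor>\<close> with \<open>p\<close> in \<open>P\<close>
  is constant.\<close>

lemma distr_approx:
  assumes h: "h \<in> Exp X" and P: "finite P" "P \<subseteq> cube X" and e: "0 < e"
  shows "\<exists>\<phi>\<in>Distr X. \<forall>p\<in>P. \<bar>distr_to_Exp X \<phi> p - h p\<bar> \<le> e"
proof -
  \<comment> \<open>Functions in \<open>P\<close> vary by at most \<open>1/n\<close> on a piece,
    which is below \<open>e\<close>.\<close>
  obtain n :: nat where n: "1 / e < real n" using reals_Archimedean2 by blast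
  have n0: "0 < real n" using n e by (meson divide_pos_pos order.strict_trans zero_less_one)
  define \<kappa> where "\<kappa> = (\<lambda>x. \<lambda>p\<in>P. \<lfloor>real n * p x\<rfloor>)"
  define K where "K = \<kappa> ` X"
  have "K \<subseteq> P \<rightarrow>\<^sub>E {0..int n}"
  proof
    fix c assume "c \<in> K"
    then obtain x where x: "x \<in> X" "c = \<kappa> x" unfolding K_def by blast
    have "0 \<le> \<lfloor>real n * p x\<rfloor> \<and> \<lfloor>real n * p x\<rfloor> \<le> int n" if "p \<in> P" for p
    proof -
      have p: "0 \<le> p x" "p x \<le> 1" using unit_cubeD[of p X x] that x P by auto
      then have "real n * p x \<le> real n" using mult_left_mono[of "p x" 1 "real n"] by simp
      then have "\<lfloor>real n * p x\<rfloor> \<le> \<lfloor>real n\<rfloor>" by (rule floor_mono)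
      then show ?thesis using p n0 by simp
    qed
    then show "c \<in> P \<rightarrow>\<^sub>E {0..int n}" using x by (auto simp: \<kappa>_def)
  qed
  moreover have "finite (P \<rightarrow>\<^sub>E {0..int n})" using P(1) by (intro finite_PiE) auto
  ultimately have K: "finite K" by (rule finite_subset)
  define rep where "rep = inv_into X \<kappa>"
  have rep: "rep c \<in> X" "\<kappa> (rep c) = c" if "c \<in> K" for c
    using that by (auto simp: rep_def K_def inv_into_into f_inv_into_f)
  define ind where "ind c = (\<lambda>x\<in>X. if \<kappa> x = c then 1 else 0 :: real)" for c
  have ind: "ind c \<in> cube X" for c by (auto simp: ind_def)
  have sum_ind: "(\<Sum>c\<in>K. a c * ind c x) = a (\<kappa> x)" if "x \<in> X" for a :: "_ \<Rightarrow> real" and x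
  proof -
    have "(\<Sum>c\<in>K. a c * ind c x) = (\<Sum>c\<in>K. if \<kappa> x = c then a c else 0)"
      using that by (intro sum.cong refl) (simp add: ind_def)
    also have "\<dots> = a (\<kappa> x)" using K that by (simp add: sum.delta' K_def)
    finally show ?thesis .
  qed
  have h0: "0 \<le> h (ind c)" for c using Exp_range[OF h ind] by blast
  have s1: "(\<Sum>c\<in>K. ind c x) = 1" if "x \<in> X" for x
    using sum_ind[OF that, of "\<lambda>_. 1"] by simp
  have "h (\<lambda>x\<in>X. \<Sum>c\<in>K. ind c x) = (\<Sum>c\<in>K. h (ind c))"
    using Exp_sum[OF h K ind, of "\<lambda>c. c"] s1 by simp
  moreover have "(\<lambda>x\<in>X. \<Sum>c\<in>K. ind c x) = (\<lambda>x\<in>X. 1)" using s1 by (auto intro!: restrict_ext)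
  ultimately have tot: "(\<Sum>c\<in>K. h (ind c)) = 1" using Exp_one[OF h] by simp
  \<comment> \<open>Each piece gets the mass that \<open>h\<close> gives to its indicator;
    \<open>rep\<close> later moves this mass to a chosen point of the piece.\<close>
  define w where "w c = (if c \<in> K then h (ind c) else 0)" for c
  have w0: "0 \<le> w c" for c using h0 by (simp add: w_def)
  have "(\<integral>\<^sup>+c. ennreal (w c) \<partial>count_space UNIV) = (\<Sum>c\<in>K. ennreal (w c))"
    using K by (intro nn_integral_count_space') (auto simp: w_def)
  also have "\<dots> = ennreal (\<Sum>c\<in>K. w c)" using w0 by simp
  also have "(\<Sum>c\<in>K. w c) = 1" using tot by (simp add: w_def)
  finally have w1: "(\<integral>\<^sup>+c. ennreal (w c) \<partial>count_space UNIV) = 1" by simp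
  define \<psi> where "\<psi> = embed_pmf w"
  have pmf_\<psi>: "pmf \<psi> c = w c" for c unfolding \<psi>_def by (rule pmf_embed_pmf[OF w0 w1])
  have set_\<psi>: "set_pmf \<psi> \<subseteq> K" by (auto simp: set_pmf_eq pmf_\<psi> w_def)
  define \<phi> where "\<phi> = map_pmf rep \<psi>"
  have \<phi>: "\<phi> \<in> Distr X"
    using set_\<psi> rep(1) finite_subset[OF set_\<psi> K] by (auto simp: \<phi>_def Distr_def)
  have "\<bar>distr_to_Exp X \<phi> p - h p\<bar> \<le> e" if pP: "p \<in> P" for p
  proof -
    have p: "p \<in> cube X" using pP P by blast
    have pr: "0 \<le> p (rep c)" "p (rep c) \<le> 1" if "c \<in> K" for c
      using unit_cubeD[OF p rep(1)[OF that]] by auto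
    define g where "g c = (\<lambda>x\<in>X. p (rep c) * ind c x)" for c
    have g: "g c \<in> cube X" if "c \<in> K" for c
      unfolding g_def by (rule cube_scale[OF ind pr[OF that]])
    have sg: "(\<Sum>c\<in>K. g c x) = p (rep (\<kappa> x))" if "x \<in> X" for x
      using sum_ind[OF that, of "\<lambda>c. p (rep c)"] that by (simp add: g_def)
    have "(\<Sum>c\<in>K. g c x) \<le> 1" if "x \<in> X" for x
      using sg[OF that] pr(2)[of "\<kappa> x"] that by (simp add: K_def)
    note hg = Exp_sum[OF h K g this]
    \<comment> \<open>The expectation of \<open>p\<close> is the value of \<open>h\<close> at the
      step function that replaces \<open>p x\<close> by \<open>p\<close> at the representative of
      the piece of \<open>x\<close>. That function is uniformly within \<open>e\<close> of
      \<open>p\<close>.\<close>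
    have "distr_to_Exp X \<phi> p = measure_pmf.expectation \<psi> (\<lambda>c. p (rep c))"
      unfolding distr_to_Exp_expectation[OF \<phi> p] by (simp add: \<phi>_def)
    also have "\<dots> = (\<Sum>c\<in>K. p (rep c) * w c)"
      by (simp add: expectation_finite[OF K set_\<psi>] pmf_\<psi>)
    also have "\<dots> = (\<Sum>c\<in>K. h (g c))"
      unfolding g_def using Exp_scale[OF h ind pr] by (intro sum.cong refl) (simp add: w_def)
    also have "\<dots> = h (\<lambda>x\<in>X. \<Sum>c\<in>K. g c x)" using hg by simp
    finally have eq: "distr_to_Exp X \<phi> p = h (\<lambda>x\<in>X. \<Sum>c\<in>K. g c x)" .
    have close: "\<bar>(\<lambda>x\<in>X. \<Sum>c\<in>K. g c x) x - p x\<bar> \<le> e" if x: "x \<in> X" for x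
    proof -
      let ?y = "rep (\<kappa> x)"
      have "\<kappa> ?y = \<kappa> x" using rep(2)[of "\<kappa> x"] x by (simp add: K_def)
      then have "\<lfloor>real n * p ?y\<rfloor> = \<lfloor>real n * p x\<rfloor>"
        using pP by (auto simp: \<kappa>_def dest!: fun_cong[of _ _ p])
      then have "\<bar>real n * p ?y - real n * p x\<bar> \<le> 1" by linarith
      then have "real n * \<bar>p ?y - p x\<bar> \<le> 1"
        using n0 by (simp add: right_diff_distrib[symmetric] abs_mult)
      then have "\<bar>p ?y - p x\<bar> \<le> 1 / real n" using n0 by (simp add: pos_le_divide_eq mult.commute)
      also have "\<dots> \<le> e" using n n0 e by (simp add: field_simps)
      finally show ?thesis using sg[OF x] x by simp
    qed
    show ?thesis
      unfolding eq by (rule Exp_close[OF h conjunct2[OF hg] p less_imp_le[OF e] close])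
  qed
  then show ?thesis using \<phi> by blast
qed

text \<open>By \<open>distr_approx\<close>, the sets of distributions that are close to
  \<open>h\<close> at a given \<open>p\<close> have the finite intersection property; an ultrafilter
  refining them converges to \<open>h\<close> at every \<open>p\<close>.\<close>

lemma Exp_ultrafilter_limit:
  assumes h: "h \<in> Exp X"
  obtains G where "G \<in> ultrafilters (Distr X)"
    "\<And>p. p \<in> cube X \<Longrightarrow> ((\<lambda>\<phi>. distr_to_Exp X \<phi> p) \<longlongrightarrow> h p) G"
proof -
  let ?I = "(cube X) \<times> {0<..} :: (('a \<Rightarrow> real) \<times> real) set"
  define B where "B t = {\<phi> \<in> Distr X. \<bar>distr_to_Exp X \<phi> (fst t) - h (fst t)\<bar> \<le> snd t}" for t
  define F where "F = (INF t\<in>?I. principal (B t))"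
  have "F \<noteq> bot"
    unfolding F_def
  proof (rule INF_filter_not_bot)
    fix J assume J: "J \<subseteq> ?I" "finite J"
    \<comment> \<open>The inserted 1 makes the minimum exist for empty \<open>J\<close>.\<close>
    define e where "e = Min (insert 1 (snd ` J))"
    have e: "0 < e" using J by (auto simp: e_def)
    have le: "e \<le> snd t" if "t \<in> J" for t using J that by (auto simp: e_def)
    obtain \<phi> where \<phi>: "\<phi> \<in> Distr X" "\<forall>p\<in>fst ` J. \<bar>distr_to_Exp X \<phi> p - h p\<bar> \<le> e"
    proof -
      have "fst ` J \<subseteq> cube X" using J(1) by fastforce
      then show ?thesis using distr_approx[OF h finite_imageI[OF J(2)] _ e] that by blast
    qed
    have "\<phi> \<in> (\<Inter>t\<in>J. B t)"
    proof
      fix t assume t: "t \<in> J"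
      then show "\<phi> \<in> B t" using \<phi> le[OF t] by (force simp: B_def)
    qed
    then show "(INF t\<in>J. principal (B t)) \<noteq> bot"
      using J(2) by (auto simp: INF_principal_finite principal_eq_bot_iff)
  qed
  then obtain G where G: "G \<le> F" "G \<noteq> bot" "\<And>P. eventually P G \<or> eventually (\<lambda>x. \<not> P x) G"
    using ultrafilter_exists by blast
  have ev: "eventually (\<lambda>\<phi>. \<phi> \<in> B t) G" if "t \<in> ?I" for t
  proof -
    have "G \<le> principal (B t)" using G(1) INF_lower[OF that, of "\<lambda>t. principal (B t)"] by (simp add: F_def)
    then show ?thesis by (simp add: le_principal)
  qed
  \<comment> \<open>Any single \<open>B t\<close> forces \<open>G\<close> onto
    \<open>Distr X\<close>; the constant function 1 with tolerance 1 is a pair that always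
    exists.\<close>
  have "eventually (\<lambda>\<phi>. \<phi> \<in> Distr X) G"
    using ev[of "(\<lambda>x\<in>X. 1, 1)"] by (auto simp: B_def elim: eventually_mono)
  then have "G \<in> ultrafilters (Distr X)" using G by (simp add: ultrafilters_def)
  moreover have "((\<lambda>\<phi>. distr_to_Exp X \<phi> p) \<longlongrightarrow> h p) G" if p: "p \<in> cube X" for p
  proof (rule tendstoI)
    fix e :: real assume e: "0 < e"
    have "(p, e/2) \<in> ?I" using p e by simp
    from ev[OF this] show "eventually (\<lambda>\<phi>. dist (distr_to_Exp X \<phi> p) (h p) < e) G"
      by (rule eventually_mono) (use e in \<open>auto simp: B_def dist_real_def\<close>)
  qed
  ultimately show ?thesis using that by blast
qed

text \<open>Writing \<open>h\<close> as a limit of distributions along an ultrafilter \<open>G\<close> makes it the image under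
  the multiplication of an ultrafilter on \<open>Exp X\<close>, so that the multiplication law of the
  algebra and continuity of \<open>f\<close> reduce the claim to distributions, where \<open>f\<close> is affine.\<close>

lemma affine_continuous_Alg_hom:
  assumes A: "A \<in> Alg" and f: "f \<in> cube (acarrier A)"
    and aff: "\<And>\<phi>. \<phi> \<in> Distr (acarrier A) \<Longrightarrow>
      f (astruct A (distr_to_Exp (acarrier A) \<phi>)) = distr_to_Exp (acarrier A) \<phi> f"
    and cont: "\<And>F. F \<in> ultrafilters (acarrier A) \<Longrightarrow>
      f (astruct A (uf_to_Exp (acarrier A) F)) = uf_to_Exp (acarrier A) F f"
  shows "f \<in> Alg_hom A unit_alg"
  unfolding Alg_hom_unit_iff
proof (intro conjI f ballI)
  let ?X = "acarrier A" and ?\<alpha> = "astruct A"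
  fix h assume h: "h \<in> Exp ?X"
  obtain G where G: "G \<in> ultrafilters (Distr ?X)"
    and lim: "\<And>p. p \<in> cube ?X \<Longrightarrow> ((\<lambda>\<phi>. distr_to_Exp ?X \<phi> p) \<longlongrightarrow> h p) G"
    using Exp_ultrafilter_limit[OF h] by blast
  have dE: "distr_to_Exp ?X \<in> Distr ?X \<rightarrow> Exp ?X" using distr_to_Exp_in by blast
  have aE: "?\<alpha> \<in> Exp ?X \<rightarrow> ?X" using AlgD(1)[OF A] by blast
  define G' where "G' = filtermap (distr_to_Exp ?X) G"
  define F where "F = filtermap ?\<alpha> G'"
  have G': "G' \<in> ultrafilters (Exp ?X)" unfolding G'_def by (rule ultrafilters_filtermap[OF G dE])
  have F: "F \<in> ultrafilters ?X" unfolding F_def by (rule ultrafilters_filtermap[OF G' aE])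
  have "Exp_mult ?X (uf_to_Exp (Exp ?X) G') = h"
  proof (rule Exp_eqI[OF Exp_mult_in[OF uf_to_Exp_in[OF G']] h])
    fix p :: "'a \<Rightarrow> real" assume p: "p \<in> cube ?X"
    have "((\<lambda>k. k p) \<longlongrightarrow> h p) G'"
      using lim[OF p] by (simp add: G'_def filterlim_filtermap)
    then have "((\<lambda>k\<in>Exp ?X. k p) \<longlongrightarrow> h p) G'"
      by (rule tendsto_cong_ultra[OF G', rotated]) simp
    moreover have "(\<lambda>k\<in>Exp ?X. k p) \<in> cube (Exp ?X)"
      using Exp_range[OF _ p] by simp
    ultimately show "Exp_mult ?X (uf_to_Exp (Exp ?X) G') p = h p"
      using uf_to_Exp_eq[OF G'] by (simp add: Exp_mult_apply[OF p])
  qed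
  then have "?\<alpha> h = ?\<alpha> (uf_to_Exp ?X F)"
    using AlgD(4)[OF A uf_to_Exp_in[OF G']] Exp_map_uf[OF G' aE] by (simp add: F_def)
  then have "f (?\<alpha> h) = uf_to_Exp ?X F f" using cont[OF F] by simp
  moreover have "(f \<longlongrightarrow> h f) F"
  proof -
    have "((\<lambda>\<phi>. f (?\<alpha> (distr_to_Exp ?X \<phi>))) \<longlongrightarrow> h f) G"
      by (rule tendsto_cong_ultra[OF G aff[symmetric] lim[OF f]])
    then show ?thesis by (simp add: F_def G'_def filterlim_filtermap)
  qed
  ultimately show "f (?\<alpha> h) = h f" using uf_to_Exp_eq[OF F f] by simp
qed

section \<open>Observable algebras and convex compact Hausdorff spaces\<close>

text \<open>For an ultrafilter on \<open>X\<close>, lying in \<open>X - U\<close> is the negation of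
  lying in \<open>U\<close>. Contraposition thus gives a form in which the axioms of a topology are
  immediate.\<close>

lemma openin_uf_topology:
  assumes a: "\<And>F. F \<in> ultrafilters X \<Longrightarrow> a F \<in> X"
  shows "openin (uf_topology X a) U \<longleftrightarrow>
    U \<subseteq> X \<and> (\<forall>F\<in>ultrafilters X. a F \<in> U \<longrightarrow> eventually (\<lambda>x. x \<in> U) F)"
proof -
  let ?P = "\<lambda>U. U \<subseteq> X \<and> (\<forall>F\<in>ultrafilters X. a F \<in> U \<longrightarrow> eventually (\<lambda>x. x \<in> U) F)"
  have ev: "eventually (\<lambda>x. x \<in> X - U) F \<longleftrightarrow> \<not> eventually (\<lambda>x. x \<in> U) F"
    if F: "F \<in> ultrafilters X" for F U
  proof
    assume *: "eventually (\<lambda>x. x \<in> X - U) F"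
    show "\<not> eventually (\<lambda>x. x \<in> U) F"
    proof
      assume "eventually (\<lambda>x. x \<in> U) F"
      then have "eventually (\<lambda>x. False) F" using * by eventually_elim simp
      then show False using ultrafiltersD(1)[OF F] by (simp add: trivial_limit_def)
    qed
  next
    assume "\<not> eventually (\<lambda>x. x \<in> U) F"
    then have "eventually (\<lambda>x. x \<notin> U) F" by (rule ultrafiltersD(3)[OF F])
    then show "eventually (\<lambda>x. x \<in> X - U) F"
      using ultrafiltersD(2)[OF F] by eventually_elim simp
  qed
  have eq: "(\<lambda>U. U \<subseteq> X \<and> (\<forall>F\<in>ultrafilters X. eventually (\<lambda>x. x \<in> X - U) F \<longrightarrow> a F \<in> X - U)) = ?P"
    using ev a by blast
  have "istopology ?P"
    unfolding istopology_def
  proof (intro conjI allI impI)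
    fix S T assume ST: "?P S" "?P T"
    show "S \<inter> T \<subseteq> X" using ST by blast
    show "\<forall>F\<in>ultrafilters X. a F \<in> S \<inter> T \<longrightarrow> eventually (\<lambda>x. x \<in> S \<inter> T) F"
    proof (intro ballI impI)
      fix F assume "F \<in> ultrafilters X" "a F \<in> S \<inter> T"
      then have "eventually (\<lambda>x. x \<in> S) F" "eventually (\<lambda>x. x \<in> T) F" using ST by blast+
      then show "eventually (\<lambda>x. x \<in> S \<inter> T) F" by eventually_elim simp
    qed
  next
    fix K assume K: "\<forall>S\<in>K. ?P S"
    show "\<Union>K \<subseteq> X" using K by blast
    show "\<forall>F\<in>ultrafilters X. a F \<in> \<Union>K \<longrightarrow> eventually (\<lambda>x. x \<in> \<Union>K) F"
    proof (intro ballI impI)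
      fix F assume "F \<in> ultrafilters X" "a F \<in> \<Union>K"
      then obtain S where "S \<in> K" "eventually (\<lambda>x. x \<in> S) F" using K by blast
      then show "eventually (\<lambda>x. x \<in> \<Union>K) F" by (auto elim: eventually_mono)
    qed
  qed
  then show ?thesis unfolding uf_topology_def eq by simp
qed

context
  fixes X :: "'a set" and a
  assumes a: "\<And>F. F \<in> ultrafilters X \<Longrightarrow> a F \<in> X"
begin

lemma topspace_uf_topology: "topspace (uf_topology X a) = X"
proof
  show "topspace (uf_topology X a) \<subseteq> X"
    using openin_topspace[of "uf_topology X a"] openin_uf_topology[of X a, OF a] by blast
  have "openin (uf_topology X a) X"
    using openin_uf_topology[of X a, OF a] ultrafiltersD(2) by blast
  then show "X \<subseteq> topspace (uf_topology X a)" by (rule openin_subset)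
qed

lemma limitin_uf_topology:
  assumes F: "F \<in> ultrafilters X"
  shows "limitin (uf_topology X a) (\<lambda>x. x) (a F) F"
  unfolding limitin_def topspace_uf_topology using a[OF F] openin_uf_topology[of X a, OF a] F by blast

text \<open>If no finite subfamily covers, the complements generate a proper filter. An ultrafilter
  \<open>G\<close> refining it has \<open>a G\<close> in some open \<open>U\<close> of the cover, so
  \<open>G\<close> contains both \<open>U\<close> and its complement.\<close>

lemma compact_uf_topology: "compact_space (uf_topology X a)"
  unfolding compact_space_alt topspace_uf_topology
proof (intro allI impI)
  fix \<U> assume \<U>: "(\<forall>U\<in>\<U>. openin (uf_topology X a) U) \<and> X \<subseteq> \<Union>\<U>"
  show "\<exists>\<F>. finite \<F> \<and> \<F> \<subseteq> \<U> \<and> X \<subseteq> \<Union>\<F>"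
  proof (rule ccontr)
    assume n: "\<not> ?thesis"
    \<comment> \<open>The inserted empty set contributes \<open>X\<close> itself, which places
      \<open>G\<close> on \<open>X\<close> even when the cover is empty.\<close>
    let ?F = "INF U\<in>insert {} \<U>. principal (X - U)"
    have "?F \<noteq> bot"
    proof (rule INF_filter_not_bot)
      fix J assume J: "J \<subseteq> insert {} \<U>" "finite J"
      have "finite (J - {{}})" "J - {{}} \<subseteq> \<U>" using J by auto
      then have "\<not> X \<subseteq> \<Union>(J - {{}})" using n by blast
      then have "(\<Inter>U\<in>J. X - U) \<noteq> {}" by blast
      then show "(INF U\<in>J. principal (X - U)) \<noteq> bot"
        using J(2) by (simp add: INF_principal_finite principal_eq_bot_iff)
    qed
    then obtain G where G: "G \<le> ?F" "G \<noteq> bot" "\<And>P. eventually P G \<or> eventually (\<lambda>x. \<not> P x) G"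
      using ultrafilter_exists by blast
    have ev: "eventually (\<lambda>x. x \<in> X - U) G" if "U \<in> insert {} \<U>" for U
    proof -
      have "G \<le> principal (X - U)" using G(1) INF_lower[OF that, of "\<lambda>U. principal (X - U)"] by (rule order_trans)
      then show ?thesis by (simp add: le_principal)
    qed
    have GX: "G \<in> ultrafilters X" using G ev[of "{}"] by (simp add: ultrafilters_def)
    obtain U where U: "U \<in> \<U>" "a G \<in> U" using \<U> a[OF GX] by blast
    then have "eventually (\<lambda>x. x \<in> U) G" using \<U> openin_uf_topology[of X a, OF a] GX by blast
    then have "eventually (\<lambda>x. False) G" using ev[of U] U(1) by (auto elim: eventually_elim2)
    then show False using G(2) by (simp add: trivial_limit_def)
  qed
qed

end

text \<open>Without a limit, the open sets outside \<open>F\<close> cover the space, and a finite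
  subcover would make \<open>F\<close> improper.\<close>

lemma compact_space_ultrafilter_limit:
  assumes T: "compact_space T" and F: "F \<in> ultrafilters (topspace T)"
  obtains x where "limitin T (\<lambda>x. x) x F"
proof (rule ccontr)
  assume "\<not> thesis"
  then have nl: "\<not> limitin T (\<lambda>x. x) x F" for x using that by blast
  define \<U> where "\<U> = {U. openin T U \<and> \<not> eventually (\<lambda>x. x \<in> U) F}"
  have "topspace T \<subseteq> \<Union>\<U>"
    using nl unfolding limitin_def \<U>_def by blast
  moreover have "\<forall>U\<in>\<U>. openin T U" by (simp add: \<U>_def)
  ultimately obtain \<F> where \<F>: "finite \<F>" "\<F> \<subseteq> \<U>" "topspace T \<subseteq> \<Union>\<F>"
    using T unfolding compact_space_alt by metis
  have "\<forall>U\<in>\<F>. eventually (\<lambda>x. x \<notin> U) F"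
    using \<F>(2) ultrafiltersD(3)[OF F] by (auto simp: \<U>_def)
  then have "eventually (\<lambda>x. \<forall>U\<in>\<F>. x \<notin> U) F" using \<F>(1) by (simp add: eventually_ball_finite)
  then have "eventually (\<lambda>x. False) F"
    using ultrafiltersD(2)[OF F] by eventually_elim (use \<F>(3) in blast)
  then show False using ultrafiltersD(1)[OF F] by (simp add: trivial_limit_def)
qed

lemma unit_cch_simps [simp]:
  "ccarrier unit_cch = {0..1}" "ctop unit_cch = top_of_set {0..1}"
  "\<phi> \<in> Distr {0..1} \<Longrightarrow> cconv unit_cch \<phi> = measure_pmf.expectation \<phi> (\<lambda>x. x)"
  using expectation_finite[OF DistrD(1) subset_refl, of \<phi> "{0..1}" "\<lambda>x. x"]
  by (simp_all add: unit_cch_def mult.commute)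

lemma CCH_hom_unit_iff:
  "f \<in> CCH_hom X unit_cch \<longleftrightarrow> f \<in> cube (ccarrier X) \<and>
    (\<forall>\<phi>\<in>Distr (ccarrier X). f (cconv X \<phi>) = distr_to_Exp (ccarrier X) \<phi> f) \<and>
    continuous_map (ctop X) (top_of_set {0..1}) f"
proof -
  have "cconv unit_cch (map_pmf f \<phi>) = distr_to_Exp (ccarrier X) \<phi> f"
    if "f \<in> cube (ccarrier X)" "\<phi> \<in> Distr (ccarrier X)" for \<phi>
  proof -
    have "map_pmf f \<phi> \<in> Distr {0..1}" using that by (intro Distr_map) (auto simp: PiE_iff)
    then show ?thesis using distr_to_Exp_expectation[OF that(2,1)] by simp
  qed
  then show ?thesis unfolding CCH_hom_def by auto
qed

lemma CCH_hom_unitD: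
  assumes "f \<in> CCH_hom X unit_cch"
  shows "f \<in> cube (ccarrier X)"
    "\<phi> \<in> Distr (ccarrier X) \<Longrightarrow> f (cconv X \<phi>) = distr_to_Exp (ccarrier X) \<phi> f"
    "continuous_map (ctop X) (top_of_set {0..1}) f"
  using assms by (simp_all add: CCH_hom_unit_iff)

lemma CCH_hom_unit_limit:
  assumes f: "f \<in> CCH_hom X unit_cch" and F: "F \<in> ultrafilters (ccarrier X)"
    and l: "limitin (ctop X) (\<lambda>x. x) x F"
  shows "f x = uf_to_Exp (ccarrier X) F f"
proof -
  have "limitin (top_of_set {0..1}) (f \<circ> (\<lambda>x. x)) (f x) F"
    by (rule continuous_map_limit[OF CCH_hom_unitD(3)[OF f] l])
  then have "(f \<longlongrightarrow> f x) F" by (simp add: limitin_subtopology o_def)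
  then show ?thesis using uf_to_Exp_eq[OF F CCH_hom_unitD(1)[OF f]] by simp
qed

section \<open>The space underlying an algebra\<close>

context
  fixes A :: "'a ealg"
  assumes A: "A \<in> Alg"
begin

lemma astruct_uf: "F \<in> ultrafilters (acarrier A) \<Longrightarrow> astruct A (uf_to_Exp (acarrier A) F) \<in> acarrier A"
  using AlgD(1)[OF A uf_to_Exp_in] .

lemma astruct_distr: "\<phi> \<in> Distr (acarrier A) \<Longrightarrow> astruct A (distr_to_Exp (acarrier A) \<phi>) \<in> acarrier A"
  using AlgD(1)[OF A distr_to_Exp_in] .

lemma cch_of_alg_simps:
  "ccarrier (cch_of_alg A) = acarrier A"
  "\<phi> \<in> Distr (acarrier A) \<Longrightarrow> cconv (cch_of_alg A) \<phi> = astruct A (distr_to_Exp (acarrier A) \<phi>)"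
  "ctop (cch_of_alg A) = uf_topology (acarrier A) (\<lambda>F. astruct A (uf_to_Exp (acarrier A) F))"
  by (simp_all add: cch_of_alg_def)

lemma openin_ctop: "openin (ctop (cch_of_alg A)) U \<longleftrightarrow> U \<subseteq> acarrier A \<and>
    (\<forall>F\<in>ultrafilters (acarrier A). astruct A (uf_to_Exp (acarrier A) F) \<in> U \<longrightarrow> eventually (\<lambda>x. x \<in> U) F)"
  unfolding cch_of_alg_simps by (rule openin_uf_topology) (rule astruct_uf)

lemma topspace_ctop: "topspace (ctop (cch_of_alg A)) = acarrier A"
  unfolding cch_of_alg_simps by (rule topspace_uf_topology) (rule astruct_uf)

lemma limitin_ctop: "F \<in> ultrafilters (acarrier A) \<Longrightarrow>
    limitin (ctop (cch_of_alg A)) (\<lambda>x. x) (astruct A (uf_to_Exp (acarrier A) F)) F"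
  unfolding cch_of_alg_simps by (rule limitin_uf_topology) (rule astruct_uf)

lemma CCH_hom_eq_Alg_hom_unit: "CCH_hom (cch_of_alg A) unit_cch = Alg_hom A unit_alg"
proof
  show "CCH_hom (cch_of_alg A) unit_cch \<subseteq> Alg_hom A unit_alg"
  proof
    fix f assume f: "f \<in> CCH_hom (cch_of_alg A) unit_cch"
    note D = CCH_hom_unitD[OF f, unfolded cch_of_alg_simps(1)]
    show "f \<in> Alg_hom A unit_alg"
    proof (rule affine_continuous_Alg_hom[OF A D(1)])
      show "f (astruct A (distr_to_Exp (acarrier A) \<phi>)) = distr_to_Exp (acarrier A) \<phi> f"
        if "\<phi> \<in> Distr (acarrier A)" for \<phi>
        using D(2)[OF that] cch_of_alg_simps(2)[OF that] by simp
      show "f (astruct A (uf_to_Exp (acarrier A) F)) = uf_to_Exp (acarrier A) F f"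
        if "F \<in> ultrafilters (acarrier A)" for F
        using CCH_hom_unit_limit[OF f _ limitin_ctop[OF that]] that by (simp add: cch_of_alg_simps(1))
    qed
  qed
  show "Alg_hom A unit_alg \<subseteq> CCH_hom (cch_of_alg A) unit_cch"
  proof
    fix f assume f: "f \<in> Alg_hom A unit_alg"
    note D = Alg_hom_unitD[OF f]
    have "continuous_map (ctop (cch_of_alg A)) (top_of_set {0..1}) f"
      unfolding continuous_map_def topspace_ctop
    proof (intro conjI allI impI)
      show "f \<in> acarrier A \<rightarrow> topspace (top_of_set {0..1})" using D(1) by (auto simp: PiE_iff)
      fix V assume "openin (top_of_set {0..1::real}) V"
      then obtain W where W: "open W" "V = {0..1} \<inter> W" by (auto simp: openin_open)
      have "eventually (\<lambda>x. x \<in> {x \<in> acarrier A. f x \<in> V}) F"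
        if F: "F \<in> ultrafilters (acarrier A)" and aF: "f (astruct A (uf_to_Exp (acarrier A) F)) \<in> V" for F
      proof -
        have "(f \<longlongrightarrow> f (astruct A (uf_to_Exp (acarrier A) F))) F"
          using uf_to_Exp_tendsto[OF F D(1)] D(2)[OF uf_to_Exp_in[OF F]] by simp
        then have "eventually (\<lambda>x. f x \<in> W) F" using W aF by (auto dest: topological_tendstoD)
        then show ?thesis
          using ultrafiltersD(2)[OF F] by eventually_elim (use W(2) D(1) in \<open>auto simp: PiE_iff\<close>)
      qed
      then show "openin (ctop (cch_of_alg A)) {x \<in> acarrier A. f x \<in> V}"
        unfolding openin_ctop by blast
    qed
    then show "f \<in> CCH_hom (cch_of_alg A) unit_cch"
      unfolding CCH_hom_unit_iff cch_of_alg_simps(1)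
      using D(1) D(2)[OF distr_to_Exp_in] by (simp add: cch_of_alg_simps(2))
  qed
qed

lemma observable_iff: "observable (cch_of_alg A) \<longleftrightarrow>
    (\<forall>x\<in>acarrier A. \<forall>y\<in>acarrier A. (\<forall>g\<in>Alg_hom A unit_alg. g x = g y) \<longrightarrow> x = y)"
  unfolding observable_def CCH_hom_eq_Alg_hom_unit cch_of_alg_simps(1) by blast

end

lemma Alg_obsD:
  assumes "A \<in> Alg_obs"
  shows "A \<in> Alg"
    and "\<lbrakk>x \<in> acarrier A; y \<in> acarrier A; \<And>g. g \<in> Alg_hom A unit_alg \<Longrightarrow> g x = g y\<rbrakk> \<Longrightarrow> x = y"
  using assms observable_iff[of A] by (auto simp: Alg_obs_def)

lemma Alg_obsI:
  assumes "A \<in> Alg"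
    and "\<And>x y. \<lbrakk>x \<in> acarrier A; y \<in> acarrier A; \<And>g. g \<in> Alg_hom A unit_alg \<Longrightarrow> g x = g y\<rbrakk> \<Longrightarrow> x = y"
  shows "A \<in> Alg_obs"
  using assms observable_iff[of A] by (auto simp: Alg_obs_def)

lemma alg_of_emod_Alg_obs:
  assumes "M \<in> EMod"
  shows "alg_of_emod M \<in> Alg_obs"
proof -
  interpret emodule M using assms by (simp add: emodule_iff)
  show ?thesis
  proof (rule Alg_obsI[OF alg_of_emod_Alg])
    fix k l assume k: "k \<in> acarrier (alg_of_emod M)" and l: "l \<in> acarrier (alg_of_emod M)"
      and eq: "\<And>g. g \<in> Alg_hom (alg_of_emod M) unit_alg \<Longrightarrow> g k = g l"
    have kl: "k \<in> states M" "l \<in> states M" using k l by simp_all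
    have "k y = l y" if "y \<in> ecarrier M" for y
      using eq[OF hat_hom[OF that]] kl by (simp add: hat_def)
    then show "k = l" by (rule extensionalityI[OF stateD(4)[OF kl(1)] stateD(4)[OF kl(2)]])
  qed
qed

lemma Hausdorff_of_separating:
  assumes f: "\<And>x y. \<lbrakk>x \<in> topspace T; y \<in> topspace T; x \<noteq> y\<rbrakk> \<Longrightarrow>
      \<exists>f. continuous_map T (top_of_set {0..1::real}) f \<and> f x \<noteq> f y"
  shows "Hausdorff_space T"
  unfolding Hausdorff_space_def
proof (intro allI impI)
  fix x y assume xy: "x \<in> topspace T \<and> y \<in> topspace T \<and> x \<noteq> y"
  then obtain f where c: "continuous_map T (top_of_set {0..1::real}) f" and ne: "f x \<noteq> f y"
    using f by blast
  obtain U V where UV: "open U" "open V" "f x \<in> U" "f y \<in> V" "U \<inter> V = {}"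
    using hausdorff[OF ne] by blast
  have c': "continuous_map T euclidean f" using c continuous_map_in_subtopology by blast
  show "\<exists>U V. openin T U \<and> openin T V \<and> x \<in> U \<and> y \<in> V \<and> disjnt U V"
    by (rule exI[of _ "{z \<in> topspace T. f z \<in> U}"], rule exI[of _ "{z \<in> topspace T. f z \<in> V}"])
      (use UV xy openin_continuous_map_preimage[OF c'] in \<open>auto simp: disjnt_def\<close>)
qed

text \<open>Algebra maps into the interval separate points and turn the convex structure into
  expectation, so the convexity laws reduce to those of expectations. The same maps, being
  continuous, give the Hausdorff property.\<close>

lemma cch_of_alg_CCH_obs:
  assumes A: "A \<in> Alg_obs"
  shows "cch_of_alg A \<in> CCH_obs"
proof -
  let ?X = "acarrier A" and ?c = "cconv (cch_of_alg A)"
  note AA = Alg_obsD(1)[OF A]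
  have c: "?c \<phi> = astruct A (distr_to_Exp ?X \<phi>)" if "\<phi> \<in> Distr ?X" for \<phi>
    by (rule cch_of_alg_simps(2)[OF AA that])
  have cX: "?c \<phi> \<in> ?X" if "\<phi> \<in> Distr ?X" for \<phi>
    unfolding c[OF that] by (rule astruct_distr[OF AA that])
  have ce: "?c \<in> extensional (Distr ?X)" by (simp add: cch_of_alg_def)
  have gc: "g (?c \<phi>) = measure_pmf.expectation \<phi> g" if "g \<in> Alg_hom A unit_alg" "\<phi> \<in> Distr ?X" for g \<phi>
    using Alg_hom_unitD(2)[OF that(1) distr_to_Exp_in[OF that(2)]] c[OF that(2)]
      distr_to_Exp_expectation[OF that(2) Alg_hom_unitD(1)[OF that(1)]] by simp
  have "convex_structure ?X ?c"
    unfolding convex_structure_def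
  proof (intro conjI ballI)
    show "?c \<in> Distr ?X \<rightarrow>\<^sub>E ?X" using cX ce by (simp add: PiE_iff)
    fix x assume x: "x \<in> ?X"
    have d: "return_pmf x \<in> Distr ?X" using x by (simp add: Distr_def)
    have "g (?c (return_pmf x)) = g x" if "g \<in> Alg_hom A unit_alg" for g
      unfolding gc[OF that d] by simp
    then show "?c (return_pmf x) = x" using Alg_obsD(2)[OF A cX[OF d] x] by blast
  next
    fix \<Phi> assume \<Phi>: "\<Phi> \<in> Distr (Distr ?X)"
    have j: "join_pmf \<Phi> \<in> Distr ?X" by (rule Distr_join[OF \<Phi>])
    have m: "map_pmf ?c \<Phi> \<in> Distr ?X" using cX by (intro Distr_map[OF \<Phi>]) blast
    have "g (?c (join_pmf \<Phi>)) = g (?c (map_pmf ?c \<Phi>))" if g: "g \<in> Alg_hom A unit_alg" for g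
    proof -
      have "measure_pmf.expectation \<Phi> (\<lambda>\<phi>. measure_pmf.expectation \<phi> g) = measure_pmf.expectation \<Phi> (\<lambda>\<phi>. g (?c \<phi>))"
        using DistrD(2)[OF \<Phi>] gc[OF g] by (intro integral_cong_AE) (auto simp: AE_measure_pmf_iff)
      then show ?thesis
        unfolding gc[OF g j] gc[OF g m] expectation_join[OF \<Phi>] by simp
    qed
    then show "?c (join_pmf \<Phi>) = ?c (map_pmf ?c \<Phi>)" using Alg_obsD(2)[OF A cX[OF j] cX[OF m]] by blast
  qed
  moreover have "compact_space (ctop (cch_of_alg A))"
    unfolding cch_of_alg_simps[OF AA] by (rule compact_uf_topology) (rule astruct_uf[OF AA])
  moreover have "Hausdorff_space (ctop (cch_of_alg A))"
  proof (rule Hausdorff_of_separating, unfold topspace_ctop[OF AA])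
    fix x y assume xy: "x \<in> ?X" "y \<in> ?X" "x \<noteq> y"
    then obtain g where "g \<in> Alg_hom A unit_alg" "g x \<noteq> g y" using Alg_obsD(2)[OF A] by blast
    then show "\<exists>f. continuous_map (ctop (cch_of_alg A)) (top_of_set {0..1::real}) f \<and> f x \<noteq> f y"
      using CCH_hom_unitD(3) CCH_hom_eq_Alg_hom_unit[OF AA] by blast
  qed
  ultimately show ?thesis
    using A topspace_ctop[OF AA] by (simp add: CCH_obs_def CCH_def Alg_obs_def cch_of_alg_simps(1)[OF AA])
qed

text \<open>An algebra map is affine and continuous by naturality of the two embeddings
  (\<open>Exp_map_distr\<close>, \<open>Exp_map_uf\<close>). Conversely, an affine continuous
  \<open>f\<close> followed by an algebra map \<open>g\<close> into the interval is an algebra map,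
  and observability of \<open>B\<close> removes \<open>g\<close>.\<close>

lemma Alg_hom_eq_CCH_hom:
  assumes A: "A \<in> Alg_obs" and B: "B \<in> Alg_obs"
  shows "Alg_hom A B = CCH_hom (cch_of_alg A) (cch_of_alg B)"
proof
  let ?X = "acarrier A" and ?Y = "acarrier B"
  note AA = Alg_obsD(1)[OF A] and BB = Alg_obsD(1)[OF B]
  show "Alg_hom A B \<subseteq> CCH_hom (cch_of_alg A) (cch_of_alg B)"
  proof
    fix f assume f: "f \<in> Alg_hom A B"
    note D = Alg_homD[OF f]
    have aff: "f (cconv (cch_of_alg A) \<phi>) = cconv (cch_of_alg B) (map_pmf f \<phi>)" if \<phi>: "\<phi> \<in> Distr ?X" for \<phi>
      using D(4)[OF distr_to_Exp_in[OF \<phi>]] Exp_map_distr[OF \<phi> D(1)]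
        cch_of_alg_simps(2)[OF AA \<phi>] cch_of_alg_simps(2)[OF BB Distr_map[OF \<phi> D(1)]] by simp
    have "continuous_map (ctop (cch_of_alg A)) (ctop (cch_of_alg B)) f"
      unfolding continuous_map_def topspace_ctop[OF AA] topspace_ctop[OF BB]
    proof (intro conjI allI impI D(1))
      fix V assume V: "openin (ctop (cch_of_alg B)) V"
      have "eventually (\<lambda>x. x \<in> {x \<in> ?X. f x \<in> V}) F"
        if F: "F \<in> ultrafilters ?X" and aF: "f (astruct A (uf_to_Exp ?X F)) \<in> V" for F
      proof -
        have "f (astruct A (uf_to_Exp ?X F)) = astruct B (uf_to_Exp ?Y (filtermap f F))"
          using D(4)[OF uf_to_Exp_in[OF F]] Exp_map_uf[OF F D(1)] by simp
        then have "eventually (\<lambda>y. y \<in> V) (filtermap f F)"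
          using V aF ultrafilters_filtermap[OF F D(1)] unfolding openin_ctop[OF BB] by simp
        then have "eventually (\<lambda>x. f x \<in> V) F" by (simp add: eventually_filtermap)
        then show ?thesis using ultrafiltersD(2)[OF F] by eventually_elim simp
      qed
      then show "openin (ctop (cch_of_alg A)) {x \<in> ?X. f x \<in> V}"
        unfolding openin_ctop[OF AA] by blast
    qed
    then show "f \<in> CCH_hom (cch_of_alg A) (cch_of_alg B)"
      using aff D(2,3) by (simp add: CCH_hom_def cch_of_alg_simps(1)[OF AA] cch_of_alg_simps(1)[OF BB] PiE_iff)
  qed
  show "CCH_hom (cch_of_alg A) (cch_of_alg B) \<subseteq> Alg_hom A B"
  proof
    fix f assume f: "f \<in> CCH_hom (cch_of_alg A) (cch_of_alg B)"
    have fP: "f \<in> ?X \<rightarrow>\<^sub>E ?Y" and fc: "continuous_map (ctop (cch_of_alg A)) (ctop (cch_of_alg B)) f"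
      and fa: "\<And>\<phi>. \<phi> \<in> Distr ?X \<Longrightarrow> f (cconv (cch_of_alg A) \<phi>) = cconv (cch_of_alg B) (map_pmf f \<phi>)"
      using f by (simp_all add: CCH_hom_def cch_of_alg_simps(1)[OF AA] cch_of_alg_simps(1)[OF BB])
    have fX: "f \<in> ?X \<rightarrow> ?Y" using fP by (auto simp: PiE_iff)
    have comp: "compose ?X g f \<in> Alg_hom A unit_alg" if g: "g \<in> Alg_hom B unit_alg" for g
    proof -
      have gC: "g \<in> CCH_hom (cch_of_alg B) unit_cch" using g CCH_hom_eq_Alg_hom_unit[OF BB] by simp
      note gD = CCH_hom_unitD[OF gC, unfolded cch_of_alg_simps(1)[OF BB]]
      have "compose ?X g f \<in> CCH_hom (cch_of_alg A) unit_cch"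
        unfolding CCH_hom_unit_iff cch_of_alg_simps(1)[OF AA]
      proof (intro conjI ballI)
        show "compose ?X g f \<in> cube ?X" by (rule compose_cube[OF fX gD(1)])
        fix \<phi> assume \<phi>: "\<phi> \<in> Distr ?X"
        have "g (f (cconv (cch_of_alg A) \<phi>)) = distr_to_Exp ?Y (map_pmf f \<phi>) g"
          using fa[OF \<phi>] gD(2)[OF Distr_map[OF \<phi> fX]] by simp
        also have "\<dots> = distr_to_Exp ?X \<phi> (compose ?X g f)"
          unfolding Exp_map_distr[OF \<phi> fX, symmetric] using gD(1) by (simp add: Exp_map_def)
        finally show "compose ?X g f (cconv (cch_of_alg A) \<phi>) = distr_to_Exp ?X \<phi> (compose ?X g f)"
          using astruct_distr[OF AA \<phi>] cch_of_alg_simps(2)[OF AA \<phi>] by (simp add: compose_def)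
      next
        have "continuous_map (ctop (cch_of_alg A)) (top_of_set {0..1}) (g \<circ> f)"
          by (rule continuous_map_compose[OF fc gD(3)])
        then show "continuous_map (ctop (cch_of_alg A)) (top_of_set {0..1}) (compose ?X g f)"
          by (rule continuous_map_eq) (simp add: topspace_ctop[OF AA] compose_def)
      qed
      then show ?thesis using CCH_hom_eq_Alg_hom_unit[OF AA] by simp
    qed
    show "f \<in> Alg_hom A B"
      unfolding Alg_hom_def mem_Collect_eq
    proof (intro conjI fP ballI)
      fix h assume h: "h \<in> Exp ?X"
      have E: "Exp_map ?X ?Y f h \<in> Exp ?Y" by (rule Exp_map_in[OF h fX])
      have x: "astruct A h \<in> ?X" by (rule AlgD(1)[OF AA h])
      have "g (f (astruct A h)) = g (astruct B (Exp_map ?X ?Y f h))" if g: "g \<in> Alg_hom B unit_alg" for g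
        using Alg_hom_unitD(2)[OF comp[OF g] h] Alg_hom_unitD(2)[OF g E] Alg_hom_unitD(1)[OF g] x
        by (simp add: compose_def Exp_map_def)
      then show "f (astruct A h) = astruct B (Exp_map ?X ?Y f h)"
        using Alg_obsD(2)[OF B _ AlgD(1)[OF BB E]] fX x by blast
    qed
  qed
qed

text \<open>The space determines the algebra maps \<open>g\<close> into the interval, and these
  determine the structure map through \<open>g (\<alpha> h) = h g\<close>.\<close>

lemma inj_cch_of_alg: "inj_on cch_of_alg (Alg_obs :: 'a ealg set)"
proof (rule inj_onI)
  fix A B :: "'a ealg"
  assume A: "A \<in> Alg_obs" and B: "B \<in> Alg_obs" and eq: "cch_of_alg A = cch_of_alg B"
  note AA = Alg_obsD(1)[OF A] and BB = Alg_obsD(1)[OF B]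
  have car: "acarrier A = acarrier B"
    using eq cch_of_alg_simps(1)[OF AA] cch_of_alg_simps(1)[OF BB] by simp
  have hom: "Alg_hom A unit_alg = Alg_hom B unit_alg"
    using eq CCH_hom_eq_Alg_hom_unit[OF AA] CCH_hom_eq_Alg_hom_unit[OF BB] by simp
  have "astruct A = astruct B"
  proof (rule extensionalityI[OF AlgD(2)[OF AA]])
    show "astruct B \<in> extensional (Exp (acarrier A))" using AlgD(2)[OF BB] car by simp
    fix h assume h: "h \<in> Exp (acarrier A)"
    then have hB: "h \<in> Exp (acarrier B)" using car by simp
    have "g (astruct A h) = g (astruct B h)" if "g \<in> Alg_hom A unit_alg" for g
      using Alg_hom_unitD(2)[OF that h] Alg_hom_unitD(2)[OF that[unfolded hom] hB] by simp
    then show "astruct A h = astruct B h"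
      using Alg_obsD(2)[OF A AlgD(1)[OF AA h]] AlgD(1)[OF BB hB] car by blast
  qed
  then show "A = B" using car by simp
qed

section \<open>Barycenters and the algebra of an observable space\<close>

lemma barycenter_exists:
  assumes X: "X \<in> CCH" and h: "h \<in> Exp (ccarrier X)"
  shows "\<exists>x\<in>ccarrier X. \<forall>f\<in>CCH_hom X unit_cch. f x = h f"
proof -
  let ?X = "ccarrier X"
  have ts: "topspace (ctop X) = ?X" and comp: "compact_space (ctop X)"
    and cX: "cconv X \<in> Distr ?X \<rightarrow> ?X"
    using X by (auto simp: CCH_def convex_structure_def)
  obtain G where G: "G \<in> ultrafilters (Distr ?X)"
    and lim: "\<And>p. p \<in> cube ?X \<Longrightarrow> ((\<lambda>\<phi>. distr_to_Exp ?X \<phi> p) \<longlongrightarrow> h p) G"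
    using Exp_ultrafilter_limit[OF h] by blast
  define F where "F = filtermap (cconv X) G"
  have F: "F \<in> ultrafilters ?X" unfolding F_def by (rule ultrafilters_filtermap[OF G cX])
  obtain x where x: "limitin (ctop X) (\<lambda>x. x) x F"
    using compact_space_ultrafilter_limit[OF comp] F ts by metis
  have "f x = h f" if f: "f \<in> CCH_hom X unit_cch" for f
  proof -
    have "((\<lambda>\<phi>. f (cconv X \<phi>)) \<longlongrightarrow> h f) G"
      by (rule tendsto_cong_ultra[OF G CCH_hom_unitD(2)[OF f, symmetric] lim[OF CCH_hom_unitD(1)[OF f]]])
    then have "(f \<longlongrightarrow> h f) F" by (simp add: F_def filterlim_filtermap)
    then show ?thesis
      using CCH_hom_unit_limit[OF f F x] uf_to_Exp_eq[OF F CCH_hom_unitD(1)[OF f]] by simp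
  qed
  then show ?thesis using limitin_topspace[OF x] ts by blast
qed

text \<open>Observability makes the barycenter unique, so the choice in the structure map is
  harmless. Each algebra law is tested by affine continuous \<open>f\<close>, for which
  \<open>f\<close> after the structure map is evaluation at \<open>f\<close>.\<close>

lemma cch_of_alg_surj:
  fixes X :: "'a cch"
  assumes X: "X \<in> CCH_obs"
  shows "\<exists>A\<in>Alg_obs. cch_of_alg A = X"
proof -
  let ?X = "ccarrier X" and ?H = "CCH_hom X unit_cch"
  have XC: "X \<in> CCH" and obs: "observable X" using X by (simp_all add: CCH_obs_def)
  have ts: "topspace (ctop X) = ?X" and cX: "cconv X \<in> Distr ?X \<rightarrow>\<^sub>E ?X"
    using XC by (simp_all add: CCH_def convex_structure_def)
  have sep: "x = y" if "x \<in> ?X" "y \<in> ?X" "\<And>f. f \<in> ?H \<Longrightarrow> f x = f y" for x y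
    using obs that unfolding observable_def by blast
  define A where "A = \<lparr>acarrier = ?X, astruct = (\<lambda>h\<in>Exp ?X. SOME x. x \<in> ?X \<and> (\<forall>f\<in>?H. f x = h f))\<rparr>"
  have AX [simp]: "acarrier A = ?X" by (simp add: A_def)
  have st: "astruct A h \<in> ?X" "\<And>f. f \<in> ?H \<Longrightarrow> f (astruct A h) = h f" if "h \<in> Exp ?X" for h
    using someI_ex[of "\<lambda>x. x \<in> ?X \<and> (\<forall>f\<in>?H. f x = h f)"] barycenter_exists[OF XC that] that
    by (auto simp: A_def)
  have stX: "astruct A \<in> Exp ?X \<rightarrow> ?X" using st(1) by blast
  have AA: "A \<in> Alg"
    unfolding Alg_def mem_Collect_eq AX
  proof (intro conjI ballI)
    have "astruct A \<in> extensional (Exp ?X)" by (simp add: A_def)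
    with stX show "astruct A \<in> Exp ?X \<rightarrow>\<^sub>E ?X" unfolding PiE_def by (rule IntI)
    fix x assume x: "x \<in> ?X"
    have "f (astruct A (Exp_unit ?X x)) = f x" if "f \<in> ?H" for f
      using st(2)[OF Exp_unit_in[OF x] that] CCH_hom_unitD(1)[OF that] by (simp add: Exp_unit_def)
    then show "astruct A (Exp_unit ?X x) = x" using sep[OF st(1)[OF Exp_unit_in[OF x]] x] by blast
  next
    fix K assume K: "K \<in> Exp (Exp ?X)"
    have m: "Exp_mult ?X K \<in> Exp ?X" by (rule Exp_mult_in[OF K])
    have e: "Exp_map (Exp ?X) ?X (astruct A) K \<in> Exp ?X" by (rule Exp_map_in[OF K stX])
    have "f (astruct A (Exp_mult ?X K)) = f (astruct A (Exp_map (Exp ?X) ?X (astruct A) K))" if f: "f \<in> ?H" for f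
    proof -
      have "compose (Exp ?X) f (astruct A) = (\<lambda>k\<in>Exp ?X. k f)"
        unfolding compose_def using st(2)[OF _ f] by (intro restrict_ext)
      then show ?thesis
        unfolding st(2)[OF m f] st(2)[OF e f]
        using CCH_hom_unitD(1)[OF f] by (simp add: Exp_mult_apply Exp_map_def)
    qed
    then show "astruct A (Exp_mult ?X K) = astruct A (Exp_map (Exp ?X) ?X (astruct A) K)"
      using sep[OF st(1)[OF m] st(1)[OF e]] by blast
  qed
  \<comment> \<open>Limits in the given topology coincide with those computed by the algebra, since
    every affine continuous function takes the same value at both points.\<close>
  have limX: "astruct A (uf_to_Exp ?X F) = x"
    if F: "F \<in> ultrafilters ?X" and l: "limitin (ctop X) (\<lambda>x. x) x F" for F x
  proof (rule sep[OF st(1)[OF uf_to_Exp_in[OF F]]])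
    show "x \<in> ?X" using limitin_topspace[OF l] ts by simp
    show "f (astruct A (uf_to_Exp ?X F)) = f x" if "f \<in> ?H" for f
      using st(2)[OF uf_to_Exp_in[OF F] that] CCH_hom_unit_limit[OF that F l] by simp
  qed
  have "openin (ctop (cch_of_alg A)) U \<longleftrightarrow> openin (ctop X) U" for U
  proof
    assume U: "openin (ctop X) U"
    have "eventually (\<lambda>x. x \<in> U) F" if F: "F \<in> ultrafilters ?X" and aF: "astruct A (uf_to_Exp ?X F) \<in> U" for F
    proof -
      have "compact_space (ctop X)" using XC by (simp add: CCH_def)
      then obtain x where x: "limitin (ctop X) (\<lambda>x. x) x F"
        using compact_space_ultrafilter_limit F ts by metis
      then show ?thesis using aF U limX[OF F x] unfolding limitin_def by simp
    qed
    then show "openin (ctop (cch_of_alg A)) U"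
      unfolding openin_ctop[OF AA] AX using openin_subset[OF U] ts by blast
  next
    assume U: "openin (ctop (cch_of_alg A)) U"
    show "openin (ctop X) U"
    proof (subst openin_subopen, intro ballI)
      fix x assume x: "x \<in> U"
      have UX: "U \<subseteq> ?X" using U unfolding openin_ctop[OF AA] by simp
      show "\<exists>S. openin (ctop X) S \<and> x \<in> S \<and> S \<subseteq> U"
      proof (rule ccontr)
        assume n: "\<not> ?thesis"
        \<comment> \<open>If \<open>U\<close> were no neighbourhood of \<open>x\<close>, some
          ultrafilter would converge to \<open>x\<close> while staying outside \<open>U\<close>; by
          \<open>limX\<close> its algebra limit is \<open>x\<close>, contradicting openness of
          \<open>U\<close> for the algebra.\<close>
        let ?F = "inf (nhdsin (ctop X) x) (principal (?X - U))"
        have xt: "x \<in> topspace (ctop X)" using x UX ts by blast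
        have "?F \<noteq> bot"
        proof
          assume "?F = bot"
          then obtain S where S: "openin (ctop X) S" "x \<in> S" "\<forall>z\<in>S. z \<notin> ?X - U"
            using xt unfolding trivial_limit_def eventually_inf_principal eventually_nhdsin by blast
          then have "S \<subseteq> U" using openin_subset[OF S(1)] ts by blast
          then show False using n S by blast
        qed
        then obtain G where G: "G \<le> ?F" "G \<noteq> bot" "\<And>P. eventually P G \<or> eventually (\<lambda>x. \<not> P x) G"
          using ultrafilter_exists by blast
        have ev: "eventually (\<lambda>z. z \<in> ?X - U) G"
          using G(1) by (simp add: le_principal)
        then have GX: "G \<in> ultrafilters ?X"
          using G by (auto simp: ultrafilters_def elim: eventually_mono)
        have "limitin (ctop X) (\<lambda>x. x) x G"
          unfolding limitin_def
        proof (intro conjI allI impI xt)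
          fix V assume "openin (ctop X) V \<and> x \<in> V"
          then have "eventually (\<lambda>z. z \<in> V) (nhdsin (ctop X) x)" unfolding eventually_nhdsin by blast
          then show "eventually (\<lambda>z. z \<in> V) G" using G(1) filter_leD[of G "nhdsin (ctop X) x"] by simp
        qed
        then have "astruct A (uf_to_Exp ?X G) \<in> U" using limX[OF GX] x by simp
        then have "eventually (\<lambda>z. z \<in> U) G" using U GX unfolding openin_ctop[OF AA] by simp
        then have "eventually (\<lambda>z. False) G" using ev by eventually_elim simp
        then show False using G(2) by (simp add: trivial_limit_def)
      qed
    qed
  qed
  then have top: "ctop (cch_of_alg A) = ctop X" by (simp add: topology_eq)
  have conv: "cconv (cch_of_alg A) = cconv X"
  proof (rule extensionalityI[of _ "Distr ?X"])
    show "cconv (cch_of_alg A) \<in> extensional (Distr ?X)" by (simp add: cch_of_alg_def)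
    show "cconv X \<in> extensional (Distr ?X)" using cX by (simp add: PiE_iff)
    fix \<phi> assume \<phi>: "\<phi> \<in> Distr ?X"
    have "f (astruct A (distr_to_Exp ?X \<phi>)) = f (cconv X \<phi>)" if "f \<in> ?H" for f
      using st(2)[OF distr_to_Exp_in[OF \<phi>] that] CCH_hom_unitD(2)[OF that \<phi>] by simp
    then have "astruct A (distr_to_Exp ?X \<phi>) = cconv X \<phi>"
      using sep[OF st(1)[OF distr_to_Exp_in[OF \<phi>]]] cX \<phi> by (auto simp: PiE_iff)
    then show "cconv (cch_of_alg A) \<phi> = cconv X \<phi>"
      using cch_of_alg_simps(2)[OF AA, of \<phi>] \<phi> by simp
  qed
  have eq: "cch_of_alg A = X"
    using top conv cch_of_alg_simps(1)[OF AA] by simp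
  then have "A \<in> Alg_obs" using AA obs by (simp add: Alg_obs_def)
  then show ?thesis using eq by blast
qed

lemma bij_cch_of_alg: "bij_betw cch_of_alg (Alg_obs :: 'a ealg set) (CCH_obs :: 'a cch set)"
proof (rule bij_betw_imageI[OF inj_cch_of_alg])
  show "cch_of_alg ` Alg_obs = (CCH_obs :: 'a cch set)"
    using cch_of_alg_CCH_obs cch_of_alg_surj by blast
qed

text \<open>Distinct type variables let maps connect objects whose carriers lie in different
  types.\<close>

theorem theorem6:
  shows
    \<comment> \<open>the functor from algebras to the opposite of effect modules\<close>
    "(\<forall>A\<in>(Alg :: 'a ealg set). emod_of_alg A \<in> EMod) \<and>
     (\<forall>A\<in>(Alg :: 'a ealg set). \<forall>B\<in>(Alg :: 'b ealg set). \<forall>f\<in>Alg_hom A B.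
        emod_of_alg_map A B f \<in> EMod_hom (emod_of_alg B) (emod_of_alg A)) \<and>
     (\<forall>A\<in>(Alg :: 'a ealg set).
        emod_of_alg_map A A (\<lambda>x\<in>acarrier A. x) = (\<lambda>g\<in>ecarrier (emod_of_alg A). g)) \<and>
     (\<forall>A\<in>(Alg :: 'a ealg set). \<forall>B\<in>(Alg :: 'b ealg set). \<forall>C\<in>(Alg :: 'c ealg set).
        \<forall>f\<in>Alg_hom A B. \<forall>g\<in>Alg_hom B C.
        emod_of_alg_map A C (compose (acarrier A) g f) =
        compose (ecarrier (emod_of_alg C)) (emod_of_alg_map A B f) (emod_of_alg_map B C g)) \<and>

     \<comment> \<open>the functor from the opposite of effect modules to algebras\<close>
     (\<forall>M\<in>(EMod :: 'd emod set). alg_of_emod M \<in> Alg) \<and>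
     (\<forall>M\<in>(EMod :: 'd emod set). \<forall>N\<in>(EMod :: 'e emod set). \<forall>f\<in>EMod_hom M N.
        alg_of_emod_map M N f \<in> Alg_hom (alg_of_emod N) (alg_of_emod M)) \<and>
     (\<forall>M\<in>(EMod :: 'd emod set).
        alg_of_emod_map M M (\<lambda>y\<in>ecarrier M. y) = (\<lambda>k\<in>acarrier (alg_of_emod M). k)) \<and>
     (\<forall>M\<in>(EMod :: 'd emod set). \<forall>N\<in>(EMod :: 'e emod set). \<forall>P\<in>(EMod :: 'f emod set).
        \<forall>f\<in>EMod_hom M N. \<forall>g\<in>EMod_hom N P.
        alg_of_emod_map M P (compose (ecarrier M) g f) =
        compose (acarrier (alg_of_emod P)) (alg_of_emod_map M N f) (alg_of_emod_map N P g)) \<and>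

     \<comment> \<open>the unit is a natural transformation\<close>
     (\<forall>A\<in>(Alg :: 'a ealg set). adj_unit A \<in> Alg_hom A (alg_of_emod (emod_of_alg A))) \<and>
     (\<forall>A\<in>(Alg :: 'a ealg set). \<forall>B\<in>(Alg :: 'b ealg set). \<forall>f\<in>Alg_hom A B.
        compose (acarrier A) (adj_unit B) f =
        compose (acarrier A)
          (alg_of_emod_map (emod_of_alg B) (emod_of_alg A) (emod_of_alg_map A B f)) (adj_unit A)) \<and>

     \<comment> \<open>the counit is a natural transformation\<close>
     (\<forall>M\<in>(EMod :: 'd emod set). adj_counit M \<in> EMod_hom M (emod_of_alg (alg_of_emod M))) \<and>
     (\<forall>M\<in>(EMod :: 'd emod set). \<forall>N\<in>(EMod :: 'e emod set). \<forall>f\<in>EMod_hom M N.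
        compose (ecarrier M) (adj_counit N) f =
        compose (ecarrier M)
          (emod_of_alg_map (alg_of_emod N) (alg_of_emod M) (alg_of_emod_map M N f)) (adj_counit M)) \<and>

     \<comment> \<open>the triangle identities\<close>
     (\<forall>A\<in>(Alg :: 'a ealg set).
        compose (ecarrier (emod_of_alg A))
          (emod_of_alg_map A (alg_of_emod (emod_of_alg A)) (adj_unit A)) (adj_counit (emod_of_alg A)) =
        (\<lambda>g\<in>ecarrier (emod_of_alg A). g)) \<and>
     (\<forall>M\<in>(EMod :: 'd emod set).
        compose (acarrier (alg_of_emod M))
          (alg_of_emod_map M (emod_of_alg (alg_of_emod M)) (adj_counit M)) (adj_unit (alg_of_emod M)) =
        (\<lambda>k\<in>acarrier (alg_of_emod M). k)) \<and>

     \<comment> \<open>the adjunction restricts to the full subcategories and is an equivalence there\<close>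
     (\<forall>A\<in>(Alg_obs :: 'a ealg set). emod_of_alg A \<in> BEMod) \<and>
     (\<forall>M\<in>(BEMod :: 'd emod set). alg_of_emod M \<in> Alg_obs) \<and>
     (\<forall>A\<in>(Alg_obs :: 'a ealg set). Alg_iso A (alg_of_emod (emod_of_alg A)) (adj_unit A)) \<and>
     (\<forall>M\<in>(BEMod :: 'd emod set). EMod_iso M (emod_of_alg (alg_of_emod M)) (adj_counit M)) \<and>

     \<comment> \<open>isomorphism of categories, the identity on underlying maps\<close>
     bij_betw cch_of_alg (Alg_obs :: 'a ealg set) (CCH_obs :: 'a cch set) \<and>
     (\<forall>A\<in>(Alg_obs :: 'a ealg set). \<forall>B\<in>(Alg_obs :: 'b ealg set).
        Alg_hom A B = CCH_hom (cch_of_alg A) (cch_of_alg B))"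
proof (intro conjI ballI)
  show "emod_of_alg A \<in> EMod" if "A \<in> Alg" for A :: "'a ealg"
    using emod_of_alg_BEMod[OF that] by (simp add: BEMod_def)
  show "emod_of_alg_map A B f \<in> EMod_hom (emod_of_alg B) (emod_of_alg A)"
    if "A \<in> Alg" "B \<in> Alg" "f \<in> Alg_hom A B" for A :: "'a ealg" and B :: "'b ealg" and f
    using that by (rule emod_of_alg_map_hom)
  show "emod_of_alg_map A C (compose (acarrier A) g f) =
      compose (ecarrier (emod_of_alg C)) (emod_of_alg_map A B f) (emod_of_alg_map B C g)"
    if "B \<in> Alg" "f \<in> Alg_hom A B" "g \<in> Alg_hom B C"
    for A :: "'a ealg" and B :: "'b ealg" and C :: "'c ealg" and f g
    using that by (rule emod_of_alg_map_comp)
  show "alg_of_emod M \<in> Alg" if "M \<in> EMod" for M :: "'d emod"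
    using that by (intro emodule.alg_of_emod_Alg) (simp add: emodule_iff)
  show "alg_of_emod_map M N f \<in> Alg_hom (alg_of_emod N) (alg_of_emod M)"
    if "M \<in> EMod" "N \<in> EMod" "f \<in> EMod_hom M N" for M :: "'d emod" and N :: "'e emod" and f
    using that by (rule alg_of_emod_map_hom)
  show "alg_of_emod_map M P (compose (ecarrier M) g f) =
      compose (acarrier (alg_of_emod P)) (alg_of_emod_map M N f) (alg_of_emod_map N P g)"
    if "N \<in> EMod" "P \<in> EMod" "f \<in> EMod_hom M N" "g \<in> EMod_hom N P"
    for M :: "'d emod" and N :: "'e emod" and P :: "'f emod" and f g
    using that by (rule alg_of_emod_map_comp)
  show "alg_of_emod M \<in> Alg_obs" if "M \<in> BEMod" for M :: "'d emod"
    using that by (intro alg_of_emod_Alg_obs) (simp add: BEMod_def)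
  show "emod_of_alg A \<in> BEMod" if "A \<in> Alg_obs" for A :: "'a ealg"
    using emod_of_alg_BEMod Alg_obsD(1) that by blast
  show "Alg_iso A (alg_of_emod (emod_of_alg A)) (adj_unit A)" if "A \<in> Alg_obs" for A :: "'a ealg"
    by (rule adj_unit_iso[OF Alg_obsD[OF that]])
  show "EMod_iso M (emod_of_alg (alg_of_emod M)) (adj_counit M)" if "M \<in> BEMod" for M :: "'d emod"
    using that by (intro emodule.adj_counit_iso) (simp_all add: emodule_iff BEMod_def)
qed (rule emod_of_alg_map_id alg_of_emod_map_id adj_unit_hom adj_unit_natural adj_counit_hom
  adj_counit_natural triangle_left triangle_right bij_cch_of_alg Alg_hom_eq_CCH_hom; assumption)+

end
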